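(* Let $p(\cdot)\in C^{\log}(\mathbb R^n)$. If $p_-\in(1,\infty)$, then $$W\!H^{p(\cdot)}(\mathbb R^n)=W\!L^{p(\cdot)}(\mathbb R^n)$$ with equivalent quasi-norms.
   Context: **Variable exponents.** $\mathcal P(\mathbb R^n)$ is the set of all measurable functions $p(\cdot):\mathbb R^n\to(0,\infty)$ with $0<p_-\le p_+<\infty$, where $p_-:=\operatorname{ess\,inf}_{x\in\mathbb R^n}p(x)$ and $p_+:=\operatorname{ess\,sup}_{x\in\mathbb R^n}p(x)$. Put $\underline p:=\min\{p_-,1\}$. A function $p(\cdot)\in\mathcal P(\mathbb R^n)$ belongs to $C^{\log}(\mathbb R^n)$ (globally log-Hölder continuous) if there exist positive constants $C_{\log}(p)$, $C_\infty$ and $p_\infty\in\mathbb R$ such that for all $x,y\in\mathbb R^n$, $$|p(x)-p(y)|\le\frac{C_{\log}(p)}{\log(e+1/|x-y|)}\quad\text{and}\quad |p(x)-p_\infty|\le\frac{C_\infty}{\log(e+|x|)}.$$ **Variable (weak) Lebesgue spaces.** For $p(\cdot)\in\mathcal P(\mathbb R^n)$ and measurable $f$, $\|f\|_{L^{p(\cdot)}(\mathbb R^n)}:=\inf\{\lambda\in(0,\infty):\int_{\mathbb R^n}(|f(x)|/\lambda)^{p(x)}\,dx\le1\}$. $W\!L^{p(\cdot)}(\mathbb R^n)$ is the set of measurable $f$ with $$\|f\|_{W\!L^{p(\cdot)}(\mathbb R^n)}:=\sup_{\alpha\in(0,\infty)}\alpha\left\|\chi_{\{x\in\mathbb R^n:\,|f(x)|>\alpha\}}\right\|_{L^{p(\cdot)}(\mathbb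 R^n)}<\infty.$$ **Grand maximal function.** $\mathcal S(\mathbb R^n)$ denotes the Schwartz space and $\mathcal S'(\mathbb R^n)$ the space of tempered distributions. For $N\in\mathbb N$, $$\mathcal F_N(\mathbb R^n):=\Big\{\psi\in\mathcal S(\mathbb R^n):\ \sum_{\beta\in\mathbb Z_+^n,\,|\beta|\le N}\sup_{x\in\mathbb R^n}\big[(1+|x|)^N|D^\beta\psi(x)|\big]\le1\Big\},$$ where $\mathbb Z_+=\{0,1,2,\dots\}$. For $f\in\mathcal S'(\mathbb R^n)$ and $x\in\mathbb R^n$, $$f^\ast_{N,+}(x):=\sup\{|f\ast\psi_t(x)|:\ t\in(0,\infty),\ \psi\in\mathcal F_N(\mathbb R^n)\},\qquad \psi_t(\xi):=t^{-n}\psi(\xi/t).$$ **Variable weak Hardy space.** For $p(\cdot)\in C^{\log}(\mathbb R^n)$ fix a positive integer $N\in(\frac n{\underline p}+n+1,\infty)$. Then $W\!H^{p(\cdot)}(\mathbb R^n)$ is the set of $f\in\mathcal S'(\mathbb R^n)$ with $\|f\|_{W\!H^{p(\cdot)}(\mathbb R^n)}:=\|f^\ast_{N,+}\|_{W\!L^{p(\cdot)}(\mathbb R^n)}<\infty$. The equality of spaces is understood under the usual identification of locally integrable functions (modulo equality a.e.) with the distributions they define; "equivalent quasi-norms" means each quasi-norm is bounded by a constant, independent of $f$, times the other. *)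

theory Defs
  imports "HOL-Analysis.Analysis" "HOL-Probability.Essential_Supremum"
begin

section \<open>Variable exponents\<close>

definition p_minus :: "(real^'n \<Rightarrow> real) \<Rightarrow> ereal" where
  "p_minus p = Sup {z. AE x in lebesgue. z \<le> ereal (p x)}"

definition p_plus :: "(real^'n \<Rightarrow> real) \<Rightarrow> ereal" where
  "p_plus p = esssup lebesgue (\<lambda>x. ereal (p x))"

definition p_underline :: "(real^'n \<Rightarrow> real) \<Rightarrow> ereal" where
  "p_underline p = min (p_minus p) 1"

definition variable_exponents :: "(real^'n \<Rightarrow> real) set" where
  "variable_exponents =
     {p. p \<in> borel_measurable lebesgue \<and> (\<forall>x. 0 < p x) \<and>
         0 < p_minus p \<and> p_minus p \<le> p_plus p \<and> p_plus p < \<infinity>}"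

text \<open>For \<open>x = y\<close> the first bound reads \<open>0 \<le> C\<close>, since \<open>1 / 0 = 0\<close>; with the
  convention \<open>1 / 0 = \<infinity>\<close> it is equally vacuous.\<close>

definition log_Hoelder_exponents :: "(real^'n \<Rightarrow> real) set" where
  "log_Hoelder_exponents =
     {p \<in> variable_exponents.
        \<exists>C_log>0. \<exists>C_inf>0. \<exists>p_inf.
          (\<forall>x y. \<bar>p x - p y\<bar> \<le> C_log / ln (exp 1 + 1 / norm (x - y))) \<and>
          (\<forall>x. \<bar>p x - p_inf\<bar> \<le> C_inf / ln (exp 1 + norm x))}"


section \<open>Variable and variable weak Lebesgue spaces\<close>

definition Lp_norm :: "(real^'n \<Rightarrow> real) \<Rightarrow> (real^'n \<Rightarrow> real) \<Rightarrow> ennreal" where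
  "Lp_norm p f =
     Inf {ennreal l |l. 0 < l \<and> (\<integral>\<^sup>+x. ennreal ((\<bar>f x\<bar> / l) powr p x) \<partial>lebesgue) \<le> 1}"

text \<open>The quasi-norm is defined for functions with values in \<open>[0, \<infinity>]\<close>, because the grand
  maximal function of a tempered distribution may take the value \<open>\<infinity>\<close>.\<close>

definition WLp_norm_nn :: "(real^'n \<Rightarrow> real) \<Rightarrow> (real^'n \<Rightarrow> ennreal) \<Rightarrow> ennreal" where
  "WLp_norm_nn p g =
     (SUP \<alpha>\<in>{0<..}. ennreal \<alpha> * Lp_norm p (indicator {x. ennreal \<alpha> < g x}))"

definition WLp_norm :: "(real^'n \<Rightarrow> real) \<Rightarrow> (real^'n \<Rightarrow> complex) \<Rightarrow> ennreal" where
  "WLp_norm p f = WLp_norm_nn p (\<lambda>x. ennreal (norm (f x)))"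

definition WLp :: "(real^'n \<Rightarrow> real) \<Rightarrow> (real^'n \<Rightarrow> complex) set" where
  "WLp p = {f \<in> borel_measurable lebesgue. WLp_norm p f < \<infinity>}"


section \<open>Schwartz functions and tempered distributions\<close>

definition partial :: "'n \<Rightarrow> (real^'n \<Rightarrow> complex) \<Rightarrow> real^'n \<Rightarrow> complex" where
  "partial i f x = vector_derivative (\<lambda>t. f (x + t *\<^sub>R axis i 1)) (at 0)"

definition smooth :: "(real^'n \<Rightarrow> complex) \<Rightarrow> bool" where
  "smooth f \<longleftrightarrow> (\<forall>js. foldr partial js f differentiable_on UNIV)"

text \<open>Multi-indices are functions \<open>'n \<Rightarrow> nat\<close>. As \<open>'n\<close> carries no order, the partial
  derivatives are composed along a fixed enumeration of the coordinates; on smooth functions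
  the result does not depend on it.\<close>

definition coordinates :: "'n::finite list" where
  "coordinates = (SOME js. distinct js \<and> set js = UNIV)"

definition multi_deriv ::
    "('n \<Rightarrow> nat) \<Rightarrow> (real^'n \<Rightarrow> complex) \<Rightarrow> real^'n \<Rightarrow> complex" where
  "multi_deriv \<beta> f = foldr (\<lambda>i. partial i ^^ \<beta> i) coordinates f"

definition schwartz :: "(real^'n \<Rightarrow> complex) set" where
  "schwartz =
     {\<psi>. smooth \<psi> \<and>
         (\<forall>\<beta> m. bdd_above (range (\<lambda>x. (1 + norm x) ^ m * norm (multi_deriv \<beta> \<psi> x))))}"

definition schwartz_norm :: "nat \<Rightarrow> (real^'n \<Rightarrow> complex) \<Rightarrow> real" where
  "schwartz_norm N \<psi> =
     (\<Sum>\<beta> | (\<Sum>i\<in>UNIV. \<beta> i) \<le> N. SUP x. (1 + norm x) ^ N * norm (multi_deriv \<beta> \<psi> x))"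

definition schwartz_topology :: "(real^'n \<Rightarrow> complex) topology" where
  "schwartz_topology =
     topology_generated_by
       {{\<psi> \<in> schwartz. schwartz_norm m (\<lambda>x. \<psi> x - \<phi> x) < \<epsilon>} |\<phi> m \<epsilon>. \<phi> \<in> schwartz \<and> 0 < \<epsilon>}"

text \<open>Functionals are \<open>undefined\<close> outside the Schwartz space, so that equality of distributions
  is equality as functionals on Schwartz functions.\<close>

definition tempered :: "((real^'n \<Rightarrow> complex) \<Rightarrow> complex) set" where
  "tempered =
     {T \<in> extensional schwartz.
        (\<forall>\<phi>\<in>schwartz. \<forall>\<psi>\<in>schwartz. T (\<lambda>x. \<phi> x + \<psi> x) = T \<phi> + T \<psi>) \<and>
        (\<forall>c. \<forall>\<phi>\<in>schwartz. T (\<lambda>x. c * \<phi> x) = c * T \<phi>) \<and>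
        continuous_map schwartz_topology euclidean T}"

text \<open>The locally integrable function \<open>f\<close> is identified with the tempered distribution \<open>T\<close>.\<close>

definition induces ::
    "(real^'n \<Rightarrow> complex) \<Rightarrow> ((real^'n \<Rightarrow> complex) \<Rightarrow> complex) \<Rightarrow> bool" where
  "induces f T \<longleftrightarrow>
     f \<in> borel_measurable lebesgue \<and>
     (\<forall>K. compact K \<longrightarrow> f absolutely_integrable_on K) \<and>
     T \<in> tempered \<and>
     (\<forall>\<phi>\<in>schwartz. integrable lebesgue (\<lambda>x. f x * \<phi> x) \<and>
                    T \<phi> = integral\<^sup>L lebesgue (\<lambda>x. f x * \<phi> x))"


section \<open>Grand maximal function and variable weak Hardy space\<close>

definition F_class :: "nat \<Rightarrow> (real^'n \<Rightarrow> complex) set" where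
  "F_class N = {\<psi> \<in> schwartz. schwartz_norm N \<psi> \<le> 1}"

definition dilate :: "real \<Rightarrow> (real^'n \<Rightarrow> complex) \<Rightarrow> real^'n \<Rightarrow> complex" where
  "dilate t \<psi> \<xi> = (1 / t ^ CARD('n)) *\<^sub>R \<psi> (\<xi> /\<^sub>R t)"

definition convolve ::
    "((real^'n \<Rightarrow> complex) \<Rightarrow> complex) \<Rightarrow> (real^'n \<Rightarrow> complex) \<Rightarrow> real^'n \<Rightarrow> complex" where
  "convolve T \<phi> x = T (\<lambda>y. \<phi> (x - y))"

definition grand_maximal ::
    "nat \<Rightarrow> ((real^'n \<Rightarrow> complex) \<Rightarrow> complex) \<Rightarrow> real^'n \<Rightarrow> ennreal" where
  "grand_maximal N T x =
     (SUP t\<in>{0<..}. SUP \<psi>\<in>F_class N. ennreal (norm (convolve T (dilate t \<psi>) x)))"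

definition WHp_norm ::
    "(real^'n \<Rightarrow> real) \<Rightarrow> nat \<Rightarrow> ((real^'n \<Rightarrow> complex) \<Rightarrow> complex) \<Rightarrow> ennreal" where
  "WHp_norm p N T = WLp_norm_nn p (grand_maximal N T)"

definition WHp ::
    "(real^'n \<Rightarrow> real) \<Rightarrow> nat \<Rightarrow> ((real^'n \<Rightarrow> complex) \<Rightarrow> complex) set" where
  "WHp p N = {T \<in> tempered. WHp_norm p N T < \<infinity>}"

end

theory Submission
  imports Defs "HOL-Library.Sublist"
begin

text \<open>
  Since \<open>p\<^sub>- > 1\<close>, the space \<open>WLp p\<close> is contained in \<open>L\<^sup>1 + L\<^sup>\<infinity>\<close>, so its elements induce tempered
  distributions, and the grand maximal function is dominated by averages over balls. A Vitali
  covering reduces the weak maximal inequality at level \<open>a\<close> to comparing \<open>a powr p x\<close> inside one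
  ball. For \<open>a \<ge> 1\<close> the selected balls have volume at most a constant times \<open>1 / a\<close>, and the local
  log-Hoelder condition suffices; for \<open>a < 1\<close> the decay condition allows one to replace \<open>p x\<close> by
  the limit exponent, up to an integrable error.

  Conversely, let \<open>T\<close> have a grand maximal function in weak \<open>L\<^sup>p\<close>. Testing \<open>T\<close> against a smooth
  partition of unity of mesh \<open>2\<^sup>-\<^sup>k\<close> yields step functions that are pointwise dominated by the grand
  maximal function and converge to \<open>T\<close> on test functions. A limit point of these step functions,
  obtained from Tychonoff's theorem and the Radon-Nikodym theorem, induces \<open>T\<close>. Only inclusions
  between level sets are used, so that measurability of the grand maximal function is irrelevant.
\<close>

section \<open>Partial derivatives\<close>

text \<open>The modular \<open>\<integral>b powr p x\<close> is not homogeneous. Estimates are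
  therefore made for functions already divided by a number above their quasi-norm, and constants
  return to the norm only at the end, where \<open>1 \<le> p x\<close> lets a factor
  \<open>K \<ge> 1\<close> be absorbed into the level.

  The assumption \<open>p\<^sub>- > 1\<close> acts in two places. It gives
  \<open>2 < 2 powr pm\<close>, so the dyadic layers of a weakly bounded function have a convergent
  geometric sum; and it gives \<open>p_inf > 1\<close>, so \<open>a powr (p_inf - 1)\<close> decays
  as \<open>a\<close> tends to 0, which makes the error of passing to the limit exponent integrable.

  Weakly bounded functions need not be integrable on the whole space. One weight,
  \<open>(1 + |x|)\<close> to the power \<open>-(n + 1)\<close>, repairs this everywhere: it makes
  the pairing with Schwartz functions converge, bounds the errors above, and turns the dominating
  function of the step functions into an integrable one before the weak limit is taken.

  The step functions are controlled by the grand maximal function because the bump of the cell of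
  \<open>x\<close> is, up to normalisation, a dilated test function centred at \<open>x\<close>
  whose Schwartz norm is bounded independently of \<open>x\<close> and of the mesh.\<close>

abbreviation pd :: "'n list \<Rightarrow> (real^'n \<Rightarrow> complex) \<Rightarrow> real^'n \<Rightarrow> complex" where
  "pd js f \<equiv> foldr partial js f"

lemma partial_eq:
  assumes "(f has_derivative f') (at x)"
  shows "partial i f x = f' (axis i 1)"
proof -
  have "((\<lambda>t. x + t *\<^sub>R axis i 1) has_vector_derivative axis i 1) (at 0)"
    by (auto intro!: derivative_eq_intros simp: has_vector_derivative_def)
  then have "(f \<circ> (\<lambda>t. x + t *\<^sub>R axis i 1) has_vector_derivative f' (axis i 1)) (at 0)"
    using vector_derivative_diff_chain_within[of "\<lambda>t. x + t *\<^sub>R axis i 1" "axis i 1" 0 UNIV f f'] assms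
    by (auto intro: has_derivative_at_withinI)
  then show ?thesis
    unfolding partial_def by (intro vector_derivative_at) (simp add: comp_def)
qed

lemma smooth_differentiable: "smooth f \<Longrightarrow> f differentiable (at x)"
  unfolding smooth_def differentiable_on_def by (metis UNIV_I foldr.simps(1) id_apply)

lemma smooth_pd: "smooth f \<Longrightarrow> smooth (pd js f)"
  unfolding smooth_def by (metis foldr_append comp_apply)

lemma smooth_partial: "smooth f \<Longrightarrow> smooth (partial i f)"
  using smooth_pd[of f "[i]"] by simp

lemma smooth_continuous: "smooth f \<Longrightarrow> continuous_on S f"
  using smooth_differentiable differentiable_imp_continuous_within continuous_on_eq_continuous_within
  by (metis continuous_at_imp_continuous_at_within)

lemma partial_add:
  assumes "\<And>x. f differentiable (at x)" "\<And>x. g differentiable (at x)"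
  shows "partial i (\<lambda>x. f x + g x) = (\<lambda>x. partial i f x + partial i g x)"
proof
  fix x
  note f = assms(1)[unfolded frechet_derivative_works, of x] and g = assms(2)[unfolded frechet_derivative_works, of x]
  show "partial i (\<lambda>x. f x + g x) x = partial i f x + partial i g x"
    using partial_eq[OF has_derivative_add[OF f g], of i] partial_eq[OF f, of i] partial_eq[OF g, of i] by simp
qed

lemma partial_mult:
  assumes "\<And>x. f differentiable (at x)" "\<And>x. g differentiable (at x)"
  shows "partial i (\<lambda>x. f x * g x) = (\<lambda>x. partial i f x * g x + f x * partial i g x)"
proof
  fix x
  note f = assms(1)[unfolded frechet_derivative_works, of x] and g = assms(2)[unfolded frechet_derivative_works, of x]
  show "partial i (\<lambda>x. f x * g x) x = partial i f x * g x + f x * partial i g x"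
    using partial_eq[OF has_derivative_mult[OF f g], of i] partial_eq[OF f, of i] partial_eq[OF g, of i] by simp
qed

lemma pd_add:
  assumes "smooth f" "smooth g"
  shows "pd js (\<lambda>x. f x + g x) = (\<lambda>x. pd js f x + pd js g x)"
  by (induction js) (auto simp: partial_add smooth_pd smooth_differentiable assms)

lemma pd_const: "pd js (\<lambda>_. c) = (if js = [] then (\<lambda>_. c) else (\<lambda>_. 0))"
proof (induction js)
  case (Cons j js)
  have "partial j (\<lambda>_. a) = (\<lambda>_. 0)" for a :: complex
    by (rule ext, subst partial_eq[OF has_derivative_const]) simp
  with Cons show ?case by simp
qed simp

lemma smooth_const: "smooth (\<lambda>_. c)"
  by (simp add: smooth_def pd_const differentiable_on_def)

text \<open>Off by one: the predicate at \<open>n\<close> asserts that \<open>f\<close> is \<open>n + 1\<close> times differentiable.\<close>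

primrec times_differentiable :: "nat \<Rightarrow> (real^'n \<Rightarrow> complex) \<Rightarrow> bool" where
  "times_differentiable 0 f \<longleftrightarrow> (\<forall>x. f differentiable (at x))"
| "times_differentiable (Suc n) f \<longleftrightarrow> (\<forall>x. f differentiable (at x)) \<and> (\<forall>i. times_differentiable n (partial i f))"

lemma times_differentiable_SucD: "times_differentiable (Suc n) f \<Longrightarrow> times_differentiable n f"
  by (induction n arbitrary: f) auto

text \<open>Lists of derivatives suit the definition of \<open>smooth\<close>; recursion on first
  derivatives suits closure under sums and products, since the product rule yields a sum of products
  to which the induction hypothesis applies. The last entry of a list is the derivative taken first,
  hence the split \<open>js @ [i]\<close>.\<close>

lemma times_differentiable_iff:
  "times_differentiable n f \<longleftrightarrow> (\<forall>js. length js \<le> n \<longrightarrow> (\<forall>x. pd js f differentiable (at x)))"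
proof (induction n arbitrary: f)
  case (Suc n)
  have "(\<forall>js. length js \<le> Suc n \<longrightarrow> P js) \<longleftrightarrow> P [] \<and> (\<forall>i js. length js \<le> n \<longrightarrow> P (js @ [i]))" for P :: "'a list \<Rightarrow> bool"
    by (metis Suc_le_mono append_butlast_last_id bot_nat_0.extremum length_append_singleton list.size(3))
  from this[of "\<lambda>js. \<forall>x. pd js f differentiable (at x)"] Suc show ?case by auto
qed simp

lemma smooth_iff_times_differentiable: "smooth f \<longleftrightarrow> (\<forall>n. times_differentiable n f)"
  unfolding times_differentiable_iff smooth_def differentiable_on_def by auto

lemma times_differentiable_add:
  "times_differentiable n f \<Longrightarrow> times_differentiable n g \<Longrightarrow> times_differentiable n (\<lambda>x. f x + g x)"
proof (induction n arbitrary: f g)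
  case (Suc n)
  then show ?case by (simp add: partial_add)
qed simp

lemma times_differentiable_mult:
  "times_differentiable n f \<Longrightarrow> times_differentiable n g \<Longrightarrow> times_differentiable n (\<lambda>x. f x * g x)"
proof (induction n arbitrary: f g)
  case (Suc n)
  show ?case
    using Suc.prems Suc.IH[OF times_differentiable_SucD] Suc.IH[OF _ times_differentiable_SucD]
    by (auto simp: partial_mult intro!: times_differentiable_add)
qed simp

lemma smooth_add: "smooth f \<Longrightarrow> smooth g \<Longrightarrow> smooth (\<lambda>x. f x + g x)"
  by (simp add: smooth_iff_times_differentiable times_differentiable_add)

lemma smooth_mult: "smooth f \<Longrightarrow> smooth g \<Longrightarrow> smooth (\<lambda>x. f x * g x)"
  by (simp add: smooth_iff_times_differentiable times_differentiable_mult)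

lemma smooth_cmult: "smooth f \<Longrightarrow> smooth (\<lambda>x. c * f x)"
  by (intro smooth_mult smooth_const)

lemma pd_cmult: "smooth f \<Longrightarrow> pd js (\<lambda>x. c * f x) = (\<lambda>x. c * pd js f x)"
proof (induction js)
  case (Cons j js)
  have "partial j (\<lambda>_. c) = (\<lambda>_. 0)" using pd_const[of "[j]" c] by simp
  with Cons show ?case
    by (simp add: partial_mult smooth_differentiable smooth_pd)
qed simp

lemma
  assumes "smooth f" "smooth g"
  shows smooth_diff: "smooth (\<lambda>x. f x - g x)"
    and pd_diff: "pd js (\<lambda>x. f x - g x) = (\<lambda>x. pd js f x - pd js g x)"
proof -
  have g: "smooth (\<lambda>x. (-1) * g x)" by (rule smooth_cmult) fact
  show "smooth (\<lambda>x. f x - g x)"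
    using smooth_add[OF assms(1) g] by simp
  show "pd js (\<lambda>x. f x - g x) = (\<lambda>x. pd js f x - pd js g x)"
    using pd_add[OF assms(1) g, of js] unfolding pd_cmult[OF assms(2), of js "-1"]
    by (simp only: mult_minus1 add_uminus_conv_diff)
qed

text \<open>Bounds are only required for sublists of \<open>js\<close>. As sublists of ordered lists of coordinates are
  ordered (\<open>subseq_deriv_list\<close>), Leibniz' rule can be used without symmetry of mixed derivatives.\<close>

lemma norm_pd_mult_le:
  assumes "smooth f" "smooth g"
    and "\<And>ks. subseq ks js \<Longrightarrow> norm (pd ks f x) \<le> A"
    and "\<And>ks. subseq ks js \<Longrightarrow> norm (pd ks g x) \<le> B"
  shows "norm (pd js (\<lambda>x. f x * g x) x) \<le> 2 ^ length js * (A * B)"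
  using assms
proof (induction js arbitrary: f g rule: rev_induct)
  case Nil
  from Nil(3)[of "[]"] Nil(4)[of "[]"] show ?case
    by (auto simp: norm_mult intro!: mult_mono order_trans[OF norm_ge_zero])
next
  case (snoc j js)
  \<comment> \<open>A sublist of \<open>js\<close> extends in two ways, according to whether the
    derivative \<open>j\<close> falls on the other factor or on this one.\<close>
  have sub: "subseq ks (js @ [j])" "subseq (ks @ [j]) (js @ [j])" if "subseq ks js" for ks
    using that by (auto intro: list_emb_append2)
  have 1: "norm (pd js (\<lambda>x. partial j f x * g x) x) \<le> 2 ^ length js * (A * B)"
  proof (rule snoc.IH[OF smooth_partial[OF snoc.prems(1)] snoc.prems(2)])
    fix ks assume "subseq ks js"
    from snoc.prems(3)[OF sub(2)[OF this]] snoc.prems(4)[OF sub(1)[OF this]]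
    show "norm (pd ks (partial j f) x) \<le> A" "norm (pd ks g x) \<le> B" by simp_all
  qed
  have 2: "norm (pd js (\<lambda>x. f x * partial j g x) x) \<le> 2 ^ length js * (A * B)"
  proof (rule snoc.IH[OF snoc.prems(1) smooth_partial[OF snoc.prems(2)]])
    fix ks assume "subseq ks js"
    from snoc.prems(3)[OF sub(1)[OF this]] snoc.prems(4)[OF sub(2)[OF this]]
    show "norm (pd ks f x) \<le> A" "norm (pd ks (partial j g) x) \<le> B" by simp_all
  qed
  have "pd (js @ [j]) (\<lambda>x. f x * g x) x = pd js (\<lambda>x. partial j f x * g x) x + pd js (\<lambda>x. f x * partial j g x) x"
    using snoc.prems(1,2) by (simp add: partial_mult smooth_differentiable pd_add smooth_mult smooth_partial)
  with norm_triangle_mono[OF 1 2] show ?case by (simp add: algebra_simps)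
qed

lemma partial_affine:
  assumes "\<And>x. f differentiable (at x)"
  shows "partial i (\<lambda>y. f (a + s *\<^sub>R y)) = (\<lambda>y. of_real s * partial i f (a + s *\<^sub>R y))"
proof
  fix y
  note f = assms[unfolded frechet_derivative_works, of "a + s *\<^sub>R y"]
  interpret linear "frechet_derivative f (at (a + s *\<^sub>R y))"
    using f by (rule has_derivative_linear)
  have "((\<lambda>y. a + s *\<^sub>R y) has_derivative (\<lambda>h. s *\<^sub>R h)) (at y)"
    by (auto intro!: derivative_eq_intros)
  from has_derivative_compose[OF this f]
  have "partial i (\<lambda>y. f (a + s *\<^sub>R y)) y = frechet_derivative f (at (a + s *\<^sub>R y)) (s *\<^sub>R axis i 1)"
    by (rule partial_eq)
  also have "\<dots> = of_real s * partial i f (a + s *\<^sub>R y)"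
    unfolding partial_eq[OF f] scaleR by (rule scaleR_conv_of_real)
  finally show "partial i (\<lambda>y. f (a + s *\<^sub>R y)) y = of_real s * partial i f (a + s *\<^sub>R y)" .
qed

lemma differentiable_affine: "(\<And>x. f differentiable (at x)) \<Longrightarrow> (\<lambda>y. f (a + s *\<^sub>R y)) differentiable (at x)"
  by (rule differentiable_compose[of f]) auto

lemma times_differentiable_cmult: "times_differentiable n f \<Longrightarrow> times_differentiable n (\<lambda>x. c * f x)"
  using times_differentiable_mult smooth_const smooth_iff_times_differentiable by blast

lemma smooth_affine:
  assumes "smooth f"
  shows "smooth (\<lambda>y. f (a + s *\<^sub>R y))"
proof -
  have "times_differentiable n f \<Longrightarrow> times_differentiable n (\<lambda>y. f (a + s *\<^sub>R y))" for n f
  proof (induction n arbitrary: f)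
    case 0
    then show ?case using differentiable_affine[of f] by simp
  next
    case (Suc n)
    then show ?case
      using differentiable_affine[of f] by (auto simp: partial_affine intro!: times_differentiable_cmult)
  qed
  with assms show ?thesis by (simp add: smooth_iff_times_differentiable)
qed

lemma pd_affine:
  assumes "smooth f"
  shows "pd js (\<lambda>y. f (a + s *\<^sub>R y)) = (\<lambda>y. of_real (s ^ length js) * pd js f (a + s *\<^sub>R y))"
proof (induction js)
  case (Cons j js)
  have "partial j (\<lambda>y. of_real (s ^ length js) * pd js f (a + s *\<^sub>R y)) =
    (\<lambda>y. of_real (s ^ length js) * partial j (\<lambda>y. pd js f (a + s *\<^sub>R y)) y)"
    using pd_cmult[OF smooth_affine[OF smooth_pd[OF assms]], of "[j]" "of_real (s ^ length js)"] by simp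
  also have "\<dots> = (\<lambda>y. of_real (s ^ length (j # js)) * pd (j # js) f (a + s *\<^sub>R y))"
    by (simp add: partial_affine smooth_differentiable smooth_pd assms algebra_simps)
  finally show ?case using Cons by simp
qed simp

lemma pd_eq_0_on_open:
  assumes "open S" "\<And>x. x \<in> S \<Longrightarrow> f x = 0" "x \<in> S"
  shows "pd js f x = 0"
  using assms(3)
proof (induction js arbitrary: x)
  case (Cons j js)
  have "((\<lambda>_. 0) has_derivative (\<lambda>_. 0)) (at x)" by simp
  then have "(pd js f has_derivative (\<lambda>_. 0)) (at x)"
    by (rule has_derivative_transform_within_open[OF _ assms(1) Cons.prems]) (simp add: Cons.IH)
  from partial_eq[OF this] show ?case by simp
qed (use assms in simp)

section \<open>Multi-indices as ordered lists of coordinates\<close>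

definition deriv_list :: "('n \<Rightarrow> nat) \<Rightarrow> 'n::finite list" where
  "deriv_list \<beta> = concat (map (\<lambda>i. replicate (\<beta> i) i) coordinates)"

lemma coordinates: "distinct (coordinates :: 'n::finite list)" "set (coordinates :: 'n list) = UNIV"
proof -
  have "\<exists>js :: 'n list. distinct js \<and> set js = UNIV"
    using finite_distinct_list[of "UNIV :: 'n set"] by auto
  from someI_ex[OF this] show "distinct (coordinates :: 'n list)" "set (coordinates :: 'n list) = UNIV"
    unfolding coordinates_def by auto
qed

lemma multi_deriv_eq_pd: "multi_deriv \<beta> f = pd (deriv_list \<beta>) f"
proof -
  have "pd (replicate n i) g = (partial i ^^ n) g" for n i and g :: "real^'a \<Rightarrow> complex"
    by (induction n) auto
  then have "foldr (\<lambda>i. partial i ^^ \<beta> i) cs f = pd (concat (map (\<lambda>i. replicate (\<beta> i) i) cs)) f" for cs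
    by (induction cs) auto
  then show ?thesis unfolding multi_deriv_def deriv_list_def .
qed

lemma length_deriv_list: "length (deriv_list \<beta>) = sum \<beta> UNIV"
proof -
  have "length (deriv_list \<beta>) = sum_list (map \<beta> coordinates)"
    by (simp add: deriv_list_def length_concat comp_def)
  also have "\<dots> = sum \<beta> UNIV"
    using coordinates sum_list_distinct_conv_sum_set by metis
  finally show ?thesis .
qed

text \<open>A sublist splits into sublists of the constant blocks, each of which is constant again;
  the lengths of the pieces are the new exponents. Distinctness of the enumeration keeps the blocks
  independent, so that changing one exponent leaves the others alone.\<close>

lemma subseq_deriv_list:
  assumes "subseq ks (deriv_list \<beta>)"
  shows "\<exists>\<gamma>. ks = deriv_list \<gamma>"
proof -
  have "\<exists>\<gamma>. ks = concat (map (\<lambda>i. replicate (\<gamma> i) i) cs)"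
    if "distinct cs" "subseq ks (concat (map (\<lambda>i. replicate (\<beta> i) i) cs))" for cs ks
    using that
  proof (induction cs arbitrary: ks)
    case (Cons c cs)
    from Cons.prems obtain k1 k2 where k: "ks = k1 @ k2" "subseq k1 (replicate (\<beta> c) c)"
      "subseq k2 (concat (map (\<lambda>i. replicate (\<beta> i) i) cs))"
      by (auto elim: subseq_appendE)
    then obtain \<gamma> where \<gamma>: "k2 = concat (map (\<lambda>i. replicate (\<gamma> i) i) cs)"
      using Cons by auto
    have "set k1 \<subseteq> {c}" using k(2)
      by (auto simp: subseq_conv_nths dest!: in_set_nthsD)
    then have k1: "k1 = replicate (length k1) c"
      by (intro replicate_eqI) auto
    have m: "map (\<lambda>i. replicate ((\<gamma>(c := length k1)) i) i) cs = map (\<lambda>i. replicate (\<gamma> i) i) cs"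
      using Cons.prems(1) by auto
    have "ks = concat (map (\<lambda>i. replicate ((\<gamma>(c := length k1)) i) i) (c # cs))"
      unfolding list.map concat.simps m fun_upd_same using k1[symmetric] k(1) \<gamma> by simp
    then show ?case by blast
  qed auto
  with assms coordinates(1) show ?thesis unfolding deriv_list_def by blast
qed

section \<open>Schwartz functions and tempered distributions\<close>

lemma finite_multi_indices: "finite {\<beta> :: 'n::finite \<Rightarrow> nat. (\<Sum>i\<in>UNIV. \<beta> i) \<le> N}"
proof (rule finite_subset)
  show "{\<beta> :: 'n \<Rightarrow> nat. (\<Sum>i\<in>UNIV. \<beta> i) \<le> N} \<subseteq> (UNIV :: 'n set) \<rightarrow>\<^sub>E {..N}"
  proof safe
    fix \<beta> :: "'n \<Rightarrow> nat" and i assume *: "(\<Sum>i\<in>UNIV. \<beta> i) \<le> N"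
    have "\<beta> i \<le> (\<Sum>i\<in>UNIV. \<beta> i)" by (rule member_le_sum) auto
    with * show "\<beta> i \<le> N" by simp
  qed auto
qed (auto intro: finite_PiE)

lemma schwartz_imp_smooth: "\<psi> \<in> schwartz \<Longrightarrow> smooth \<psi>"
  by (simp add: schwartz_def)

lemma schwartz_bdd:
  "\<psi> \<in> schwartz \<Longrightarrow> bdd_above (range (\<lambda>x. (1 + norm x) ^ m * norm (multi_deriv \<beta> \<psi> x)))"
  by (simp add: schwartz_def)

lemma schwartzI:
  assumes "smooth \<psi>" "\<And>\<beta> m. \<exists>C. \<forall>x. (1 + norm x) ^ m * norm (multi_deriv \<beta> \<psi> x) \<le> C"
  shows "\<psi> \<in> schwartz"
  unfolding schwartz_def using assms by (auto simp: bdd_above_def image_iff)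

lemma schwartz_norm_ge:
  fixes \<psi> :: "real^'n \<Rightarrow> complex"
  assumes "\<psi> \<in> schwartz" "sum \<beta> UNIV \<le> N"
  shows "(1 + norm x) ^ N * norm (multi_deriv \<beta> \<psi> x) \<le> schwartz_norm N \<psi>"
proof -
  let ?S = "\<lambda>\<beta>. SUP x. (1 + norm x) ^ N * norm (multi_deriv \<beta> \<psi> x)"
  have ge: "(1 + norm x) ^ N * norm (multi_deriv \<beta> \<psi> x) \<le> ?S \<beta>" for \<beta> x
    by (rule cSUP_upper[OF UNIV_I schwartz_bdd[OF assms(1)]])
  have "0 \<le> ?S \<beta>" for \<beta>
    using order_trans[OF _ ge[of 0 \<beta>]] by simp
  then have "?S \<beta> \<le> schwartz_norm N \<psi>"
    unfolding schwartz_norm_def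
    by (intro member_le_sum) (auto simp: assms(2) finite_multi_indices)
  with ge show ?thesis by (rule order_trans)
qed

lemma schwartz_norm_nonneg: "\<psi> \<in> schwartz \<Longrightarrow> 0 \<le> schwartz_norm N \<psi>"
  by (rule order_trans[OF _ schwartz_norm_ge[of \<psi> "\<lambda>_. 0" N 0]]) simp_all

lemma schwartz_norm_le:
  fixes \<psi> :: "real^'n \<Rightarrow> complex"
  assumes "\<And>\<beta> x. sum \<beta> UNIV \<le> N \<Longrightarrow> (1 + norm x) ^ N * norm (multi_deriv \<beta> \<psi> x) \<le> K"
  shows "schwartz_norm N \<psi> \<le> real (card {\<beta> :: 'n \<Rightarrow> nat. sum \<beta> UNIV \<le> N}) * K"
  unfolding schwartz_norm_def
  by (rule sum_bounded_above, rule cSUP_least) (use assms in auto)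

lemma schwartz_add: "\<phi> \<in> schwartz \<Longrightarrow> \<psi> \<in> schwartz \<Longrightarrow> (\<lambda>x. \<phi> x + \<psi> x) \<in> schwartz"
proof (rule schwartzI)
  assume *: "\<phi> \<in> schwartz" "\<psi> \<in> schwartz"
  then show "smooth (\<lambda>x. \<phi> x + \<psi> x)" by (intro smooth_add schwartz_imp_smooth)
  fix \<beta> m
  obtain C D where "(1 + norm x) ^ m * norm (multi_deriv \<beta> \<phi> x) \<le> C"
    "(1 + norm x) ^ m * norm (multi_deriv \<beta> \<psi> x) \<le> D" for x
    using schwartz_bdd[OF *(1), of m \<beta>] schwartz_bdd[OF *(2), of m \<beta>] unfolding bdd_above_def by blast
  then have "(1 + norm x) ^ m * (norm (multi_deriv \<beta> \<phi> x) + norm (multi_deriv \<beta> \<psi> x)) \<le> C + D" for x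
    unfolding distrib_left by (intro add_mono)
  moreover have "norm (multi_deriv \<beta> (\<lambda>x. \<phi> x + \<psi> x) x) \<le> norm (multi_deriv \<beta> \<phi> x) + norm (multi_deriv \<beta> \<psi> x)" for x
    unfolding multi_deriv_eq_pd pd_add[OF *[THEN schwartz_imp_smooth]] by (rule norm_triangle_ineq)
  ultimately show "\<exists>C. \<forall>x. (1 + norm x) ^ m * norm (multi_deriv \<beta> (\<lambda>x. \<phi> x + \<psi> x) x) \<le> C"
    by (intro exI[of _ "C + D"] allI) (meson mult_left_mono norm_ge_zero order_trans add_nonneg_nonneg zero_le_one zero_le_power)
qed

lemma schwartz_cmult: "\<psi> \<in> schwartz \<Longrightarrow> (\<lambda>x. c * \<psi> x) \<in> schwartz"
proof (rule schwartzI)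
  assume *: "\<psi> \<in> schwartz"
  then show "smooth (\<lambda>x. c * \<psi> x)" by (intro smooth_cmult schwartz_imp_smooth)
  fix \<beta> m
  obtain C where "(1 + norm x) ^ m * norm (multi_deriv \<beta> \<psi> x) \<le> C" for x
    using schwartz_bdd[OF *, of m \<beta>] unfolding bdd_above_def by blast
  then have "norm c * ((1 + norm x) ^ m * norm (multi_deriv \<beta> \<psi> x)) \<le> norm c * C" for x
    by (intro mult_left_mono) auto
  then show "\<exists>C. \<forall>x. (1 + norm x) ^ m * norm (multi_deriv \<beta> (\<lambda>x. c * \<psi> x) x) \<le> C"
    by (intro exI[of _ "norm c * C"])
      (simp add: multi_deriv_eq_pd pd_cmult[OF schwartz_imp_smooth[OF *]] norm_mult mult.left_commute)
qed

lemma schwartz_diff: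
  assumes "\<phi> \<in> schwartz" "\<psi> \<in> schwartz"
  shows "(\<lambda>x. \<phi> x - \<psi> x) \<in> schwartz"
  using schwartz_add[OF assms(1) schwartz_cmult[OF assms(2), of "-1"]] by simp

lemma zero_schwartz: "(\<lambda>_. 0) \<in> schwartz"
proof (rule schwartzI)
  show "smooth (\<lambda>_. 0)" by (rule smooth_const)
  show "\<exists>C. \<forall>x. (1 + norm x) ^ m * norm (multi_deriv \<beta> (\<lambda>_. 0) x) \<le> C" for \<beta> m
    by (intro exI[of _ 0]) (simp add: multi_deriv_eq_pd pd_const)
qed

lemma schwartz_affine:
  assumes \<psi>: "\<psi> \<in> schwartz" and s: "s \<noteq> 0"
  shows "(\<lambda>y. \<psi> (a + s *\<^sub>R y)) \<in> schwartz"
proof (rule schwartzI)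
  show "smooth (\<lambda>y. \<psi> (a + s *\<^sub>R y))" using \<psi> by (intro smooth_affine schwartz_imp_smooth)
  fix \<beta> m
  obtain C where C: "(1 + norm x) ^ m * norm (multi_deriv \<beta> \<psi> x) \<le> C" for x
    using schwartz_bdd[OF \<psi>, of m \<beta>] unfolding bdd_above_def by blast
  \<comment> \<open>From \<open>\<bar>s\<bar> * norm y \<le> norm (a + s *\<^sub>R y) + norm
    a\<close>: the factor by which the weight can grow under the change of variables.\<close>
  define K where "K = 1 + (1 + norm a) / \<bar>s\<bar>"
  have K: "0 \<le> K" by (simp add: K_def)
  have y: "1 + norm y \<le> K * (1 + norm (a + s *\<^sub>R y))" for y
  proof -
    have "\<bar>s\<bar> * norm y = norm ((a + s *\<^sub>R y) - a)" by simp
    also have "\<dots> \<le> norm (a + s *\<^sub>R y) + norm a" by (rule norm_triangle_ineq4)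
    finally have "norm y \<le> (norm (a + s *\<^sub>R y) + norm a) / \<bar>s\<bar>"
      using s by (simp add: pos_le_divide_eq mult.commute)
    also have "\<dots> \<le> (1 + norm a) * (1 + norm (a + s *\<^sub>R y)) / \<bar>s\<bar>"
      by (intro divide_right_mono) (auto simp: algebra_simps)
    also have "1 + \<dots> \<le> K * (1 + norm (a + s *\<^sub>R y))" unfolding K_def by (simp add: distrib_right)
    finally show ?thesis by simp
  qed
  have "(1 + norm y) ^ m * norm (multi_deriv \<beta> (\<lambda>y. \<psi> (a + s *\<^sub>R y)) y) \<le> \<bar>s\<bar> ^ length (deriv_list \<beta>) * (K ^ m * C)" for y
  proof -
    have "(1 + norm y) ^ m * norm (multi_deriv \<beta> (\<lambda>y. \<psi> (a + s *\<^sub>R y)) y) =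
       \<bar>s\<bar> ^ length (deriv_list \<beta>) * ((1 + norm y) ^ m * norm (multi_deriv \<beta> \<psi> (a + s *\<^sub>R y)))"
      by (simp add: multi_deriv_eq_pd pd_affine[OF schwartz_imp_smooth[OF \<psi>]] norm_mult norm_power)
    also have "(1 + norm y) ^ m * norm (multi_deriv \<beta> \<psi> (a + s *\<^sub>R y)) \<le>
      (K * (1 + norm (a + s *\<^sub>R y))) ^ m * norm (multi_deriv \<beta> \<psi> (a + s *\<^sub>R y))"
      using y by (intro mult_right_mono power_mono) auto
    also have "\<dots> = K ^ m * ((1 + norm (a + s *\<^sub>R y)) ^ m * norm (multi_deriv \<beta> \<psi> (a + s *\<^sub>R y)))"
      by (simp add: power_mult_distrib)
    also have "\<dots> \<le> K ^ m * C" using C K by (intro mult_left_mono) auto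
    finally show ?thesis by (simp add: mult_left_mono)
  qed
  then show "\<exists>C. \<forall>x. (1 + norm x) ^ m * norm (multi_deriv \<beta> (\<lambda>y. \<psi> (a + s *\<^sub>R y)) x) \<le> C" by blast
qed

lemma pd_compact_support_eq_0: 
  assumes "\<And>x. R < norm x \<Longrightarrow> f x = 0" "R < norm x"
  shows "pd js f x = 0"
proof (rule pd_eq_0_on_open)
  show "open (- cball 0 R)" by auto
qed (use assms in auto)

lemma pd_compact_support_bounded:
  fixes f :: "real^'n \<Rightarrow> complex"
  assumes "smooth f" "\<And>x. R < norm x \<Longrightarrow> f x = 0"
  obtains M where "0 \<le> M" "\<And>js x. length js \<le> N \<Longrightarrow> norm (pd js f x) \<le> M"
proof -
  have "\<exists>M. \<forall>x. norm (pd js f x) \<le> M" for js :: "'n list"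
  proof -
    have "bounded (pd js f ` cball 0 R)"
      by (intro compact_imp_bounded compact_continuous_image compact_cball smooth_continuous smooth_pd assms)
    then obtain M where "\<forall>x\<in>cball 0 R. norm (pd js f x) \<le> M"
      unfolding bounded_iff by auto
    then show ?thesis
      using pd_compact_support_eq_0[of R f, OF assms(2)]
      by (intro exI[of _ "max M 0"]) (metis linorder_not_less max.coboundedI1 max.coboundedI2 mem_cball_0 norm_zero order_refl)
  qed
  then obtain M where M: "norm (pd js f x) \<le> M js" for js x by metis
  have M0: "0 \<le> M js" for js using order_trans[OF norm_ge_zero M[of js 0]] .
  have fin: "finite {js :: 'n list. length js \<le> N}"
    using finite_lists_length_le[of "UNIV :: 'n set" N] by simp
  show ?thesis
  proof (rule that[of "\<Sum>js | length js \<le> N. M js"])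
    show "0 \<le> (\<Sum>js | length js \<le> N. M js)" by (intro sum_nonneg M0)
    fix js :: "'n list" and x assume "length js \<le> N"
    then have "M js \<le> (\<Sum>js | length js \<le> N. M js)"
      by (intro member_le_sum fin M0) auto
    with M show "norm (pd js f x) \<le> (\<Sum>js | length js \<le> N. M js)" by (rule order_trans)
  qed
qed

lemma compact_support_schwartz_bound:
  fixes \<psi> :: "real^'n \<Rightarrow> complex"
  assumes "\<And>x. R < norm x \<Longrightarrow> \<psi> x = 0" "0 \<le> M" "0 \<le> R"
    "\<And>x. norm x \<le> R \<Longrightarrow> norm (multi_deriv \<beta> \<psi> x) \<le> M"
  shows "(1 + norm x) ^ m * norm (multi_deriv \<beta> \<psi> x) \<le> (1 + R) ^ m * M"
proof (cases "norm x \<le> R")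
  case True
  with assms show ?thesis by (intro mult_mono power_mono) auto
next
  case False
  then have "multi_deriv \<beta> \<psi> x = 0"
    using pd_compact_support_eq_0[of R \<psi>, OF assms(1)] by (simp add: multi_deriv_eq_pd)
  with assms show ?thesis by simp
qed

lemma schwartz_compact_support:
  fixes \<psi> :: "real^'n \<Rightarrow> complex"
  assumes "smooth \<psi>" "\<And>x. R < norm x \<Longrightarrow> \<psi> x = 0"
  shows "\<psi> \<in> schwartz"
proof (rule schwartzI)
  fix \<beta> :: "'n \<Rightarrow> nat" and m
  obtain M where M: "0 \<le> M" "\<And>js x. length js \<le> length (deriv_list \<beta>) \<Longrightarrow> norm (pd js \<psi> x) \<le> M"
    using pd_compact_support_bounded[OF assms] by blast
  have "\<psi> x = 0" if "max R 0 < norm x" for x using assms(2)[of x] that by simp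
  then have "(1 + norm x) ^ m * norm (multi_deriv \<beta> \<psi> x) \<le> (1 + max R 0) ^ m * M" for x
    by (rule compact_support_schwartz_bound[OF _ M(1)]) (use M(2) in \<open>auto simp: multi_deriv_eq_pd\<close>)
  then show "\<exists>C. \<forall>x. (1 + norm x) ^ m * norm (multi_deriv \<beta> \<psi> x) \<le> C" by blast
qed fact

text \<open>The derivatives are bounded only on the ball that carries \<psi>: the increments of a
  test function over one cell, to which this is applied, are small only there.\<close>

lemma schwartz_norm_compact_support:
  fixes \<psi> :: "real^'n \<Rightarrow> complex"
  assumes "\<And>x. R < norm x \<Longrightarrow> \<psi> x = 0" "0 \<le> M" "0 \<le> R"
    "\<And>js x. length js \<le> N \<Longrightarrow> norm x \<le> R \<Longrightarrow> norm (pd js \<psi> x) \<le> M"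
  shows "schwartz_norm N \<psi> \<le> real (card {\<beta> :: 'n \<Rightarrow> nat. sum \<beta> UNIV \<le> N}) * ((1 + R) ^ N * M)"
proof (rule schwartz_norm_le)
  fix \<beta> :: "'n \<Rightarrow> nat" and x assume *: "sum \<beta> UNIV \<le> N"
  show "(1 + norm x) ^ N * cmod (multi_deriv \<beta> \<psi> x) \<le> (1 + R) ^ N * M"
    by (rule compact_support_schwartz_bound[OF assms(1,2,3)])
      (use assms(4) * in \<open>auto simp: multi_deriv_eq_pd length_deriv_list\<close>)
qed

lemma schwartz_norm_cmult_le:
  assumes "\<psi> \<in> schwartz"
  shows "schwartz_norm N (\<lambda>x. c * \<psi> x) \<le> norm c * schwartz_norm N \<psi>"
  unfolding schwartz_norm_def sum_distrib_left
proof (intro sum_mono cSUP_least)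
  fix \<beta> :: "'a \<Rightarrow> nat" and x :: "real^'a"
  have "(1 + norm x) ^ N * cmod (multi_deriv \<beta> (\<lambda>x. c * \<psi> x) x) = norm c * ((1 + norm x) ^ N * cmod (multi_deriv \<beta> \<psi> x))"
    by (simp add: multi_deriv_eq_pd pd_cmult[OF schwartz_imp_smooth[OF assms]] norm_mult mult.left_commute)
  also have "\<dots> \<le> norm c * (SUP x. (1 + norm x) ^ N * cmod (multi_deriv \<beta> \<psi> x))"
    by (intro mult_left_mono cSUP_upper schwartz_bdd assms) auto
  finally show "(1 + norm x) ^ N * cmod (multi_deriv \<beta> (\<lambda>x. c * \<psi> x) x) \<le> \<dots>" .
qed simp

lemma schwartz_norm_triangle:
  assumes "\<phi> \<in> schwartz" "\<psi> \<in> schwartz"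
  shows "schwartz_norm N (\<lambda>x. \<phi> x + \<psi> x) \<le> schwartz_norm N \<phi> + schwartz_norm N \<psi>"
  unfolding schwartz_norm_def sum.distrib[symmetric]
proof (intro sum_mono cSUP_least)
  fix \<beta> :: "'a \<Rightarrow> nat" and x :: "real^'a"
  have "(1 + norm x) ^ N * cmod (multi_deriv \<beta> (\<lambda>x. \<phi> x + \<psi> x) x) \<le>
     (1 + norm x) ^ N * (cmod (multi_deriv \<beta> \<phi> x) + cmod (multi_deriv \<beta> \<psi> x))"
    unfolding multi_deriv_eq_pd pd_add[OF assms[THEN schwartz_imp_smooth]]
    by (intro mult_left_mono norm_triangle_ineq) auto
  also have "\<dots> = (1 + norm x) ^ N * cmod (multi_deriv \<beta> \<phi> x) + (1 + norm x) ^ N * cmod (multi_deriv \<beta> \<psi> x)"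
    by (rule distrib_left)
  also have "\<dots> \<le> (SUP x. (1 + norm x) ^ N * cmod (multi_deriv \<beta> \<phi> x)) + (SUP x. (1 + norm x) ^ N * cmod (multi_deriv \<beta> \<psi> x))"
    by (intro add_mono cSUP_upper schwartz_bdd assms) auto
  finally show "(1 + norm x) ^ N * cmod (multi_deriv \<beta> (\<lambda>x. \<phi> x + \<psi> x) x) \<le> \<dots>" .
qed simp

lemma schwartz_norm_zero: "schwartz_norm N (\<lambda>_. 0) = 0"
  by (simp add: schwartz_norm_def multi_deriv_eq_pd pd_const)

section \<open>The Schwartz topology and continuity of distributions\<close>

lemma topspace_schwartz: "topspace (schwartz_topology :: (real^'n \<Rightarrow> complex) topology) = schwartz"
proof -
  let ?B = "{{\<psi> \<in> schwartz. schwartz_norm m (\<lambda>x. \<psi> x - \<phi> x) < \<epsilon>} |\<phi> m \<epsilon>. \<phi> \<in> schwartz \<and> 0 < \<epsilon>} :: (real^'n \<Rightarrow> complex) set set"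
  have "\<phi> \<in> \<Union>?B" if "\<phi> \<in> schwartz" for \<phi>
  proof (rule UnionI)
    show "{\<psi> \<in> schwartz. schwartz_norm 0 (\<lambda>x. \<psi> x - \<phi> x) < 1} \<in> ?B"
      using that zero_less_one by blast
    show "\<phi> \<in> {\<psi> \<in> schwartz. schwartz_norm 0 (\<lambda>x. \<psi> x - \<phi> x) < 1}"
      using that by (simp add: schwartz_norm_zero)
  qed
  then show ?thesis
    unfolding schwartz_topology_def topology_generated_by_topspace by blast
qed

lemma tempered_add: "T \<in> tempered \<Longrightarrow> \<phi> \<in> schwartz \<Longrightarrow> \<psi> \<in> schwartz \<Longrightarrow> T (\<lambda>x. \<phi> x + \<psi> x) = T \<phi> + T \<psi>"
  and tempered_cmult: "T \<in> tempered \<Longrightarrow> \<phi> \<in> schwartz \<Longrightarrow> T (\<lambda>x. c * \<phi> x) = c * T \<phi>"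
  by (simp_all add: tempered_def)

lemma tempered_diff:
  assumes "T \<in> tempered" "\<phi> \<in> schwartz" "\<psi> \<in> schwartz"
  shows "T (\<lambda>x. \<phi> x - \<psi> x) = T \<phi> - T \<psi>"
  using tempered_add[OF assms(1,2) schwartz_cmult[OF assms(3), of "-1"]]
    tempered_cmult[OF assms(1,3), of "-1"] by simp

lemma tempered_zero: "T \<in> tempered \<Longrightarrow> T (\<lambda>_. 0) = 0"
  using tempered_cmult[of T "\<lambda>_. 0" 0] zero_schwartz by simp

lemma schwartz_sum: "(\<And>j. j \<in> J \<Longrightarrow> f j \<in> schwartz) \<Longrightarrow> (\<lambda>x. \<Sum>j\<in>J. f j x) \<in> schwartz"
proof (induction J rule: infinite_finite_induct)
  case (insert j J)
  have "(\<lambda>x. f j x + (\<Sum>j\<in>J. f j x)) \<in> schwartz"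
    by (rule schwartz_add) (use insert in auto)
  then show ?case using insert(1,2) by simp
qed (simp_all add: zero_schwartz)

lemma tempered_sum:
  assumes "T \<in> tempered"
  shows "(\<And>j. j \<in> J \<Longrightarrow> f j \<in> schwartz) \<Longrightarrow> T (\<lambda>x. \<Sum>j\<in>J. f j x) = (\<Sum>j\<in>J. T (f j))"
proof (induction J rule: infinite_finite_induct)
  case (insert j J)
  have "T (\<lambda>x. f j x + (\<Sum>j\<in>J. f j x)) = T (f j) + T (\<lambda>x. \<Sum>j\<in>J. f j x)"
    by (rule tempered_add[OF assms _ schwartz_sum]) (use insert in auto)
  with insert show ?case by simp
qed (simp_all add: tempered_zero assms)

text \<open>Continuity refers to a topology generated by a subbasis, so convergence in all seminorms
  is carried through the generation of open sets by induction.\<close>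

lemma tempered_sequentially_continuous:
  fixes \<phi> :: "real^'n \<Rightarrow> complex"
  assumes T: "T \<in> tempered" and \<phi>: "\<phi> \<in> schwartz" "\<And>k. \<phi>' k \<in> schwartz"
    and lim: "\<And>m. (\<lambda>k. schwartz_norm m (\<lambda>x. \<phi>' k x - \<phi> x)) \<longlonglongrightarrow> 0"
  shows "(\<lambda>k. T (\<phi>' k)) \<longlonglongrightarrow> T \<phi>"
proof -
  let ?B = "{{\<psi> \<in> schwartz. schwartz_norm m (\<lambda>x. \<psi> x - \<phi> x) < \<epsilon>} |\<phi> m \<epsilon>. \<phi> \<in> schwartz \<and> 0 < \<epsilon>} :: (real^'n \<Rightarrow> complex) set set"
  have ev: "eventually (\<lambda>k. \<phi>' k \<in> U) sequentially" if "generate_topology_on ?B U" "\<phi> \<in> U" for U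
    using that
  proof (induction rule: generate_topology_on.induct)
    case (Basis s)
    then obtain \<phi>0 m \<epsilon> where s: "s = {\<psi> \<in> schwartz. schwartz_norm m (\<lambda>x. \<psi> x - \<phi>0 x) < \<epsilon>}" "\<phi>0 \<in> schwartz"
      by blast
    \<comment> \<open>The room left by the triangle inequality between \<phi> and the boundary of
      the subbasic set centred at \<open>\<phi>0\<close>.\<close>
    then have pos: "0 < \<epsilon> - schwartz_norm m (\<lambda>x. \<phi> x - \<phi>0 x)" using Basis(2) by simp
    have "eventually (\<lambda>k. schwartz_norm m (\<lambda>x. \<phi>' k x - \<phi> x) < \<epsilon> - schwartz_norm m (\<lambda>x. \<phi> x - \<phi>0 x)) sequentially"
      by (rule order_tendstoD(2)[OF lim pos])
    then show ?case
    proof eventually_elim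
      case (elim k)
      have "schwartz_norm m (\<lambda>x. (\<phi>' k x - \<phi> x) + (\<phi> x - \<phi>0 x)) \<le>
          schwartz_norm m (\<lambda>x. \<phi>' k x - \<phi> x) + schwartz_norm m (\<lambda>x. \<phi> x - \<phi>0 x)"
        by (intro schwartz_norm_triangle schwartz_diff \<phi> s)
      with elim show ?case unfolding s(1) using \<phi>(2) by simp
    qed
  next
    case (UN K)
    then obtain V where "V \<in> K" "\<phi> \<in> V" by blast
    with UN have "eventually (\<lambda>k. \<phi>' k \<in> V) sequentially" by blast
    then show ?case by eventually_elim (use \<open>V \<in> K\<close> in blast)
  qed (auto simp: eventually_conj_iff)
  have "limitin schwartz_topology \<phi>' \<phi> sequentially"
    unfolding limitin_def topspace_schwartz
    using \<phi>(1) ev unfolding schwartz_topology_def openin_topology_generated_by_iff by blast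
  moreover have "continuous_map schwartz_topology euclidean T" using T by (simp add: tempered_def)
  ultimately have "limitin euclidean (T \<circ> \<phi>') (T \<phi>) sequentially"
    by (intro continuous_map_limit)
  then show ?thesis by (simp add: comp_def)
qed

lemma temperedI:
  fixes T :: "(real^'n \<Rightarrow> complex) \<Rightarrow> complex"
  assumes ext: "T \<in> extensional schwartz"
    and add: "\<And>\<phi> \<psi>. \<phi> \<in> schwartz \<Longrightarrow> \<psi> \<in> schwartz \<Longrightarrow> T (\<lambda>x. \<phi> x + \<psi> x) = T \<phi> + T \<psi>"
    and cmult: "\<And>c \<phi>. \<phi> \<in> schwartz \<Longrightarrow> T (\<lambda>x. c * \<phi> x) = c * T \<phi>"
    and bound: "\<And>\<phi>. \<phi> \<in> schwartz \<Longrightarrow> norm (T \<phi>) \<le> C * schwartz_norm m \<phi>"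
  shows "T \<in> tempered"
proof -
  have "openin schwartz_topology {\<phi> \<in> schwartz. T \<phi> \<in> U}" if U: "open U" for U
  proof (subst openin_subopen, safe)
    fix \<phi> assume \<phi>: "\<phi> \<in> schwartz" "T \<phi> \<in> U"
    then obtain e where e: "e > 0" "ball (T \<phi>) e \<subseteq> U" using U openE by blast
    \<comment> \<open>The denominator \<open>\<bar>C\<bar> + 1\<close> is positive whatever the sign
      of \<open>C\<close>.\<close>
    define \<epsilon> where "\<epsilon> = e / (\<bar>C\<bar> + 1)"
    have \<epsilon>: "\<epsilon> > 0" using e by (simp add: \<epsilon>_def)
    let ?V = "{\<psi> \<in> schwartz. schwartz_norm m (\<lambda>x. \<psi> x - \<phi> x) < \<epsilon>}"
    have "openin schwartz_topology ?V"
      unfolding schwartz_topology_def openin_topology_generated_by_iff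
      by (rule generate_topology_on.Basis) (use \<phi> \<epsilon> in blast)
    moreover have "\<phi> \<in> ?V" using \<phi> \<epsilon> by (simp add: schwartz_norm_zero)
    moreover have "T \<psi> \<in> U" if \<psi>: "\<psi> \<in> ?V" for \<psi>
    proof -
      have d: "(\<lambda>x. \<psi> x - \<phi> x) \<in> schwartz" using \<psi> \<phi> by (intro schwartz_diff) auto
      have "T \<psi> = T (\<lambda>x. \<phi> x + (\<psi> x - \<phi> x))" by simp
      also have "\<dots> = T \<phi> + T (\<lambda>x. \<psi> x - \<phi> x)" by (rule add[OF \<phi>(1) d])
      finally have "dist (T \<phi>) (T \<psi>) = norm (T (\<lambda>x. \<psi> x - \<phi> x))" by (simp add: dist_norm norm_minus_commute)
      also have "\<dots> \<le> C * schwartz_norm m (\<lambda>x. \<psi> x - \<phi> x)" by (rule bound[OF d])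
      also have "\<dots> \<le> (\<bar>C\<bar> + 1) * schwartz_norm m (\<lambda>x. \<psi> x - \<phi> x)"
        by (intro mult_right_mono schwartz_norm_nonneg d) auto
      also have "\<dots> < (\<bar>C\<bar> + 1) * \<epsilon>" using \<psi> by (intro mult_strict_left_mono) auto
      also have "\<dots> = e" by (simp add: \<epsilon>_def add_nonneg_pos less_imp_neq[symmetric])
      finally show ?thesis using e(2) by auto
    qed
    ultimately show "\<exists>V. openin schwartz_topology V \<and> \<phi> \<in> V \<and> V \<subseteq> {\<phi> \<in> schwartz. T \<phi> \<in> U}"
      by (intro exI[of _ ?V]) blast
  qed
  then have "continuous_map schwartz_topology euclidean T"
    unfolding continuous_map_def topspace_schwartz by (auto simp flip: open_openin)
  with ext add cmult show ?thesis by (simp add: tempered_def)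
qed

section \<open>Dilated test functions and cutoffs\<close>

lemma dilate_reflect:
  assumes "t > 0"
  shows "(\<lambda>y. dilate t \<psi> (x - y)) =
    (\<lambda>y. of_real (1 / t ^ CARD('n)) * \<psi> ((1 / t) *\<^sub>R x + (- 1 / t) *\<^sub>R (y :: real^'n)))"
proof
  fix y :: "real^'n"
  have "(x - y) /\<^sub>R t = (1 / t) *\<^sub>R x + (- 1 / t) *\<^sub>R y"
    by (simp add: scaleR_diff_right divide_inverse)
  then show "dilate t \<psi> (x - y) = of_real (1 / t ^ CARD('n)) * \<psi> ((1 / t) *\<^sub>R x + (- 1 / t) *\<^sub>R y)"
    by (simp add: dilate_def scaleR_conv_of_real)
qed

lemma dilate_reflect_schwartz: "\<psi> \<in> schwartz \<Longrightarrow> t > 0 \<Longrightarrow> (\<lambda>y. dilate t \<psi> (x - y)) \<in> schwartz"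
  by (subst dilate_reflect, assumption, intro schwartz_cmult schwartz_affine) auto

text \<open>\<open>F_class\<close> is normalised by 1, so \<psi> is first divided by a bound of its
  norm. A positive \<open>K\<close> above the norm is used for the division because the norm itself
  may vanish.\<close>

lemma norm_le_grand_maximal:
  assumes T: "T \<in> tempered" and \<psi>: "\<psi> \<in> schwartz" "schwartz_norm N \<psi> \<le> K" and "K > 0" "t > 0"
  shows "ennreal (norm (T (\<lambda>y. dilate t \<psi> (x - y)))) \<le> ennreal K * grand_maximal N T x"
proof -
  define \<psi>' where "\<psi>' = (\<lambda>y. of_real (1 / K) * \<psi> y)"
  have S: "\<psi>' \<in> schwartz" unfolding \<psi>'_def by (rule schwartz_cmult[OF \<psi>(1)])
  have "schwartz_norm N \<psi>' \<le> norm (of_real (1 / K) :: complex) * schwartz_norm N \<psi>"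
    unfolding \<psi>'_def by (rule schwartz_norm_cmult_le[OF \<psi>(1)])
  also have "\<dots> \<le> 1" using \<psi>(2) \<open>K > 0\<close> by (simp add: norm_divide divide_simps)
  finally have F: "\<psi>' \<in> F_class N" using S by (simp add: F_class_def)
  have "(\<lambda>y. dilate t \<psi> (x - y)) = (\<lambda>y. of_real K * dilate t \<psi>' (x - y))"
    using \<open>K > 0\<close> by (auto simp: dilate_def \<psi>'_def scaleR_conv_of_real)
  then have "norm (T (\<lambda>y. dilate t \<psi> (x - y))) = K * norm (convolve T (dilate t \<psi>') x)"
    using tempered_cmult[OF T dilate_reflect_schwartz[OF S \<open>t > 0\<close>, of x], of "of_real K"] \<open>K > 0\<close>
    by (simp add: convolve_def norm_mult)
  moreover have "ennreal (norm (convolve T (dilate t \<psi>') x)) \<le> grand_maximal N T x"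
    unfolding grand_maximal_def using F \<open>t > 0\<close> by (intro SUP_upper2[of t] SUP_upper2[of \<psi>']) auto
  ultimately show ?thesis
    using \<open>K > 0\<close> by (simp add: ennreal_mult mult_left_mono)
qed

text \<open>The difference vanishes on the ball of radius \<open>Suc k\<close>. Outside it, the
  seminorm of order \<open>Suc m\<close> of \<phi> supplies one power of \<open>1 + norm x\<close>
  more than the seminorm of order \<open>m\<close> consumes, and this surplus is worth a factor
  \<open>1 / Suc k\<close>. Stretching the cutoff only decreases its derivatives.\<close>

lemma cutoff_tendsto:
  fixes \<phi> cut :: "real^'n \<Rightarrow> complex"
  assumes \<phi>: "\<phi> \<in> schwartz" and cut: "smooth cut" "\<And>x. R < norm x \<Longrightarrow> cut x = 0" "\<And>x. norm x < 1 \<Longrightarrow> cut x = 1"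
  shows "(\<lambda>k. schwartz_norm m (\<lambda>x. \<phi> x * cut (x /\<^sub>R real (Suc k)) - \<phi> x)) \<longlonglongrightarrow> 0"
proof -
  obtain M where M: "0 \<le> M" "\<And>js x. length js \<le> m \<Longrightarrow> norm (pd js cut x) \<le> M"
    using pd_compact_support_bounded[OF cut(1,2)] by blast
  define S where "S = schwartz_norm (Suc m) \<phi>"
  have S: "0 \<le> S" unfolding S_def by (rule schwartz_norm_nonneg[OF \<phi>])
  define c where "c = real (card {\<beta> :: 'n \<Rightarrow> nat. sum \<beta> UNIV \<le> m})"
  define d where "d = (\<lambda>k x. cut (x /\<^sub>R real (Suc k)) - 1)"
  have d_smooth: "smooth (d k)" for k
    unfolding d_def using smooth_affine[OF cut(1), of 0 "inverse (real (Suc k))"]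
    by (intro smooth_diff smooth_const) simp
  have d_bound: "norm (pd js (d k) x) \<le> M + 1" if "length js \<le> m" for js k x
  proof -
    have "smooth (\<lambda>x. cut (x /\<^sub>R real (Suc k)))"
      using smooth_affine[OF cut(1), of 0 "inverse (real (Suc k))"] by simp
    then have "pd js (d k) x = of_real (inverse (real (Suc k)) ^ length js) * pd js cut (x /\<^sub>R real (Suc k)) - pd js (\<lambda>_. 1) x"
      unfolding d_def using pd_affine[OF cut(1), of js 0 "inverse (real (Suc k))"]
      by (subst pd_diff[OF _ smooth_const]) simp_all
    also have "norm \<dots> \<le> norm (of_real (inverse (real (Suc k)) ^ length js) * pd js cut (x /\<^sub>R real (Suc k))) + norm (pd js (\<lambda>_. 1) x)"
      by (rule norm_triangle_ineq4)
    also have "\<dots> \<le> 1 * M + 1"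
    proof (intro add_mono)
      have "inverse (real (Suc k)) ^ length js \<le> 1"
        by (intro power_le_one) (auto simp: inverse_le_1_iff)
      then show "norm (of_real (inverse (real (Suc k)) ^ length js) * pd js cut (x /\<^sub>R real (Suc k))) \<le> 1 * M"
        unfolding norm_mult norm_of_real using M(2)[OF that] M(1)
        by (intro mult_mono) auto
    qed (simp add: pd_const)
    finally show ?thesis by simp
  qed
  have bound: "schwartz_norm m (\<lambda>x. \<phi> x * d k x) \<le> c * (2 ^ m * (S * (M + 1))) / real (Suc k)" for k
  proof -
    have "schwartz_norm m (\<lambda>x. \<phi> x * d k x) \<le> c * ((2 ^ m * (S * (M + 1))) / real (Suc k))"
      unfolding c_def
    proof (rule schwartz_norm_le)
      fix \<beta> :: "'n \<Rightarrow> nat" and x :: "real^'n"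
      assume \<beta>: "sum \<beta> UNIV \<le> m"
      then have len: "length (deriv_list \<beta>) \<le> m" by (simp add: length_deriv_list)
      show "(1 + norm x) ^ m * norm (multi_deriv \<beta> (\<lambda>x. \<phi> x * d k x) x) \<le> 2 ^ m * (S * (M + 1)) / real (Suc k)"
      proof (cases "norm x < real (Suc k)")
        case True
        have "pd (deriv_list \<beta>) (\<lambda>x. \<phi> x * d k x) x = 0"
        proof (rule pd_eq_0_on_open)
          show "x \<in> ball 0 (real (Suc k))" using True by simp
          fix y :: "real^'n" assume "y \<in> ball 0 (real (Suc k))"
          then have "norm (y /\<^sub>R real (Suc k)) < 1" by (simp add: divide_simps)
          then show "\<phi> y * d k y = 0" unfolding d_def using cut(3) by simp
        qed simp
        then show ?thesis using S M by (simp add: multi_deriv_eq_pd)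
      next
        case False
        have "norm (pd (deriv_list \<beta>) (\<lambda>x. \<phi> x * d k x) x) \<le> 2 ^ length (deriv_list \<beta>) * (S / (1 + norm x) ^ Suc m * (M + 1))"
        proof (rule norm_pd_mult_le[OF schwartz_imp_smooth[OF \<phi>] d_smooth])
          fix ks assume ks: "subseq ks (deriv_list \<beta>)"
          then have kl: "length ks \<le> m" using list_emb_length[OF ks] len by simp
          obtain \<gamma> where \<gamma>: "ks = deriv_list \<gamma>" using subseq_deriv_list[OF ks] by blast
          with kl have "sum \<gamma> UNIV \<le> Suc m" by (simp add: length_deriv_list)
          from schwartz_norm_ge[OF \<phi> this, of x]
          show "norm (pd ks \<phi> x) \<le> S / (1 + norm x) ^ Suc m"
            by (simp add: S_def \<gamma> multi_deriv_eq_pd pos_le_divide_eq mult.commute add_pos_nonneg)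
          show "norm (pd ks (d k) x) \<le> M + 1" by (rule d_bound[OF kl])
        qed
        also have "\<dots> \<le> 2 ^ m * (S / (1 + norm x) ^ Suc m * (M + 1))"
          using len S M by (intro mult_right_mono power_increasing) auto
        finally have "(1 + norm x) ^ m * norm (multi_deriv \<beta> (\<lambda>x. \<phi> x * d k x) x) \<le>
           (1 + norm x) ^ m * (2 ^ m * (S / (1 + norm x) ^ Suc m * (M + 1)))"
          unfolding multi_deriv_eq_pd by (intro mult_left_mono) auto
        also have "\<dots> = 2 ^ m * (S * (M + 1)) / (1 + norm x)"
          by (simp add: field_simps add_pos_nonneg less_imp_neq[symmetric])
        also have "\<dots> \<le> 2 ^ m * (S * (M + 1)) / real (Suc k)"
          using False S M by (intro divide_left_mono) auto
        finally show ?thesis .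
      qed
    qed
    then show ?thesis by simp
  qed
  have eq: "(\<lambda>x. \<phi> x * cut (x /\<^sub>R real (Suc k)) - \<phi> x) = (\<lambda>x. \<phi> x * d k x)" for k
    by (simp add: d_def algebra_simps)
  have supp: "\<phi> x * cut (x /\<^sub>R real (Suc k)) = 0" if "R * real (Suc k) < norm x" for x k
    using that cut(2)[of "x /\<^sub>R real (Suc k)"] by (simp add: divide_simps)
  have cS: "(\<lambda>x. \<phi> x * cut (x /\<^sub>R real (Suc k))) \<in> schwartz" for k
    using supp smooth_affine[OF cut(1), of 0 "inverse (real (Suc k))"]
    by (intro schwartz_compact_support smooth_mult schwartz_imp_smooth[OF \<phi>]) simp_all
  have lim: "(\<lambda>k. c * (2 ^ m * (S * (M + 1))) / real (Suc k)) \<longlonglongrightarrow> 0"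
    by (rule LIMSEQ_Suc[OF lim_const_over_n])
  have "(\<lambda>x. \<phi> x * d k x) \<in> schwartz" for k
    using schwartz_diff[OF cS \<phi>] unfolding eq .
  then have nonneg: "0 \<le> schwartz_norm m (\<lambda>x. \<phi> x * d k x)" for k by (rule schwartz_norm_nonneg)
  show ?thesis unfolding eq
    by (rule tendsto_sandwich[OF always_eventually always_eventually tendsto_const lim])
      (use bound nonneg in blast)+
qed

section \<open>Smooth bump functions\<close>

text \<open>Here \<open>n\<close> counts derivatives exactly, in contrast to
  \<open>times_differentiable\<close>; this explains the shift to \<open>times_deriv (Suc n)\<close>
  in \<open>smooth_prod_coordinates\<close>.\<close>

primrec times_deriv :: "nat \<Rightarrow> (real \<Rightarrow> real) \<Rightarrow> bool" where
  "times_deriv 0 f \<longleftrightarrow> True"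
| "times_deriv (Suc n) f \<longleftrightarrow> (\<exists>f'. (\<forall>t. (f has_real_derivative f' t) (at t)) \<and> times_deriv n f')"

lemma times_deriv_SucI:
  "(\<And>t. (f has_real_derivative f' t) (at t)) \<Longrightarrow> times_deriv n f' \<Longrightarrow> times_deriv (Suc n) f"
  by auto

lemma times_deriv_SucD: "times_deriv (Suc n) f \<Longrightarrow> times_deriv n f"
  by (induction n arbitrary: f) auto

lemma times_deriv_add: "times_deriv n f \<Longrightarrow> times_deriv n g \<Longrightarrow> times_deriv n (\<lambda>t. f t + g t)"
proof (induction n arbitrary: f g)
  case (Suc n)
  then obtain f' g' where "\<forall>t. (f has_real_derivative f' t) (at t)" "times_deriv n f'"
    "\<forall>t. (g has_real_derivative g' t) (at t)" "times_deriv n g'" by auto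
  then show ?case using Suc.IH
    by (auto intro!: exI[of _ "\<lambda>t. f' t + g' t"] derivative_intros)
qed simp

lemma times_deriv_mult: "times_deriv n f \<Longrightarrow> times_deriv n g \<Longrightarrow> times_deriv n (\<lambda>t. f t * g t)"
proof (induction n arbitrary: f g)
  case (Suc n)
  then obtain f' g' where d: "\<forall>t. (f has_real_derivative f' t) (at t)" "times_deriv n f'"
    "\<forall>t. (g has_real_derivative g' t) (at t)" "times_deriv n g'" by auto
  have "((\<lambda>t. f t * g t) has_real_derivative f' t * g t + f t * g' t) (at t)" for t
    using DERIV_mult[of f "f' t" t UNIV g "g' t"] d by (simp add: algebra_simps)
  moreover have "times_deriv n (\<lambda>t. f' t * g t + f t * g' t)"
    using d Suc.IH Suc.prems[THEN times_deriv_SucD] by (intro times_deriv_add) auto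
  ultimately show ?case by (rule times_deriv_SucI)
qed simp

lemma times_deriv_const: "times_deriv n (\<lambda>_. c)"
  by (induction n arbitrary: c) (auto intro!: exI[of _ "\<lambda>_. 0"])

lemma times_deriv_cmult: "times_deriv n f \<Longrightarrow> times_deriv n (\<lambda>t. c * f t)"
  by (intro times_deriv_mult times_deriv_const)

lemma times_deriv_inverse:
  "times_deriv n f \<Longrightarrow> (\<And>t. f t \<noteq> 0) \<Longrightarrow> times_deriv n (\<lambda>t. inverse (f t))"
proof (induction n)
  case (Suc n)
  then obtain f' where d: "\<forall>t. (f has_real_derivative f' t) (at t)" "times_deriv n f'" by auto
  have "((\<lambda>t. inverse (f t)) has_real_derivative (- 1) * (f' t * (inverse (f t) * inverse (f t)))) (at t)" for t
    using DERIV_inverse_fun[of f "f' t" t UNIV] d Suc.prems(2)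
    by (simp add: algebra_simps)
  moreover have "times_deriv n (\<lambda>t. (- 1) * (f' t * (inverse (f t) * inverse (f t))))"
    using Suc d times_deriv_SucD by (intro times_deriv_cmult times_deriv_mult) auto
  ultimately show ?case by (rule times_deriv_SucI)
qed simp

lemma times_deriv_affine: "times_deriv n f \<Longrightarrow> times_deriv n (\<lambda>t. f (a + b * t))"
proof (induction n arbitrary: f)
  case (Suc n)
  then obtain f' where d: "\<forall>t. (f has_real_derivative f' t) (at t)" "times_deriv n f'" by auto
  have "((\<lambda>t. f (a + b * t)) has_real_derivative b * f' (a + b * t)) (at t)" for t
  proof -
    have "((\<lambda>t. a + b * t) has_real_derivative b) (at t)" by (auto intro!: derivative_eq_intros)
    from DERIV_chain2[OF d(1)[rule_format] this] show ?thesis by (simp add: mult.commute)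
  qed
  then show ?case using times_deriv_cmult[OF Suc.IH[OF d(2)]] by (rule times_deriv_SucI)
qed simp

text \<open>The standard flat function \<open>exp (- 1 / t)\<close>, multiplied by negative powers
  of \<open>t\<close> so that derivatives are again linear combinations of members of the
  family.\<close>

definition flat :: "nat \<Rightarrow> real \<Rightarrow> real" where
  "flat m t = (if t \<le> 0 then 0 else inverse t ^ m * exp (- inverse t))"

lemma flat_has_derivative:
  "(flat m has_real_derivative flat (m + 2) t - real m * flat (Suc m) t) (at t)"
proof -
  consider "t < 0" | "t = 0" | "t > 0" by linarith
  then show ?thesis
  proof cases
    case 1
    have "((\<lambda>_. 0) has_real_derivative 0) (at t)" by simp
    then have "(flat m has_real_derivative 0) (at t)"
      by (rule has_field_derivative_transform_within_open[of _ _ _ "{..<0}"]) (use 1 in \<open>auto simp: flat_def\<close>)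
    with 1 show ?thesis by (simp add: flat_def)
  next
    case 2
    \<comment> \<open>From the right, the substitution \<open>x = 1 / h\<close> turns the difference
      quotient into \<open>x ^ Suc m / exp x\<close> at infinity.\<close>
    have "((\<lambda>h. flat m h / h) \<longlongrightarrow> 0) (at_right 0)"
    proof (rule Lim_transform_eventually)
      show "((\<lambda>h::real. inverse h ^ m * exp (- inverse h) / h) \<longlongrightarrow> 0) (at_right 0)"
      proof -
        have "((\<lambda>x::real. x ^ Suc m / exp x) \<longlongrightarrow> 0) at_top" by (rule tendsto_power_div_exp_0)
        from filterlim_compose[OF this filterlim_inverse_at_top_right]
        show ?thesis by (simp add: field_simps exp_minus)
      qed
      show "\<forall>\<^sub>F h in at_right 0. inverse h ^ m * exp (- inverse h) / h = flat m h / h"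
        by (auto simp: flat_def eventually_at_filter)
    qed
    moreover have "((\<lambda>h. flat m h / h) \<longlongrightarrow> 0) (at_left 0)"
      by (rule Lim_transform_eventually[OF tendsto_const]) (auto simp: flat_def eventually_at_filter)
    ultimately have "((\<lambda>h. flat m h / h) \<longlongrightarrow> 0) (at 0)"
      by (simp add: filterlim_at_split)
    with 2 show ?thesis by (simp add: has_field_derivative_iff flat_def)
  next
    case 3
    have "((\<lambda>t. inverse t ^ m * exp (- inverse t)) has_real_derivative
        inverse t ^ (m + 2) * exp (- inverse t) - real m * (inverse t ^ Suc m * exp (- inverse t))) (at t)"
    proof -
      have i: "(inverse has_real_derivative - (inverse t * inverse t)) (at t)"
        using DERIV_inverse[of t] 3 by simp
      show ?thesis
        using DERIV_mult[OF DERIV_power[OF i, of m] DERIV_fun_exp[OF DERIV_minus[OF i]]]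
        by (cases m) (simp_all add: algebra_simps)
    qed
    then have "(flat m has_real_derivative
        inverse t ^ (m + 2) * exp (- inverse t) - real m * (inverse t ^ Suc m * exp (- inverse t))) (at t)"
      by (rule has_field_derivative_transform_within_open[of _ _ _ "{0<..}"]) (use 3 in \<open>auto simp: flat_def\<close>)
    with 3 show ?thesis by (simp add: flat_def)
  qed
qed

lemma times_deriv_flat: "times_deriv n (flat m)"
proof (induction n arbitrary: m)
  case (Suc n)
  have "times_deriv n (\<lambda>t. flat (m + 2) t + (- real m) * flat (Suc m) t)"
    by (intro times_deriv_add times_deriv_cmult Suc)
  then show ?case using flat_has_derivative[of m]
    by (auto intro!: exI[of _ "\<lambda>t. flat (m + 2) t - real m * flat (Suc m) t"])
qed simp

definition smooth_step :: "real \<Rightarrow> real" where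
  "smooth_step t = flat 0 t * inverse (flat 0 t + flat 0 (1 - t))"

lemma flat_pos: "0 < t \<Longrightarrow> 0 < flat m t" and flat_nonneg: "0 \<le> flat m t" and flat_eq_0: "t \<le> 0 \<Longrightarrow> flat m t = 0"
  by (auto simp: flat_def)

text \<open>The numbers \<open>t\<close> and \<open>1 - t\<close> are never both
  nonpositive.\<close>

lemma smooth_step_denominator: "0 < flat 0 t + flat 0 (1 - t)"
  using flat_pos[of t 0] flat_pos[of "1 - t" 0] flat_nonneg[of 0 t] flat_nonneg[of 0 "1 - t"]
  by (cases "0 < t") (auto intro: add_pos_nonneg add_nonneg_pos)

lemma times_deriv_smooth_step: "times_deriv n smooth_step"
proof -
  have "times_deriv n (\<lambda>t. flat 0 t * inverse (flat 0 t + flat 0 (1 + (- 1) * t)))"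
    using smooth_step_denominator by (intro times_deriv_mult times_deriv_inverse times_deriv_add times_deriv_flat
        times_deriv_affine) (auto simp: less_le)
  then show ?thesis by (simp add: smooth_step_def[abs_def])
qed

lemma smooth_step_eq_0: "t \<le> 0 \<Longrightarrow> smooth_step t = 0"
  and smooth_step_eq_1: "1 \<le> t \<Longrightarrow> smooth_step t = 1"
  using flat_pos[of t 0] by (auto simp: smooth_step_def flat_eq_0)

lemma smooth_step_nonneg: "0 \<le> smooth_step t"
  unfolding smooth_step_def using smooth_step_denominator[of t] flat_nonneg by (auto intro!: mult_nonneg_nonneg)

lemma smooth_step_le_1: "smooth_step t \<le> 1"
  unfolding smooth_step_def using smooth_step_denominator[of t] flat_nonneg[of 0 "1 - t"]
  by (simp add: divide_inverse[symmetric])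

lemma has_derivative_prod_coordinates:
  fixes u u' :: "'n::finite \<Rightarrow> real \<Rightarrow> real"
  assumes "\<And>i t. (u i has_real_derivative u' i t) (at t)"
  shows "((\<lambda>x :: real^'n. complex_of_real (\<Prod>i\<in>UNIV. u i (x $ i))) has_derivative
     (\<lambda>h. complex_of_real (\<Sum>i\<in>UNIV. u' i (x $ i) * h $ i * (\<Prod>j\<in>UNIV - {i}. u j (x $ j))))) (at x)"
proof -
  have "((\<lambda>x :: real^'n. u i (x $ i)) has_derivative (\<lambda>h. u' i (x $ i) * h $ i)) (at x)" for i
    using has_derivative_compose[of "\<lambda>x. x $ i" "\<lambda>h. h $ i" x UNIV "u i" "\<lambda>h. u' i (x $ i) * h"] assms[of i "x $ i"]
    by (simp add: has_field_derivative_def bounded_linear_imp_has_derivative bounded_linear_vec_nth)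
  then have "((\<lambda>x :: real^'n. \<Prod>i\<in>UNIV. u i (x $ i)) has_derivative
     (\<lambda>h. \<Sum>i\<in>UNIV. u' i (x $ i) * h $ i * (\<Prod>j\<in>UNIV - {i}. u j (x $ j)))) (at x)"
    by (intro has_derivative_prod) auto
  then show ?thesis
    by (rule bounded_linear.has_derivative[OF bounded_linear_of_real])
qed

text \<open>Differentiation along \<open>k\<close> merely replaces the \<open>k\<close>-th factor,
  so products of functions of one coordinate each form a class stable under partial derivatives.
  This gives smoothness by induction.\<close>

lemma partial_prod_coordinates:
  fixes u u' :: "'n::finite \<Rightarrow> real \<Rightarrow> real"
  assumes "\<And>i t. (u i has_real_derivative u' i t) (at t)"
  shows "partial k (\<lambda>x :: real^'n. complex_of_real (\<Prod>i\<in>UNIV. u i (x $ i))) =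
    (\<lambda>x. complex_of_real (\<Prod>i\<in>UNIV. (u(k := u' k)) i (x $ i)))"
proof
  fix x :: "real^'n"
  have "partial k (\<lambda>x :: real^'n. complex_of_real (\<Prod>i\<in>UNIV. u i (x $ i))) x =
    complex_of_real (\<Sum>i\<in>UNIV. u' i (x $ i) * axis k 1 $ i * (\<Prod>j\<in>UNIV - {i}. u j (x $ j)))"
    by (rule partial_eq[OF has_derivative_prod_coordinates[OF assms]])
  also have "(\<Sum>i\<in>UNIV. u' i (x $ i) * axis k 1 $ i * (\<Prod>j\<in>UNIV - {i}. u j (x $ j))) =
     (\<Sum>i\<in>UNIV. if i = k then u' k (x $ k) * (\<Prod>j\<in>UNIV - {k}. u j (x $ j)) else 0)"
    by (intro sum.cong) (auto simp: axis_def)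
  also have "\<dots> = u' k (x $ k) * (\<Prod>j\<in>UNIV - {k}. u j (x $ j))" by simp
  also have "\<dots> = (\<Prod>i\<in>UNIV. (u(k := u' k)) i (x $ i))"
    by (subst prod.remove[of UNIV k]) auto
  finally show "partial k (\<lambda>x :: real^'n. complex_of_real (\<Prod>i\<in>UNIV. u i (x $ i))) x =
    complex_of_real (\<Prod>i\<in>UNIV. (u(k := u' k)) i (x $ i))" .
qed

lemma smooth_prod_coordinates:
  fixes u :: "'n::finite \<Rightarrow> real \<Rightarrow> real"
  assumes "\<And>i n. times_deriv n (u i)"
  shows "smooth (\<lambda>x :: real^'n. complex_of_real (\<Prod>i\<in>UNIV. u i (x $ i)))"
proof -
  have "times_differentiable n (\<lambda>x :: real^'n. complex_of_real (\<Prod>i\<in>UNIV. u i (x $ i)))"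
    if "\<And>i. times_deriv (Suc n) (u i)" for n and u :: "'n \<Rightarrow> real \<Rightarrow> real"
    using that
  proof (induction n arbitrary: u)
    case 0
    then have "\<forall>i. \<exists>f'. \<forall>t. (u i has_real_derivative f' t) (at t)" by auto
    then obtain u' where "\<And>i t. (u i has_real_derivative u' i t) (at t)" by metis
    from has_derivative_prod_coordinates[of u u', OF this] show ?case
      unfolding times_differentiable.simps differentiable_def by blast
  next
    case (Suc n)
    from Suc.prems have "\<forall>i. \<exists>f'. (\<forall>t. (u i has_real_derivative f' t) (at t)) \<and> times_deriv (Suc n) f'"
      by (metis times_deriv.simps(2))
    then obtain u' where u': "\<And>i t. (u i has_real_derivative u' i t) (at t)" "\<And>i. times_deriv (Suc n) (u' i)" by metis
    have *: "times_deriv (Suc n) ((u(k := u' k)) i)" for i k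
      using u'(2) times_deriv_SucD[OF Suc.prems] by simp
    have "times_differentiable n (partial k (\<lambda>x :: real^'n. complex_of_real (\<Prod>i\<in>UNIV. u i (x $ i))))" for k
      unfolding partial_prod_coordinates[of u u', OF u'(1)] by (rule Suc.IH[OF *])
    with has_derivative_prod_coordinates[of u u', OF u'(1)] show ?case
      unfolding times_differentiable.simps differentiable_def by blast
  qed
  with assms show ?thesis unfolding smooth_iff_times_differentiable by blast
qed

text \<open>A difference of two consecutive translates of a step, so that sums over integer
  translates telescope.\<close>

definition bump :: "real \<Rightarrow> real" where
  "bump t = smooth_step t - smooth_step (t - 1)"

lemma times_deriv_bump: "times_deriv n bump"
proof -
  have "times_deriv n (\<lambda>t. smooth_step t + (- 1) * smooth_step (- 1 + 1 * t))"
    by (intro times_deriv_add times_deriv_cmult times_deriv_affine times_deriv_smooth_step)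
  then show ?thesis by (simp add: bump_def[abs_def])
qed

lemma bump_eq_0: "t \<le> 0 \<or> 2 \<le> t \<Longrightarrow> bump t = 0"
  by (auto simp: bump_def smooth_step_eq_0 smooth_step_eq_1)

lemma sum_bump_eq_1:
  assumes "- real_of_int L + 2 \<le> t" "t \<le> real_of_int L"
  shows "(\<Sum>m\<in>{-L..L}. bump (t - real_of_int m)) = 1"
proof -
  have "L \<ge> 1" using assms by linarith
  \<comment> \<open>The induction starts with the empty sum at \<open>b = a - 1\<close>, where both
    steps coincide.\<close>
  have "(\<Sum>m\<in>{a..b}. bump (t - real_of_int m)) = smooth_step (t - a) - smooth_step (t - b - 1)"
    if "a - 1 \<le> b" for a b :: int
    using that
  proof (induction b rule: int_ge_induct[where k = "a - 1"])
    case (step i)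
    then have "{a..i + 1} = insert (i + 1) {a..i}" by auto
    with step show ?case by (simp add: bump_def algebra_simps)
  qed (auto simp: algebra_simps)
  from this[of "-L" L] \<open>L \<ge> 1\<close> assms show ?thesis
    by (simp add: smooth_step_eq_0 smooth_step_eq_1)
qed

section \<open>Weak limits of dominated functions\<close>

text \<open>The values \<open>L k\<close> lie in a product of compact intervals indexed by all
  \<open>A\<close>. Such a product is compact, but for an uncountable index type sequential
  compactness may fail; so a finer filter takes the place of a subsequence.\<close>

lemma cluster_filter_bounded:
  fixes L :: "'b \<Rightarrow> 'a \<Rightarrow> real"
  assumes F0: "F0 \<noteq> bot" and bnd: "\<And>k A. \<bar>L k A\<bar> \<le> c A"
  obtains F \<nu> where "F \<le> F0" "F \<noteq> bot" "\<And>A. ((\<lambda>k. L k A) \<longlongrightarrow> \<nu> A) F"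
proof -
  define U where "U = PiE (UNIV :: 'a set) (\<lambda>A. {- c A..c A})"
  have "compactin (product_topology (\<lambda>_. euclidean) UNIV) U"
    unfolding U_def by (subst compactin_PiE) auto
  then have "compact U"
    by (simp add: euclidean_product_topology)
  moreover have "filtermap L F0 \<noteq> bot" using F0 by (simp add: filtermap_bot_iff)
  moreover have "eventually (\<lambda>x. x \<in> U) (filtermap L F0)"
    unfolding eventually_filtermap U_def
    using bnd by (intro always_eventually) (auto simp: abs_le_iff minus_le_iff)
  ultimately obtain \<nu> where \<nu>: "inf (nhds \<nu>) (filtermap L F0) \<noteq> bot"
    unfolding compact_filter by blast
  \<comment> \<open>Pulling the neighbourhoods of the cluster point \<nu> back along
    \<open>L\<close> yields a filter on the indices along which \<open>L\<close> converges to \<nu>;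
    that \<nu> clusters makes its meet with \<open>F0\<close> proper.\<close>
  define F where "F = inf (filtercomap L (nhds \<nu>)) F0"
  have "F \<noteq> bot"
  proof
    assume "F = bot"
    then have "eventually (\<lambda>_. False) F" by simp
    then obtain P Q where PQ: "eventually P (filtercomap L (nhds \<nu>))" "eventually Q F0" "\<And>k. P k \<Longrightarrow> Q k \<Longrightarrow> False"
      unfolding F_def eventually_inf by blast
    then obtain R where R: "eventually R (nhds \<nu>)" "\<And>k. R (L k) \<Longrightarrow> P k"
      unfolding eventually_filtercomap by blast
    have "eventually (\<lambda>x. \<not> R x) (filtermap L F0)"
      unfolding eventually_filtermap using PQ R by (auto elim!: eventually_mono)
    with R(1) have "eventually (\<lambda>_. False) (inf (nhds \<nu>) (filtermap L F0))"
      unfolding eventually_inf by blast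
    with \<nu> show False by (simp add: eventually_False)
  qed
  moreover have "F \<le> F0" by (simp add: F_def)
  moreover have "((\<lambda>k. L k A) \<longlongrightarrow> \<nu> A) F" for A
  proof (rule topological_tendstoI)
    fix V :: "real set" assume V: "open V" "\<nu> A \<in> V"
    have "open ((\<lambda>f :: 'a \<Rightarrow> real. f A) -` V)"
      by (intro open_vimage V continuous_on_product_coordinates)
    then have "eventually (\<lambda>f. f A \<in> V) (nhds \<nu>)"
      unfolding eventually_nhds using V by auto
    then show "eventually (\<lambda>k. L k A \<in> V) F"
      unfolding F_def eventually_inf eventually_filtercomap
      by (intro exI[of _ "\<lambda>k. L k A \<in> V"] exI[of _ "\<lambda>_. True"]) auto
  qed
  ultimately show ?thesis using that by blast
qed

text \<open>Set-wise limits of dominated densities along a filter are automatically countably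
  additive, so that no weak compactness theorem for \<open>L\<^sup>1\<close> is needed.\<close>

lemma dominated_setwise_limit:
  fixes h :: "'b \<Rightarrow> 'a \<Rightarrow> real"
  assumes sf: "sigma_finite_measure M"
    and F: "F \<noteq> bot"
    and G: "integrable M G"
    and h: "\<And>k. h k \<in> borel_measurable M" "\<And>k x. 0 \<le> h k x" "\<And>k x. h k x \<le> G x"
    and lim: "\<And>A. ((\<lambda>k. \<integral>x. h k x * indicator (A \<inter> space M) x \<partial>M) \<longlongrightarrow> \<nu> A) F"
  obtains H where "H \<in> borel_measurable M" "\<And>x. 0 \<le> H x" "AE x in M. H x \<le> G x"
    "\<And>A. A \<in> sets M \<Longrightarrow> \<nu> A = (\<integral>x. H x * indicator A x \<partial>M)"
proof -
  have Gp: "0 \<le> G x" for x using h(2,3)[of undefined x] by (rule order_trans)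
  have int: "integrable M (\<lambda>x. h k x * indicator A x)" if "A \<in> sets M" for k A
    using that h Gp by (intro Bochner_Integration.integrable_bound[OF G])
      (auto simp: indicator_def intro!: AE_I2)
  have intG: "integrable M (\<lambda>x. G x * indicator A x)" if "A \<in> sets M" for A
    using integrable_mult_indicator[OF that G] by (simp add: mult.commute)
  have lim': "((\<lambda>k. \<integral>x. h k x * indicator A x \<partial>M) \<longlongrightarrow> \<nu> A) F" if "A \<in> sets M" for A
    using lim[of A] sets.Int_space_eq2[OF that] by simp
  have nonneg: "0 \<le> \<nu> A" if "A \<in> sets M" for A
    by (rule tendsto_lowerbound[OF lim'[OF that] _ F])
      (auto intro!: always_eventually Bochner_Integration.integral_nonneg simp: h)
  have upper: "\<nu> A \<le> (\<integral>x. G x * indicator A x \<partial>M)" if "A \<in> sets M" for A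
    by (rule tendsto_upperbound[OF lim'[OF that] _ F])
      (auto intro!: always_eventually integral_mono int intG that mult_right_mono simp: h)
  have add: "\<nu> (A \<union> B) = \<nu> A + \<nu> B" if "A \<in> sets M" "B \<in> sets M" "A \<inter> B = {}" for A B
  proof (rule tendsto_unique[OF F])
    show "((\<lambda>k. \<integral>x. h k x * indicator (A \<union> B) x \<partial>M) \<longlongrightarrow> \<nu> (A \<union> B)) F"
      using that by (intro lim') auto
    have "(\<integral>x. h k x * indicator (A \<union> B) x \<partial>M) =
        (\<integral>x. h k x * indicator A x \<partial>M) + (\<integral>x. h k x * indicator B x \<partial>M)" for k
    proof -
      have "h k x * indicator (A \<union> B) x = h k x * indicator A x + h k x * indicator B x" for x
        using that(3) by (auto split: split_indicator)
      then show ?thesis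
        by (simp add: Bochner_Integration.integral_add[OF int[OF that(1)] int[OF that(2)]])
    qed
    then show "((\<lambda>k. \<integral>x. h k x * indicator (A \<union> B) x \<partial>M) \<longlongrightarrow> \<nu> A + \<nu> B) F"
      using that by (simp add: tendsto_add lim')
  qed
  have empty: "\<nu> {} = 0"
    using nonneg[of "{}"] upper[of "{}"] by simp
  \<comment> \<open>Finite additivity passes to the limit. Continuity at the empty set comes from
    \<open>upper\<close> and dominated convergence for \<open>G\<close> alone, so no uniformity of
    the limit along \<open>F\<close> enters.\<close>
  have ca: "countably_additive (sets M) (\<lambda>A. ennreal (\<nu> A))"
  proof (rule sets.empty_continuous_imp_countably_additive)
    show "positive (sets M) (\<lambda>A. ennreal (\<nu> A))" by (simp add: positive_def empty)
    show "Measure_Space.additive (sets M) (\<lambda>A. ennreal (\<nu> A))"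
      by (auto simp: additive_def add nonneg ennreal_plus[symmetric] simp del: ennreal_plus)
    fix A :: "nat \<Rightarrow> 'a set" assume A: "range A \<subseteq> sets M" "decseq A" "(\<Inter>i. A i) = {}"
    have Am: "A i \<in> sets M" for i using A by auto
    have "(\<lambda>i. \<integral>x. G x * indicator (A i) x \<partial>M) \<longlonglongrightarrow> (\<integral>x. 0 \<partial>M)"
    proof (rule integral_dominated_convergence[where w=G])
      show "AE x in M. (\<lambda>i. G x * indicator (A i) x) \<longlonglongrightarrow> 0"
      proof (rule AE_I2)
        fix x
        have "(\<lambda>i. indicator (A i) x :: real) \<longlonglongrightarrow> indicator (\<Inter>i. A i) x"
          by (rule LIMSEQ_indicator_decseq[OF A(2)])
        then have "(\<lambda>i. indicator (A i) x :: real) \<longlonglongrightarrow> 0" using A(3) by simp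
        then show "(\<lambda>i. G x * indicator (A i) x) \<longlonglongrightarrow> 0"
          by (rule tendsto_mult_right_zero)
      qed
    qed (use G Gp Am in \<open>auto simp: indicator_def intro!: borel_measurable_integrable intG\<close>)
    then have "(\<lambda>i. \<nu> (A i)) \<longlonglongrightarrow> 0"
      by (intro tendsto_sandwich[of "\<lambda>_. 0" "\<lambda>i. \<nu> (A i)" sequentially "\<lambda>i. \<integral>x. G x * indicator (A i) x \<partial>M"])
        (auto intro!: always_eventually nonneg upper Am)
    then show "(\<lambda>i. ennreal (\<nu> (A i))) \<longlonglongrightarrow> 0"
      using tendsto_ennrealI by fastforce
  qed auto
  define N where "N = measure_of (space M) (sets M) (\<lambda>A. ennreal (\<nu> A))"
  have setsN: "sets N = sets M" by (simp add: N_def)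
  have emN: "emeasure N A = ennreal (\<nu> A)" if "A \<in> sets M" for A
    using ca that unfolding N_def
    by (subst emeasure_measure_of_sigma) (auto simp: positive_def empty intro: sets.sigma_algebra_axioms)
  have "absolutely_continuous M N"
    unfolding absolutely_continuous_def
  proof
    fix A assume A: "A \<in> null_sets M"
    then have "(\<integral>x. G x * indicator A x \<partial>M) = 0"
      by (intro integral_eq_zero_AE) (use AE_not_in[OF A] in \<open>auto elim!: eventually_mono\<close>)
    with A nonneg[of A] upper[of A] show "A \<in> null_sets N"
      by (intro null_setsI) (auto simp: setsN emN)
  qed
  then obtain H0 where H0: "H0 \<in> borel_measurable M" "density M H0 = N"
    using sigma_finite_measure.Radon_Nikodym[OF sf _ setsN] by blast
  have emN': "emeasure N A = (\<integral>\<^sup>+x. H0 x * indicator A x \<partial>M)" if "A \<in> sets M" for A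
    using emeasure_density[OF H0(1) that] H0(2) by simp
  have H0le: "AE x in M. H0 x \<le> ennreal (G x)"
  proof -
    \<comment> \<open>On the set where \<open>H0\<close> exceeds \<open>G\<close>, the bound
      \<open>upper\<close> forces the integral of the excess to be 0.\<close>
    define A where "A = {x \<in> space M. ennreal (G x) < H0 x}"
    have Gm: "G \<in> borel_measurable M" using G by simp
    have A: "A \<in> sets M" unfolding A_def using H0(1) Gm by measurable
    have "(\<integral>\<^sup>+x. G x * indicator A x \<partial>M) = ennreal (\<integral>x. G x * indicator A x \<partial>M)"
      by (subst nn_integral_eq_integral[symmetric, OF intG[OF A]])
        (auto simp: Gp intro!: nn_integral_cong split: split_indicator)
    then have fin: "(\<integral>\<^sup>+x. G x * indicator A x \<partial>M) \<noteq> \<infinity>"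
      and le: "(\<integral>\<^sup>+x. H0 x * indicator A x \<partial>M) \<le> (\<integral>\<^sup>+x. G x * indicator A x \<partial>M)"
      using emN'[OF A] emN[OF A] ennreal_leI[OF upper[OF A]] by simp_all
    have "(\<integral>\<^sup>+x. H0 x * indicator A x - G x * indicator A x \<partial>M) =
        (\<integral>\<^sup>+x. H0 x * indicator A x \<partial>M) - (\<integral>\<^sup>+x. G x * indicator A x \<partial>M)"
      by (rule nn_integral_diff) (use H0(1) Gm A fin in \<open>auto simp: A_def less_imp_le split: split_indicator\<close>)
    also have "\<dots> = 0" using le fin by (subst diff_eq_0_iff_ennreal) (auto simp: less_top intro: le_less_trans)
    finally have "AE x in M. H0 x * indicator A x - G x * indicator A x = 0"
      using H0(1) Gm A by (subst (asm) nn_integral_0_iff_AE) auto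
    with AE_space show ?thesis
      by eventually_elim (auto simp: A_def diff_eq_0_iff_ennreal not_less split: split_indicator_asm)
  qed
  define H where "H = (\<lambda>x. enn2real (H0 x))"
  have Hm: "H \<in> borel_measurable M" unfolding H_def using H0(1) by measurable
  have HH0: "AE x in M. ennreal (H x) = H0 x"
    using H0le by eventually_elim (auto simp: H_def intro!: ennreal_enn2real intro: le_less_trans)
  have HG: "AE x in M. H x \<le> G x"
    using HH0 H0le by eventually_elim (use Gp in \<open>metis ennreal_le_iff\<close>)
  have "\<nu> A = (\<integral>x. H x * indicator A x \<partial>M)" if A: "A \<in> sets M" for A
  proof -
    have "ennreal (\<nu> A) = (\<integral>\<^sup>+x. H0 x * indicator A x \<partial>M)"
      using emN'[OF A] emN[OF A] by simp
    also have "\<dots> = (\<integral>\<^sup>+x. ennreal (H x * indicator A x) \<partial>M)"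
      by (intro nn_integral_cong_AE) (use HH0 in \<open>auto elim!: eventually_mono split: split_indicator\<close>)
    finally have "ennreal (\<nu> A) = (\<integral>\<^sup>+x. ennreal (H x * indicator A x) \<partial>M)" .
    then have "(\<integral>x. H x * indicator A x \<partial>M) = enn2real (ennreal (\<nu> A))"
      using Hm A by (subst integral_eq_nn_integral) (auto simp: H_def)
    then show ?thesis using nonneg[OF A] by simp
  qed
  then show ?thesis
    by (intro that[OF Hm _ HG]) (auto simp: H_def)
qed

text \<open>Adding \<open>G\<close> makes the functions nonnegative and dominated by
  \<open>2 * G\<close>, so \<open>dominated_setwise_limit\<close> applies, and the shift is then
  removed. Domination bounds every pairing by the norm of \<open>u\<close> in the space of density
  \<open>G\<close>, uniformly in \<open>k\<close>; hence convergence on indicators extends to all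
  \<open>u\<close> integrable for that density.\<close>

lemma weak_limit_dominated:
  fixes h :: "'b \<Rightarrow> 'a \<Rightarrow> real"
  assumes sf: "sigma_finite_measure M"
    and F0: "F0 \<noteq> bot"
    and G: "integrable M G"
    and h: "\<And>k. h k \<in> borel_measurable M" "\<And>k x. \<bar>h k x\<bar> \<le> G x"
  obtains F H where "F \<le> F0" "F \<noteq> bot" "H \<in> borel_measurable M" "AE x in M. \<bar>H x\<bar> \<le> G x"
    "\<And>u :: 'a \<Rightarrow> 'c :: {banach, second_countable_topology}.
       integrable (density M G) u \<Longrightarrow> ((\<lambda>k. \<integral>x. h k x *\<^sub>R u x \<partial>M) \<longlongrightarrow> (\<integral>x. H x *\<^sub>R u x \<partial>M)) F"
proof -
  have Gp: "0 \<le> G x" for x using h(2)[of undefined x] by linarith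
  have Gm[measurable]: "G \<in> borel_measurable M" using G by simp
  define h' where "h' = (\<lambda>k x. h k x + G x)"
  have h'm: "h' k \<in> borel_measurable M" for k unfolding h'_def using h(1)[of k] by measurable
  have h'b: "0 \<le> h' k x" "h' k x \<le> 2 * G x" for k x
    using h(2)[of k x] by (auto simp: h'_def)
  have G2: "integrable M (\<lambda>x. 2 * G x)" using G by simp
  define L where "L = (\<lambda>k A. \<integral>x. h' k x * indicator (A \<inter> space M) x \<partial>M)"
  \<comment> \<open>Here \<open>A\<close> is an arbitrary set. If the product with its indicator is
    not integrable, the Bochner integral has the default value 0 and the bound persists.\<close>
  have "\<bar>L k A\<bar> \<le> (\<integral>x. 2 * G x \<partial>M)" for k A
    unfolding L_def
  proof (rule order_trans[OF integral_abs_bound integral_mono'[OF G2]])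
    fix x show "\<bar>h' k x * indicator (A \<inter> space M) x\<bar> \<le> 2 * G x"
      using h'b[of k x] Gp[of x] by (auto split: split_indicator)
  qed (use Gp in auto)
  then obtain F \<nu> where F: "F \<le> F0" "F \<noteq> bot" "\<And>A. ((\<lambda>k. L k A) \<longlongrightarrow> \<nu> A) F"
    using cluster_filter_bounded[OF F0, of L "\<lambda>_. \<integral>x. 2 * G x \<partial>M"] by blast
  obtain H' where H': "H' \<in> borel_measurable M" "\<And>x. 0 \<le> H' x" "AE x in M. H' x \<le> 2 * G x"
    "\<And>A. A \<in> sets M \<Longrightarrow> \<nu> A = (\<integral>x. H' x * indicator A x \<partial>M)"
    by (rule dominated_setwise_limit[OF sf F(2) G2 h'm h'b F(3)[unfolded L_def]]) (rule that)
  define H where "H = (\<lambda>x. H' x - G x)"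
  have Hm[measurable]: "H \<in> borel_measurable M" unfolding H_def using H'(1) by measurable
  have HG: "AE x in M. \<bar>H x\<bar> \<le> G x"
    using H'(3) by eventually_elim (use H'(2) in \<open>auto simp: H_def abs_le_iff\<close>)
  have bnd: "integrable M (\<lambda>x. w x *\<^sub>R u x)" "norm (\<integral>x. w x *\<^sub>R u x \<partial>M) \<le> (\<integral>x. G x * norm (u x) \<partial>M)"
    if u: "integrable (density M G) u" and w: "w \<in> borel_measurable M" "AE x in M. \<bar>w x\<bar> \<le> G x"
    for u :: "'a \<Rightarrow> 'c" and w
  proof -
    have um: "u \<in> borel_measurable M" using u by (auto dest: borel_measurable_integrable)
    have iu: "integrable M (\<lambda>x. G x *\<^sub>R u x)"
      using u um by (subst (asm) integrable_density) (auto simp: Gp)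
    have iu': "integrable M (\<lambda>x. G x * norm (u x))"
      using integrable_norm[OF iu] Gp by simp
    show *: "integrable M (\<lambda>x. w x *\<^sub>R u x)"
      by (rule Bochner_Integration.integrable_bound[OF iu'])
        (use w um Gp in \<open>auto elim!: eventually_mono intro: mult_right_mono\<close>)
    show "norm (\<integral>x. w x *\<^sub>R u x \<partial>M) \<le> (\<integral>x. G x * norm (u x) \<partial>M)"
      by (rule order_trans[OF integral_norm_bound integral_mono_AE])
        (use integrable_norm[OF *] w iu' in \<open>auto elim!: eventually_mono intro: mult_right_mono\<close>)
  qed
  have hG: "AE x in M. \<bar>h k x\<bar> \<le> G x" for k using h(2) by simp
  have conv: "((\<lambda>k. \<integral>x. h k x *\<^sub>R u x \<partial>M) \<longlongrightarrow> (\<integral>x. H x *\<^sub>R u x \<partial>M)) F"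
    if "integrable (density M G) u" for u :: "'a \<Rightarrow> 'c"
    using that
  proof (induction rule: integrable_induct)
    case (base A c)
    have A: "A \<in> sets M" using base by simp
    have int: "integrable M (\<lambda>x. w x * indicator A x)" if "w \<in> borel_measurable M" "AE x in M. \<bar>w x\<bar> \<le> G x" for w
      by (rule Bochner_Integration.integrable_bound[OF G])
        (use A that Gp in \<open>auto elim!: eventually_mono split: split_indicator\<close>)
    have intG: "integrable M (\<lambda>x. G x * indicator A x)" by (rule int) (auto simp: Gp)
    have "((\<lambda>k. L k A - (\<integral>x. G x * indicator A x \<partial>M)) \<longlongrightarrow> \<nu> A - (\<integral>x. G x * indicator A x \<partial>M)) F"
      by (intro tendsto_intros F)
    also have "(\<lambda>k. L k A - (\<integral>x. G x * indicator A x \<partial>M)) = (\<lambda>k. \<integral>x. h k x * indicator A x \<partial>M)"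
    proof
      fix k
      have "L k A = (\<integral>x. h k x * indicator A x + G x * indicator A x \<partial>M)"
        unfolding L_def h'_def using sets.Int_space_eq2[OF A] by (simp add: algebra_simps)
      also have "\<dots> = (\<integral>x. h k x * indicator A x \<partial>M) + (\<integral>x. G x * indicator A x \<partial>M)"
        by (rule Bochner_Integration.integral_add[OF int[OF h(1) hG] intG])
      finally show "L k A - (\<integral>x. G x * indicator A x \<partial>M) = (\<integral>x. h k x * indicator A x \<partial>M)" by simp
    qed
    also have "\<nu> A - (\<integral>x. G x * indicator A x \<partial>M) = (\<integral>x. H x * indicator A x \<partial>M)"
    proof -
      have "\<nu> A = (\<integral>x. H x * indicator A x + G x * indicator A x \<partial>M)"
        unfolding H'(4)[OF A] H_def by (simp add: algebra_simps)
      also have "\<dots> = (\<integral>x. H x * indicator A x \<partial>M) + (\<integral>x. G x * indicator A x \<partial>M)"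
        by (rule Bochner_Integration.integral_add[OF int[OF Hm HG] intG])
      finally show ?thesis by simp
    qed
    finally have *: "((\<lambda>k. (\<integral>x. h k x * indicator A x \<partial>M) *\<^sub>R c) \<longlongrightarrow> (\<integral>x. H x * indicator A x \<partial>M) *\<^sub>R c) F"
      by (intro tendsto_intros)
    have "(\<integral>x. w x *\<^sub>R indicator A x *\<^sub>R c \<partial>M) = (\<integral>x. w x * indicator A x \<partial>M) *\<^sub>R c"
      if "w \<in> borel_measurable M" "AE x in M. \<bar>w x\<bar> \<le> G x" for w
      using integral_scaleR_left[of c M "\<lambda>x. w x * indicator A x"] int[OF that] by simp
    with * h(1) hG Hm HG show ?case by simp
  next
    case (add f g)
    have "(\<integral>x. w x *\<^sub>R (f x + g x) \<partial>M) = (\<integral>x. w x *\<^sub>R f x \<partial>M) + (\<integral>x. w x *\<^sub>R g x \<partial>M)"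
      if "w \<in> borel_measurable M" "AE x in M. \<bar>w x\<bar> \<le> G x" for w
      unfolding scaleR_add_right
      by (rule Bochner_Integration.integral_add[OF bnd(1)[OF add.hyps(1) that] bnd(1)[OF add.hyps(2) that]])
    with add.IH h(1) hG Hm HG show ?case by (simp add: tendsto_add)
  next
    case (lim f s)
    have intd: "integrable (density M G) (\<lambda>x. f x - s i x)" for i using lim.hyps(1,4) by simp
    \<comment> \<open>This error of replacing \<open>f\<close> by \<open>s i\<close> serves all
      \<open>h k\<close> and the limit \<open>H\<close> at once, so \<open>i\<close> can be fixed
      before \<open>k\<close> moves.\<close>
    define \<delta> where "\<delta> = (\<lambda>i. \<integral>x. G x * norm (f x - s i x) \<partial>M)"
    have fm: "f \<in> borel_measurable M" "s i \<in> borel_measurable M" for i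
      using lim.hyps(4) lim.hyps(1)[of i] by (auto dest: borel_measurable_integrable)
    have "\<delta> \<longlonglongrightarrow> (\<integral>x. 0 \<partial>M)" unfolding \<delta>_def
    proof (rule integral_dominated_convergence[where w="\<lambda>x. 3 * (G x * norm (f x))"])
      have "integrable M (\<lambda>x. G x *\<^sub>R f x)"
        using lim.hyps(4) fm by (subst (asm) integrable_density) (auto simp: Gp)
      from integrable_norm[OF this] show "integrable M (\<lambda>x. 3 * (G x * norm (f x)))" using Gp by simp
      show "AE x in M. (\<lambda>i. G x * norm (f x - s i x)) \<longlonglongrightarrow> 0"
      proof (rule AE_I2)
        fix x assume "x \<in> space M"
        then have "(\<lambda>i. f x - s i x) \<longlonglongrightarrow> f x - f x"
          using lim.hyps(2)[of x] by (intro tendsto_intros) simp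
        then show "(\<lambda>i. G x * norm (f x - s i x)) \<longlonglongrightarrow> 0"
          by (intro tendsto_mult_right_zero tendsto_norm_zero) simp
      qed
      show "AE x in M. norm (G x * norm (f x - s i x)) \<le> 3 * (G x * norm (f x))" for i
      proof (rule AE_I2)
        fix x assume "x \<in> space M"
        then have "norm (s i x) \<le> 2 * norm (f x)" using lim.hyps(3)[of x] by simp
        then have "norm (f x - s i x) \<le> 3 * norm (f x)"
          using norm_triangle_ineq4[of "f x" "s i x"] by linarith
        from mult_left_mono[OF this Gp[of x]] show "norm (G x * norm (f x - s i x)) \<le> 3 * (G x * norm (f x))"
          using Gp[of x] by (simp add: algebra_simps)
      qed
    qed (use fm in auto)
    then have \<delta>: "\<delta> \<longlonglongrightarrow> 0" by simp
    have diff: "norm ((\<integral>x. w x *\<^sub>R f x \<partial>M) - (\<integral>x. w x *\<^sub>R s i x \<partial>M)) \<le> \<delta> i"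
      if "w \<in> borel_measurable M" "AE x in M. \<bar>w x\<bar> \<le> G x" for w i
    proof -
      have "(\<integral>x. w x *\<^sub>R f x \<partial>M) - (\<integral>x. w x *\<^sub>R s i x \<partial>M) = (\<integral>x. w x *\<^sub>R (f x - s i x) \<partial>M)"
        unfolding scaleR_diff_right
        using lim.hyps(1)[of i] by (intro Bochner_Integration.integral_diff[symmetric] bnd(1) lim.hyps(4) that) simp_all
      with bnd(2)[OF intd[of i] that] show ?thesis by (simp add: \<delta>_def)
    qed
    show ?case
    proof (rule tendstoI)
      fix e :: real assume e: "e > 0"
      have "eventually (\<lambda>i. \<delta> i < e / 3) sequentially"
        using e by (intro order_tendstoD(2)[OF \<delta>]) simp
      then obtain i where i: "\<delta> i < e / 3" by (auto simp: eventually_sequentially)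
      have "eventually (\<lambda>k. dist (\<integral>x. h k x *\<^sub>R s i x \<partial>M) (\<integral>x. H x *\<^sub>R s i x \<partial>M) < e / 3) F"
        using lim.IH[of i] e by (intro tendstoD) auto
      then show "eventually (\<lambda>k. dist (\<integral>x. h k x *\<^sub>R f x \<partial>M) (\<integral>x. H x *\<^sub>R f x \<partial>M) < e) F"
      proof eventually_elim
        case (elim k)
        have "dist (\<integral>x. h k x *\<^sub>R f x \<partial>M) (\<integral>x. h k x *\<^sub>R s i x \<partial>M) \<le> \<delta> i"
          using diff[OF h(1) hG, of k i] by (simp add: dist_norm)
        moreover have "dist (\<integral>x. H x *\<^sub>R f x \<partial>M) (\<integral>x. H x *\<^sub>R s i x \<partial>M) \<le> \<delta> i"
          using diff[OF Hm HG, of i] by (simp add: dist_norm)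
        ultimately show ?case using elim i
          dist_triangle[of "\<integral>x. h k x *\<^sub>R f x \<partial>M" "\<integral>x. H x *\<^sub>R f x \<partial>M" "\<integral>x. h k x *\<^sub>R s i x \<partial>M"]
          dist_triangle2[of "\<integral>x. h k x *\<^sub>R s i x \<partial>M" "\<integral>x. H x *\<^sub>R f x \<partial>M" "\<integral>x. H x *\<^sub>R s i x \<partial>M"]
          by linarith
      qed
    qed
  qed
  show ?thesis by (rule that[OF F(1,2) Hm HG conv])
qed

section \<open>Weak quasi-norms, dyadic layers and coverings\<close>

lemma ennreal_less_divide:
  assumes "0 < l" "0 \<le> b"
  shows "ennreal b < g / ennreal l \<longleftrightarrow> ennreal (b * l) < g"
  using assms by (cases g) (auto simp: divide_ennreal ennreal_less_iff pos_less_divide_eq ennreal_top_divide)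

lemma Lp_norm_mono:
  assumes "AE x in lebesgue. \<bar>f x\<bar> \<le> \<bar>g x\<bar>" "\<And>x. 0 < p x"
  shows "Lp_norm p f \<le> Lp_norm p g"
  unfolding Lp_norm_def
proof (rule Inf_superset_mono, safe)
  fix l :: real
  assume l: "0 < l" "(\<integral>\<^sup>+x. ennreal ((\<bar>g x\<bar> / l) powr p x) \<partial>lebesgue) \<le> 1"
  have "(\<integral>\<^sup>+x. ennreal ((\<bar>f x\<bar> / l) powr p x) \<partial>lebesgue) \<le> (\<integral>\<^sup>+x. ennreal ((\<bar>g x\<bar> / l) powr p x) \<partial>lebesgue)"
    by (rule nn_integral_mono_AE)
      (use assms(1) in \<open>eventually_elim, auto intro!: ennreal_leI powr_mono2 divide_right_mono
         simp: assms(2) less_imp_le l(1)\<close>)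
  with l show "\<exists>l'. ennreal l = ennreal l' \<and> 0 < l' \<and> (\<integral>\<^sup>+x. ennreal ((\<bar>f x\<bar> / l') powr p x) \<partial>lebesgue) \<le> 1"
    by (intro exI[of _ l]) auto
qed

lemma WLp_norm_nn_mono:
  assumes "AE x in lebesgue. g x \<le> ennreal C * h x" "0 < C" "\<And>x. 0 < p x"
  shows "WLp_norm_nn p g \<le> ennreal C * WLp_norm_nn p h"
  unfolding WLp_norm_nn_def
proof (rule SUP_least)
  fix a :: real assume "a \<in> {0<..}"
  then have a: "a > 0" by simp
  have "Lp_norm p (indicator {x. ennreal a < g x}) \<le> Lp_norm p (indicator {x. ennreal (a / C) < h x})"
  proof (rule Lp_norm_mono[OF _ assms(3)])
    show "AE x in lebesgue. \<bar>indicator {x. ennreal a < g x} x :: real\<bar> \<le> \<bar>indicator {x. ennreal (a / C) < h x} x\<bar>"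
      using assms(1)
    proof eventually_elim
      case (elim x)
      have "ennreal (a / C) < h x" if "ennreal a < g x"
      proof (rule ccontr)
        assume "\<not> ennreal (a / C) < h x"
        then have "ennreal C * h x \<le> ennreal C * ennreal (a / C)"
          by (intro mult_left_mono) auto
        also have "\<dots> = ennreal a" using assms(2) a by (simp flip: ennreal_mult)
        finally show False using that elim by auto
      qed
      then show ?case by (auto simp: indicator_def)
    qed
  qed
  then have "ennreal a * Lp_norm p (indicator {x. ennreal a < g x}) \<le>
     ennreal a * Lp_norm p (indicator {x. ennreal (a / C) < h x})"
    by (intro mult_left_mono) auto
  also have "\<dots> = ennreal C * (ennreal (a / C) * Lp_norm p (indicator {x. ennreal (a / C) < h x}))"
    using a assms(2) by (simp flip: ennreal_mult mult.assoc)
  also have "\<dots> \<le> ennreal C * (SUP \<alpha>\<in>{0<..}. ennreal \<alpha> * Lp_norm p (indicator {x. ennreal \<alpha> < h x}))"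
    using a assms(2) by (intro mult_left_mono SUP_upper) auto
  finally show "ennreal a * Lp_norm p (indicator {x. ennreal a < g x}) \<le> \<dots>" .
qed

text \<open>Strictness turns the infimum in \<open>Lp_norm\<close> into an admissible scale
  \<open>m < 1 / b\<close>; monotonicity of powers then replaces \<open>1 / m\<close> by
  \<open>b\<close>.\<close>

lemma WLp_norm_nn_lessD:
  assumes less: "WLp_norm_nn p g < ennreal l" and "0 < l" "0 < b" and p: "\<And>x. 0 < p x"
  shows "(\<integral>\<^sup>+x. ennreal (b powr p x) * indicator {x. ennreal (b * l) < g x} x \<partial>lebesgue) \<le> 1"
proof -
  let ?A = "{x. ennreal (b * l) < g x}"
  have "ennreal (b * l) * Lp_norm p (indicator ?A) \<le> WLp_norm_nn p g"
    unfolding WLp_norm_nn_def using assms by (intro SUP_upper) auto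
  with less have *: "ennreal (b * l) * Lp_norm p (indicator ?A) < ennreal l" by simp
  have "Lp_norm p (indicator ?A) < ennreal (1 / b)"
  proof (rule ccontr)
    assume "\<not> ?thesis"
    then have "ennreal (b * l) * ennreal (1 / b) \<le> ennreal (b * l) * Lp_norm p (indicator ?A)"
      by (intro mult_left_mono) auto
    with * show False using assms(2,3) by (simp flip: ennreal_mult)
  qed
  then obtain m where m: "0 < m" "(\<integral>\<^sup>+x. ennreal ((\<bar>indicator ?A x\<bar> / m) powr p x) \<partial>lebesgue) \<le> 1" "ennreal m < ennreal (1 / b)"
    unfolding Lp_norm_def Inf_less_iff by auto
  then have bm: "b \<le> 1 / m" using \<open>0 < b\<close> by (simp add: ennreal_less_iff field_simps)
  have "(\<integral>\<^sup>+x. ennreal (b powr p x) * indicator ?A x \<partial>lebesgue) \<le> (\<integral>\<^sup>+x. ennreal ((\<bar>indicator ?A x\<bar> / m) powr p x) \<partial>lebesgue)"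
    using bm \<open>0 < b\<close> p by (intro nn_integral_mono) (auto simp: indicator_def less_imp_le intro!: ennreal_leI powr_mono2)
  with m(2) show ?thesis by simp
qed

text \<open>For \<open>p x \<ge> 1\<close> and \<open>K \<ge> 1\<close> one has
  \<open>(1 / K) powr p x \<le> 1 / K\<close>, so lowering the level by the factor \<open>K\<close>
  brings the modular below 1.\<close>

lemma Lp_norm_indicator_le:
  assumes "A \<in> sets lebesgue" "p \<in> borel_measurable lebesgue" "AE x in lebesgue. 1 \<le> p x"
    and "0 < b" "1 \<le> K" and le: "(\<integral>\<^sup>+x. ennreal (b powr p x) * indicator A x \<partial>lebesgue) \<le> ennreal K"
  shows "ennreal b * Lp_norm p (indicator A) \<le> ennreal K"
proof -
  have "(\<integral>\<^sup>+x. ennreal ((\<bar>indicator A x\<bar> / (K / b)) powr p x) \<partial>lebesgue) \<le>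
        (\<integral>\<^sup>+x. ennreal (1 / K) * (ennreal (b powr p x) * indicator A x) \<partial>lebesgue)"
  proof (rule nn_integral_mono_AE)
    show "AE x in lebesgue. ennreal ((\<bar>indicator A x\<bar> / (K / b)) powr p x) \<le> ennreal (1 / K) * (ennreal (b powr p x) * indicator A x)"
      using assms(3)
    proof eventually_elim
      case (elim x)
      have "(b / K) powr p x = (1 / K) powr p x * b powr p x"
        using assms(4,5) by (subst powr_mult[symmetric]) auto
      also have "(1 / K) powr p x \<le> (1 / K) powr 1"
        using elim assms(5) by (intro powr_mono') auto
      also have "(1 / K) powr 1 = 1 / K" using assms(5) by simp
      finally have "(b / K) powr p x \<le> 1 / K * b powr p x"
        by (simp add: mult_right_mono)
      then show ?case using assms(5)
        by (auto simp: indicator_def ennreal_leI simp flip: ennreal_mult)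
    qed
  qed
  also have "\<dots> = ennreal (1 / K) * (\<integral>\<^sup>+x. ennreal (b powr p x) * indicator A x \<partial>lebesgue)"
    supply assms(1,2)[measurable] by (intro nn_integral_cmult) measurable
  also have "\<dots> \<le> ennreal (1 / K) * ennreal K" by (intro mult_left_mono le) auto
  also have "\<dots> = 1" using assms(5) by (simp flip: ennreal_mult)
  finally have "Lp_norm p (indicator A) \<le> ennreal (K / b)"
    unfolding Lp_norm_def using assms(4,5) by (intro Inf_lower) (auto intro!: exI[of _ "K / b"])
  then have "ennreal b * Lp_norm p (indicator A) \<le> ennreal b * ennreal (K / b)"
    by (intro mult_left_mono) auto
  also have "\<dots> = ennreal K" using assms(4) by (simp flip: ennreal_mult')
  finally show ?thesis .
qed

lemma emeasure_lborel_cball_vec: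
  "0 \<le> r \<Longrightarrow> emeasure lborel (cball (c :: real^'n) r) = ennreal (unit_ball_vol (real CARD('n)) * r ^ CARD('n))"
  by (simp add: emeasure_cball)

lemma unit_ball_vol_card_pos: "0 < unit_ball_vol (real CARD('n::finite))"
  by (intro unit_ball_vol_pos) simp

section \<open>Dyadic layers of functions and kernels\<close>

lemma dyadic_bracket:
  fixes r :: real
  assumes "1 < r"
  obtains k where "2 ^ k < r" "r \<le> 2 ^ Suc k"
proof -
  have "\<exists>k. r \<le> 2 ^ Suc k"
    using real_arch_pow[of 2 r] by (metis less_imp_le one_less_numeral_iff order.strict_trans power_strict_increasing_iff lessI semiring_norm(76))
  then have L: "r \<le> 2 ^ Suc (LEAST k. r \<le> 2 ^ Suc k)" by (rule LeastI_ex)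
  have "2 ^ (LEAST k. r \<le> 2 ^ Suc k) < r"
  proof (cases "LEAST k. r \<le> 2 ^ Suc k")
    case (Suc j)
    then have "\<not> r \<le> 2 ^ Suc j" using not_less_Least[of j "\<lambda>k. r \<le> 2 ^ Suc k"] by simp
    with Suc show ?thesis by simp
  qed (use assms in simp)
  with L show ?thesis by (rule that[rotated])
qed

lemma dyadic_layers:
  fixes h :: ennreal
  assumes "1 < h"
  shows "h \<le> (\<Sum>k. ennreal (2 ^ Suc k) * of_bool (ennreal (2 ^ k) < h))"
proof (cases h)
  case (real r)
  then have "1 < r" using assms by (simp add: ennreal_less_iff flip: ennreal_1)
  then obtain k where k: "2 ^ k < r" "r \<le> 2 ^ Suc k" by (rule dyadic_bracket)
  have "h \<le> (\<Sum>k\<in>{k}. ennreal (2 ^ Suc k) * of_bool (ennreal (2 ^ k) < h))"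
    using k real by (simp add: ennreal_less_iff ennreal_leI del: power_Suc)
  also have "\<dots> \<le> (\<Sum>k. ennreal (2 ^ Suc k) * of_bool (ennreal (2 ^ k) < h))"
    by (rule sum_le_suminf) auto
  finally show ?thesis .
next
  case top
  have "of_nat n \<le> (\<Sum>k. ennreal (2 ^ Suc k) * of_bool (ennreal (2 ^ k) < h))" for n
  proof -
    have "of_nat n = (\<Sum>k<n. 1 :: ennreal)" by simp
    also have "\<dots> \<le> (\<Sum>k<n. ennreal (2 ^ Suc k) * of_bool (ennreal (2 ^ k) < h))"
    proof (rule sum_mono)
      fix k
      have "(1::real) \<le> 2 ^ Suc k" by (rule one_le_power) simp
      from ennreal_leI[OF this] show "1 \<le> ennreal (2 ^ Suc k) * of_bool (ennreal (2 ^ k) < h)"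
        using top by simp
    qed
    also have "\<dots> \<le> (\<Sum>k. ennreal (2 ^ Suc k) * of_bool (ennreal (2 ^ k) < h))"
      by (rule sum_le_suminf) auto
    finally show ?thesis .
  qed
  then have "(SUP n. of_nat n :: ennreal) \<le> (\<Sum>k. ennreal (2 ^ Suc k) * of_bool (ennreal (2 ^ k) < h))"
    by (rule SUP_least)
  then show ?thesis by (simp add: ennreal_SUP_of_nat_eq_top top_unique)
qed

text \<open>The layer where \<open>h\<close> lies between \<open>2 ^ k\<close> and
  \<open>2 ^ Suc k\<close> contributes at most \<open>2 ^ Suc k / q ^ k\<close>. The condition
  \<open>2 < q\<close> makes these terms summable, and the stated constant is their sum.\<close>

lemma nn_integral_layers:
  fixes w h :: "'a \<Rightarrow> ennreal"
  assumes [measurable]: "w \<in> borel_measurable M" "h \<in> borel_measurable M"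
    and le: "\<And>k. (\<integral>\<^sup>+x. w x * indicator {x. ennreal (2 ^ k) < h x} x \<partial>M) \<le> ennreal (1 / q ^ k)"
    and q: "2 < q"
  shows "(\<integral>\<^sup>+x. w x * (h x * indicator {x. 1 < h x} x) \<partial>M) \<le> ennreal (2 / (1 - 2 / q))"
proof -
  have "(\<integral>\<^sup>+x. w x * (h x * indicator {x. 1 < h x} x) \<partial>M) \<le>
     (\<integral>\<^sup>+x. (\<Sum>k. ennreal (2 ^ Suc k) * (w x * indicator {x. ennreal (2 ^ k) < h x} x)) \<partial>M)"
  proof (rule nn_integral_mono)
    fix x
    have "h x * indicator {x. 1 < h x} x \<le> (\<Sum>k. ennreal (2 ^ Suc k) * of_bool (ennreal (2 ^ k) < h x))"
      using dyadic_layers[of "h x"] by (auto simp: indicator_def)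
    then have "w x * (h x * indicator {x. 1 < h x} x) \<le> w x * (\<Sum>k. ennreal (2 ^ Suc k) * of_bool (ennreal (2 ^ k) < h x))"
      by (intro mult_left_mono) auto
    also have "\<dots> = (\<Sum>k. ennreal (2 ^ Suc k) * (w x * indicator {x. ennreal (2 ^ k) < h x} x))"
      by (subst ennreal_suminf_cmult[symmetric]) (auto intro!: suminf_cong simp: indicator_def of_bool_def ac_simps)
    finally show "w x * (h x * indicator {x. 1 < h x} x) \<le> \<dots>" .
  qed
  also have "\<dots> = (\<Sum>k. ennreal (2 ^ Suc k) * (\<integral>\<^sup>+x. w x * indicator {x. ennreal (2 ^ k) < h x} x \<partial>M))"
    by (subst nn_integral_suminf) (auto simp: nn_integral_cmult)
  also have "\<dots> \<le> (\<Sum>k. ennreal (2 * (2 / q) ^ k))"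
  proof (rule suminf_le)
    fix k
    have "ennreal (2 ^ Suc k) * (\<integral>\<^sup>+x. w x * indicator {x. ennreal (2 ^ k) < h x} x \<partial>M) \<le> ennreal (2 ^ Suc k) * ennreal (1 / q ^ k)"
      by (intro mult_left_mono le) auto
    also have "\<dots> = ennreal (2 * (2 / q) ^ k)"
      using q by (simp add: power_divide flip: ennreal_mult)
    finally show "ennreal (2 ^ Suc k) * (\<integral>\<^sup>+x. w x * indicator {x. ennreal (2 ^ k) < h x} x \<partial>M) \<le> \<dots>" .
  qed auto
  also have "\<dots> = ennreal (2 / (1 - 2 / q))"
  proof (rule suminf_ennreal_eq)
    show "(\<lambda>k. 2 * (2 / q) ^ k) sums (2 / (1 - 2 / q))"
      using sums_mult[OF geometric_sums[of "2 / q"], of 2] q by simp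
  qed (use q in auto)
  finally show ?thesis .
qed

text \<open>A point with \<open>2 ^ j < norm z \<le> 2 ^ Suc j\<close> is charged to the ball of
  index \<open>Suc j\<close>. Rounding the radius up costs the factor \<open>2 ^ N\<close>.\<close>

lemma kernel_le_dyadic:
  fixes z :: "'a::real_normed_vector"
  shows "ennreal (1 / (1 + norm z) ^ N) \<le> (\<Sum>k. ennreal (2 ^ N / 2 ^ (k * N)) * indicator (cball 0 (2 ^ k)) z)"
proof -
  obtain k where k: "norm z \<le> 2 ^ k" "1 / (1 + norm z) ^ N \<le> 2 ^ N / 2 ^ (k * N)"
  proof (cases "norm z \<le> 1")
    case True
    have "1 / (1 + norm z) ^ N \<le> 1" using one_le_power[of "1 + norm z" N] frac_le[of 1 1 1 "(1 + norm z) ^ N"] by simp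
    also have "\<dots> \<le> 2 ^ N / 2 ^ (0 * N)" by simp
    finally show ?thesis using that[of 0] True by simp
  next
    case False
    then obtain j where j: "2 ^ j < norm z" "norm z \<le> 2 ^ Suc j" using dyadic_bracket by (metis not_le)
    have "2 ^ (j * N) \<le> (1 + norm z) ^ N"
      unfolding power_mult using j by (intro power_mono) auto
    then have "1 / (1 + norm z) ^ N \<le> 1 / 2 ^ (j * N)"
      by (intro divide_left_mono) (auto intro!: mult_pos_pos zero_less_power add_pos_nonneg)
    also have "\<dots> = 2 ^ N / 2 ^ (Suc j * N)" by (simp add: power_add)
    finally show ?thesis using that[of "Suc j"] j by simp
  qed
  have "ennreal (1 / (1 + norm z) ^ N) \<le> (\<Sum>k\<in>{k}. ennreal (2 ^ N / 2 ^ (k * N)) * indicator (cball 0 (2 ^ k)) z)"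
    using k by (simp add: ennreal_leI)
  also have "\<dots> \<le> (\<Sum>k. ennreal (2 ^ N / 2 ^ (k * N)) * indicator (cball 0 (2 ^ k)) z)"
    by (rule sum_le_suminf) auto
  finally show ?thesis .
qed

text \<open>The sum over \<open>k\<close> of \<open>2 ^ N * (2 ^ n / 2 ^ N) ^ k\<close>, in which
  \<open>2 ^ n\<close> is the growth of ball volumes and \<open>2 ^ N\<close> the decay of the
  kernel from one dyadic ball to the next.\<close>

definition kernel_const :: "nat \<Rightarrow> nat \<Rightarrow> real" where
  "kernel_const N n = 2 ^ N / (1 - 2 ^ n / 2 ^ N)"

lemma kernel_const_pos: "n < N \<Longrightarrow> 0 < kernel_const N n"
  by (auto simp: kernel_const_def intro!: divide_pos_pos)

lemma kernel_average:
  fixes G :: "real^'n \<Rightarrow> ennreal"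
  assumes [measurable]: "G \<in> borel_measurable lebesgue" and t: "0 < t" and N: "n < N" and a: "0 \<le> a"
    and avg: "\<And>r. 0 < r \<Longrightarrow> (\<integral>\<^sup>+y. G y * indicator (cball x r) y \<partial>lebesgue) \<le> ennreal (a * r ^ n)"
  shows "(\<integral>\<^sup>+y. G y * ennreal (1 / (1 + norm ((x - y) /\<^sub>R t)) ^ N) \<partial>lebesgue) \<le> ennreal (a * t ^ n * kernel_const N n)"
proof -
  have ind: "indicator (cball 0 (2 ^ k)) ((x - y) /\<^sub>R t) = (indicator (cball x (t * 2 ^ k)) y :: ennreal)" for k y
    using t by (auto simp: indicator_def dist_norm divide_simps mult.commute)
  have cb[measurable]: "cball x r \<in> sets lebesgue" for r by simp
  have "(\<integral>\<^sup>+y. G y * ennreal (1 / (1 + norm ((x - y) /\<^sub>R t)) ^ N) \<partial>lebesgue) \<le>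
      (\<integral>\<^sup>+y. (\<Sum>k. ennreal (2 ^ N / 2 ^ (k * N)) * (G y * indicator (cball x (t * 2 ^ k)) y)) \<partial>lebesgue)"
  proof (rule nn_integral_mono)
    fix y
    have "G y * ennreal (1 / (1 + norm ((x - y) /\<^sub>R t)) ^ N) \<le>
        G y * (\<Sum>k. ennreal (2 ^ N / 2 ^ (k * N)) * indicator (cball x (t * 2 ^ k)) y)"
      using kernel_le_dyadic[of "(x - y) /\<^sub>R t" N] unfolding ind by (rule mult_left_mono) simp
    also have "\<dots> = (\<Sum>k. ennreal (2 ^ N / 2 ^ (k * N)) * (G y * indicator (cball x (t * 2 ^ k)) y))"
      by (subst ennreal_suminf_cmult[symmetric]) (simp add: ac_simps)
    finally show "G y * ennreal (1 / (1 + norm ((x - y) /\<^sub>R t)) ^ N) \<le> \<dots>" .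
  qed
  also have "\<dots> = (\<Sum>k. ennreal (2 ^ N / 2 ^ (k * N)) * (\<integral>\<^sup>+y. G y * indicator (cball x (t * 2 ^ k)) y \<partial>lebesgue))"
    by (subst nn_integral_suminf) (auto simp: nn_integral_cmult)
  also have "\<dots> \<le> (\<Sum>k. ennreal (a * t ^ n * (2 ^ N * (2 ^ n / 2 ^ N) ^ k)))"
  proof (rule suminf_le)
    fix k
    have "ennreal (2 ^ N / 2 ^ (k * N)) * (\<integral>\<^sup>+y. G y * indicator (cball x (t * 2 ^ k)) y \<partial>lebesgue) \<le>
      ennreal (2 ^ N / 2 ^ (k * N)) * ennreal (a * (t * 2 ^ k) ^ n)"
      using t by (intro mult_left_mono avg) auto
    also have "\<dots> = ennreal (a * t ^ n * (2 ^ N * (2 ^ n / 2 ^ N) ^ k))"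
      using a t by (simp add: power_divide power_mult_distrib field_simps flip: ennreal_mult power_mult)
    finally show "ennreal (2 ^ N / 2 ^ (k * N)) * (\<integral>\<^sup>+y. G y * indicator (cball x (t * 2 ^ k)) y \<partial>lebesgue) \<le> \<dots>" .
  qed auto
  also have "\<dots> = ennreal (a * t ^ n * kernel_const N n)"
  proof (rule suminf_ennreal_eq)
    have "norm (2 ^ n / 2 ^ N :: real) < 1" using N by simp
    from sums_mult[OF geometric_sums[OF this], of "a * t ^ n * 2 ^ N"]
    show "(\<lambda>k. a * t ^ n * (2 ^ N * (2 ^ n / 2 ^ N) ^ k)) sums (a * t ^ n * kernel_const N n)"
      by (simp add: kernel_const_def algebra_simps)
  qed (use a t in auto)
  finally show ?thesis .
qed

text \<open>The case of the constant function 1 in \<open>kernel_average\<close>: its integrals over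
  balls are the volumes.\<close>

lemma nn_integral_kernel_finite:
  "(\<integral>\<^sup>+x. ennreal (1 / (1 + norm x) ^ Suc CARD('n)) \<partial>(lebesgue :: (real^'n) measure)) < \<infinity>"
proof -
  have "(\<integral>\<^sup>+y. 1 * ennreal (1 / (1 + norm ((0 - y) /\<^sub>R 1)) ^ Suc CARD('n)) \<partial>(lebesgue :: (real^'n) measure)) \<le>
     ennreal (unit_ball_vol (real CARD('n)) * 1 ^ CARD('n) * kernel_const (Suc CARD('n)) CARD('n))"
    by (rule kernel_average) (auto simp: emeasure_lborel_cball_vec)
  also have "\<dots> < \<infinity>" by simp
  finally show ?thesis by simp
qed

section \<open>Selection of disjoint balls\<close>

lemma vitali_selection:
  fixes h :: "real^'n \<Rightarrow> ennreal"
  assumes fin: "(\<integral>\<^sup>+y. h y \<partial>lebesgue) < \<infinity>"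
    and S: "\<And>x. x \<in> S \<Longrightarrow> \<exists>r>0. emeasure lebesgue (cball x r) \<le> (\<integral>\<^sup>+y. h y * indicator (cball x r) y \<partial>lebesgue)"
  obtains C r where "countable C" "\<And>x. x \<in> C \<Longrightarrow> 0 < r x"
    "\<And>x. x \<in> C \<Longrightarrow> emeasure lebesgue (cball x (r x)) \<le> (\<integral>\<^sup>+y. h y * indicator (cball x (r x)) y \<partial>lebesgue)"
    "disjoint_family_on (\<lambda>x. cball x (r x)) C" "S \<subseteq> (\<Union>x\<in>C. cball x (5 * r x))"
proof -
  let ?\<omega> = "unit_ball_vol (real CARD('n))"
  from S obtain r where r: "0 < r x" 
    "emeasure lebesgue (cball x (r x)) \<le> (\<integral>\<^sup>+y. h y * indicator (cball x (r x)) y \<partial>lebesgue)" if "x \<in> S" for x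
    by metis
  obtain I where I: "0 \<le> I" "(\<integral>\<^sup>+y. h y \<partial>lebesgue) = ennreal I" using fin by (cases "\<integral>\<^sup>+y. h y \<partial>lebesgue") auto
  \<comment> \<open>Vitali's lemma asks for bounded radii. Each ball has volume at most
    \<open>I\<close>, and for \<open>r x > 1\<close> the radius is at most its own power
    \<open>r x ^ CARD('n)\<close>.\<close>
  have bound: "r x \<le> max 1 (I / ?\<omega>)" if x: "x \<in> S" for x
  proof (cases "r x \<le> 1")
    case False
    have "ennreal (?\<omega> * r x ^ CARD('n)) \<le> (\<integral>\<^sup>+y. h y * indicator (cball x (r x)) y \<partial>lebesgue)"
      using r[OF x] by (simp add: emeasure_lborel_cball_vec)
    also have "\<dots> \<le> ennreal I"
      unfolding I(2)[symmetric] by (intro nn_integral_mono) (simp add: indicator_def)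
    finally have "?\<omega> * r x ^ CARD('n) \<le> I" using I(1) by simp
    moreover have "r x \<le> r x ^ CARD('n)" using False by (intro self_le_power) auto
    ultimately have "?\<omega> * r x \<le> I"
      using unit_ball_vol_card_pos[where 'n='n] by (meson mult_left_mono less_imp_le order_trans)
    then show ?thesis using unit_ball_vol_card_pos[where 'n='n] by (simp add: pos_le_divide_eq mult.commute le_max_iff_disj)
  qed simp
  have cov: "S \<subseteq> (\<Union>x\<in>S. cball x (r x))"
  proof
    fix x assume "x \<in> S"
    with r(1)[of x] show "x \<in> (\<Union>x\<in>S. cball x (r x))" by (intro UN_I[of x]) auto
  qed
  have rb: "0 < r x \<and> r x \<le> max 1 (I / ?\<omega>)" if "x \<in> S" for x using r(1) bound that by blast
  obtain C where C: "countable C" "C \<subseteq> S" "pairwise (\<lambda>i j. disjnt (cball i (r i)) (cball j (r j))) C"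
     "S \<subseteq> (\<Union>i\<in>C. cball i (5 * r i))"
    by (rule Vitali_covering_lemma_cballs[OF cov rb]) (assumption, rule that)
  show ?thesis
  proof (rule that[OF C(1)])
    show "disjoint_family_on (\<lambda>x. cball x (r x)) C"
      using C(3) by (auto simp: disjoint_family_on_def pairwise_def disjnt_def)
  qed (use C r in auto)
qed

text \<open>Allows all estimates on the selected balls to be made for finite subfamilies, by
  continuity from below.\<close>

lemma emeasure_countable_UN_le:
  assumes C: "countable C" and A: "\<And>i. i \<in> C \<Longrightarrow> A i \<in> sets M"
    and le: "\<And>F. finite F \<Longrightarrow> F \<subseteq> C \<Longrightarrow> emeasure M (\<Union>i\<in>F. A i) \<le> c"
  shows "emeasure M (\<Union>i\<in>C. A i) \<le> c"
proof (cases "C = {}")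
  case False
  define B where "B = (\<lambda>n. \<Union>i\<in>from_nat_into C ` {..n}. A i)"
  have sub: "from_nat_into C ` {..n} \<subseteq> C" for n using False by (auto intro: from_nat_into)
  have "(\<Union>i\<in>C. A i) \<subseteq> (\<Union>n. B n)"
  proof
    fix x assume "x \<in> (\<Union>i\<in>C. A i)"
    then obtain i where i: "i \<in> C" "x \<in> A i" by blast
    obtain m where "from_nat_into C m = i" using from_nat_into_surj[OF C i(1)] by blast
    with i show "x \<in> (\<Union>n. B n)" by (auto simp: B_def)
  qed
  moreover have "(\<Union>n. B n) \<subseteq> (\<Union>i\<in>C. A i)" unfolding B_def using sub by blast
  ultimately have "(\<Union>i\<in>C. A i) = (\<Union>n. B n)" by (rule equalityI)
  also have "emeasure M \<dots> = (SUP n. emeasure M (B n))"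
  proof (rule SUP_emeasure_incseq[symmetric])
    show "range B \<subseteq> sets M"
      unfolding B_def using sub A by (intro image_subsetI sets.finite_UN) auto
    show "incseq B"
      unfolding B_def incseq_def by (intro allI impI UN_mono image_mono) auto
  qed
  also have "\<dots> \<le> c"
    unfolding B_def by (intro SUP_least le sub) auto
  finally show ?thesis .
qed (use le[of "{}"] in simp)

section \<open>The weak maximal inequality\<close>

text \<open>The exponent bounds as real numbers: \<open>pm\<close> lies above 1 and below
  \<open>p\<close> almost everywhere, while \<open>pp\<close> bounds \<open>p\<close> at every
  point, as the decay condition permits.\<close>

locale log_hoelder_exponent =
  fixes p :: "real^'n \<Rightarrow> real" and pm pp C_log C_inf p_inf :: real
  assumes p_measurable [measurable]: "p \<in> borel_measurable lebesgue"
    and p_pos: "0 < p x" and p_le: "p x \<le> pp" and pm: "1 < pm" and p_ge: "AE x in lebesgue. pm \<le> p x"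
    and C_log: "0 < C_log" and C_inf: "0 < C_inf"
    and local: "\<bar>p x - p y\<bar> \<le> C_log / ln (exp 1 + 1 / norm (x - y))"
    and decay: "\<bar>p x - p_inf\<bar> \<le> C_inf / ln (exp 1 + norm x)"
begin

text \<open>Otherwise the decay condition would keep \<open>p\<close> below \<open>pm\<close>
  outside a large ball, whose complement is open and nonempty and so not a null set.\<close>

lemma p_inf_ge: "pm \<le> p_inf"
proof (rule ccontr)
  assume "\<not> pm \<le> p_inf"
  then have d: "0 < pm - p_inf" by simp
  define R where "R = exp (C_inf / (pm - p_inf))"
  have "AE x in (lebesgue :: (real^'n) measure). norm x \<le> R"
    using p_ge
  proof eventually_elim
    case (elim x)
    have l: "0 < ln (exp 1 + norm x)" by (rule ln_gt_zero) (use exp_gt_one[of "1::real"] norm_ge_zero[of x] in linarith)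
    have "pm - p_inf \<le> C_inf / ln (exp 1 + norm x)" using elim decay[of x] by linarith
    then have "ln (exp 1 + norm x) \<le> C_inf / (pm - p_inf)"
      using l d by (simp add: field_simps)
    then have "exp (ln (exp 1 + norm x)) \<le> R" unfolding R_def by simp
    then have "exp 1 + norm x \<le> R" by (simp add: add_pos_nonneg)
    then show ?case using exp_gt_zero[of "1::real"] by linarith
  qed
  then have "- cball 0 R \<in> null_sets (lebesgue :: (real^'n) measure)"
    by (subst AE_iff_null_sets) (auto elim!: eventually_mono)
  then have "negligible (- cball 0 R :: (real^'n) set)" by (simp add: negligible_iff_null_sets)
  moreover have "open (- cball 0 R :: (real^'n) set)" by auto
  moreover have "- cball 0 R \<noteq> ({} :: (real^'n) set)"
  proof -
    have "(\<bar>R\<bar> + 1) *\<^sub>R axis undefined 1 \<in> (- cball 0 R :: (real^'n) set)" by simp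
    then show ?thesis by blast
  qed
  ultimately show False using open_not_negligible by blast
qed

lemma p_ge_1: "AE x in lebesgue. 1 \<le> p x"
  using p_ge by eventually_elim (use pm in simp)

text \<open>A modular form of \<open>WLp_norm_nn p F < 1\<close> that avoids the infimum in \<open>Lp_norm\<close>.\<close>

definition weak_bounded :: "(real^'n \<Rightarrow> ennreal) \<Rightarrow> bool" where
  "weak_bounded F \<longleftrightarrow> F \<in> borel_measurable lebesgue \<and>
     (\<forall>b>0. (\<integral>\<^sup>+x. ennreal (b powr p x) * indicator {x. ennreal b < F x} x \<partial>lebesgue) \<le> 1)"

lemma weak_boundedI:
  assumes "g \<in> borel_measurable lebesgue" "WLp_norm_nn p g < ennreal l" "0 < l"
  shows "weak_bounded (\<lambda>x. g x / ennreal l)"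
  unfolding weak_bounded_def
proof (intro conjI allI impI)
  fix b :: real assume "0 < b"
  then show "(\<integral>\<^sup>+x. ennreal (b powr p x) * indicator {x. ennreal b < g x / ennreal l} x \<partial>lebesgue) \<le> 1"
    using WLp_norm_nn_lessD[OF assms(2,3) \<open>0 < b\<close> p_pos] assms(3) by (simp add: ennreal_less_divide)
qed (use assms(1) in measurable)

text \<open>The constant of \<open>nn_integral_layers\<close> for \<open>q = 2 powr pm\<close>; it
  is meaningful because \<open>pm > 1\<close>.\<close>

definition layer_const :: real where "layer_const = 2 / (1 - 2 / 2 powr pm)"

lemma two_less: "2 < (2::real) powr pm"
  using powr_less_mono[of 1 pm 2] pm by simp

lemma layer_const_pos: "0 < layer_const"
  using two_less by (auto simp: layer_const_def intro!: divide_pos_pos)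

text \<open>Raising the level from \<open>a\<close> to \<open>2 ^ k * a\<close> multiplies the
  weight by at least \<open>(2 powr pm) ^ k\<close>, while the weighted measure of the level set
  stays below 1. So the part of \<open>F / a\<close> above 1 satisfies a strong bound with respect
  to the weight \<open>a powr p x\<close>, although \<open>F\<close> satisfies only a weak
  one.\<close>

lemma weak_bounded_layer:
  assumes F: "weak_bounded F" and a: "0 < a"
  shows "(\<integral>\<^sup>+x. ennreal (a powr p x) * (F x / ennreal a * indicator {x. 1 < F x / ennreal a} x) \<partial>lebesgue) \<le> ennreal layer_const"
  unfolding layer_const_def
proof (rule nn_integral_layers)
  have Fm[measurable]: "F \<in> borel_measurable lebesgue" using F by (simp add: weak_bounded_def)
  show "(\<lambda>x. F x / ennreal a) \<in> borel_measurable lebesgue" by measurable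
  fix k :: nat
  define b where "b = 2 ^ k * a"
  have b: "0 < b" using a by (simp add: b_def)
  have "(\<integral>\<^sup>+x. ennreal (a powr p x) * indicator {x. ennreal (2 ^ k) < F x / ennreal a} x \<partial>lebesgue) \<le>
    (\<integral>\<^sup>+x. ennreal (1 / (2 powr pm) ^ k) * (ennreal (b powr p x) * indicator {x. ennreal b < F x} x) \<partial>lebesgue)"
  proof (rule nn_integral_mono_AE)
    show "AE x in lebesgue. ennreal (a powr p x) * indicator {x. ennreal (2 ^ k) < F x / ennreal a} x \<le>
       ennreal (1 / (2 powr pm) ^ k) * (ennreal (b powr p x) * indicator {x. ennreal b < F x} x)"
      using p_ge
    proof eventually_elim
      case (elim x)
      have "(2 powr pm) ^ k = (2 ^ k) powr pm" by (simp add: powr_powr powr_realpow[symmetric] mult.commute)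
      also have "\<dots> \<le> (2 ^ k) powr p x" by (intro powr_mono elim) simp
      finally have "(2 powr pm) ^ k * a powr p x \<le> b powr p x"
        unfolding b_def using a by (subst powr_mult) (auto intro: mult_right_mono)
      then have "a powr p x \<le> 1 / (2 powr pm) ^ k * b powr p x"
        by (simp add: pos_le_divide_eq mult.commute)
      then show ?case using a
        by (auto simp: ennreal_less_divide b_def indicator_def ennreal_leI simp flip: ennreal_mult)
    qed
  qed
  also have "\<dots> = ennreal (1 / (2 powr pm) ^ k) * (\<integral>\<^sup>+x. ennreal (b powr p x) * indicator {x. ennreal b < F x} x \<partial>lebesgue)"
    by (rule nn_integral_cmult) measurable
  also have "\<dots> \<le> ennreal (1 / (2 powr pm) ^ k) * 1"
    using F b unfolding weak_bounded_def by (intro mult_left_mono) auto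
  finally show "(\<integral>\<^sup>+x. ennreal (a powr p x) * indicator {x. ennreal (2 ^ k) < F x / ennreal a} x \<partial>lebesgue) \<le> ennreal (1 / (2 powr pm) ^ k)"
    by simp
qed (use two_less in \<open>auto intro!: measurable_compose[OF _ measurable_ennreal]\<close>)

lemma weak_bounded_large_part:
  assumes F: "weak_bounded F"
  shows "(\<integral>\<^sup>+x. F x * indicator {x. 1 < F x} x \<partial>lebesgue) \<le> ennreal layer_const"
  using weak_bounded_layer[OF F, of 1] by (simp add: divide_ennreal_def)

text \<open>The splitting into a bounded and an integrable part: \<open>F \<le> 1\<close> leaves at
  most \<open>v\<close>, and the part of \<open>F\<close> above 1 is integrable by the layer
  estimate at level 1.\<close>

lemma weak_bounded_weighted:
  assumes F: "weak_bounded F" and v: "v \<in> borel_measurable lebesgue" "\<And>x. v x \<le> 1"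
  shows "(\<integral>\<^sup>+x. F x * v x \<partial>lebesgue) \<le> (\<integral>\<^sup>+x. v x \<partial>lebesgue) + ennreal layer_const"
proof -
  have Fm[measurable]: "F \<in> borel_measurable lebesgue" using F by (simp add: weak_bounded_def)
  note v(1)[measurable]
  have "(\<integral>\<^sup>+x. F x * v x \<partial>lebesgue) \<le> (\<integral>\<^sup>+x. v x + F x * indicator {x. 1 < F x} x \<partial>lebesgue)"
  proof (rule nn_integral_mono)
    fix x
    have "F x * v x \<le> 1 * v x" if "\<not> 1 < F x" using that by (intro mult_right_mono) auto
    moreover have "F x * v x \<le> F x * 1" using v(2) by (intro mult_left_mono) auto
    ultimately show "F x * v x \<le> v x + F x * indicator {x. 1 < F x} x"
      by (auto simp: indicator_def add_increasing)
  qed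
  also have "\<dots> = (\<integral>\<^sup>+x. v x \<partial>lebesgue) + (\<integral>\<^sup>+x. F x * indicator {x. 1 < F x} x \<partial>lebesgue)"
    by (rule nn_integral_add) measurable
  also have "\<dots> \<le> (\<integral>\<^sup>+x. v x \<partial>lebesgue) + ennreal layer_const"
    by (intro add_left_mono weak_bounded_large_part F)
  finally show ?thesis .
qed

text \<open>\<open>Suc CARD('n)\<close> is the least integer exponent that makes the weight
  integrable.\<close>

abbreviation polynomial_weight :: "real^'n \<Rightarrow> real" where
  "polynomial_weight x \<equiv> 1 / (1 + norm x) ^ Suc CARD('n)"

lemma polynomial_weight_le_1: "polynomial_weight x \<le> 1"
  using one_le_power[of "1 + norm x" "Suc CARD('n)"] frac_le[of 1 1 1 "(1 + norm x) ^ Suc CARD('n)"] by simp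

lemma polynomial_weight_pos: "0 < polynomial_weight x"
  by (intro divide_pos_pos zero_less_power) (auto simp: add_pos_nonneg)

lemma polynomial_weight_measurable [measurable]: "polynomial_weight \<in> borel_measurable lebesgue"
  by (rule measurable_completion) measurable

lemma weak_bounded_polynomial_weight:
  assumes "weak_bounded F"
  shows "(\<integral>\<^sup>+x. F x * ennreal (polynomial_weight x) \<partial>lebesgue) < \<infinity>"
proof -
  have "(\<integral>\<^sup>+x. F x * ennreal (polynomial_weight x) \<partial>lebesgue) \<le>
     (\<integral>\<^sup>+x. ennreal (polynomial_weight x) \<partial>lebesgue) + ennreal layer_const"
    by (rule weak_bounded_weighted[OF assms]) (use polynomial_weight_le_1 in \<open>simp_all del: power_Suc add: ennreal_le_1\<close>)
  also have "\<dots> < \<infinity>" using nn_integral_kernel_finite[where 'n='n] by (simp add: ennreal_add_eq_top less_top)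
  finally show ?thesis .
qed

lemma weak_bounded_finite: "weak_bounded F \<Longrightarrow> AE x in lebesgue. F x < \<infinity>"
proof -
  assume F: "weak_bounded F"
  then have [measurable]: "F \<in> borel_measurable lebesgue" by (simp add: weak_bounded_def)
  have "(\<integral>\<^sup>+x. F x * indicator {x. 1 < F x} x \<partial>lebesgue) \<noteq> \<infinity>"
    using weak_bounded_large_part[OF F] by (auto simp: top_unique)
  then have "AE x in lebesgue. F x * indicator {x. 1 < F x} x \<noteq> \<infinity>"
    by (intro nn_integral_PInf_AE) measurable
  then show ?thesis
  proof eventually_elim
    case (elim x)
    show ?case
    proof (cases "1 < F x")
      case True
      with elim show ?thesis by (simp add: less_top)
    next
      case False
      then have "F x \<le> 1" by simp
      also have "1 < (\<infinity> :: ennreal)" by simp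
      finally show ?thesis .
    qed
  qed
qed

section \<open>Comparison of weights with different exponents\<close>

lemma ln_log_term_ge_1: "1 \<le> ln (exp 1 + t)" if "0 \<le> t" for t :: real
proof -
  have "ln (exp 1) \<le> ln (exp 1 + t)" using that by (intro ln_mono) auto
  then show ?thesis by simp
qed

text \<open>The volume bound says that \<open>ln a\<close> is at most a constant plus
  \<open>n\<close> times \<open>ln (1 / r)\<close>, and local log-Hoelder continuity says that
  \<open>p\<close> varies by at most the reciprocal of such a logarithm over distances up to
  \<open>6 * r\<close>. The product of the two is bounded. The radius \<open>6 * r\<close> separates
  a point of the fivefold ball from a point of the ball itself.\<close>

lemma local_comparison:
  assumes a: "1 \<le> a" and r: "0 < r" and vol: "a * r ^ CARD('n) \<le> c" "0 < c"
    and xy: "norm (x - y) \<le> 6 * r"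
  shows "a powr p x \<le> exp ((\<bar>ln c\<bar> + real CARD('n) * ln 6 + real CARD('n)) * C_log) * a powr p y"
proof -
  let ?n = "real CARD('n)"
  \<comment> \<open>The logarithm from the log-Hoelder condition at distance \<open>6 * r\<close>.
    Since \<open>D \<ge> 1\<close>, it also absorbs the additive constants in the bound for
    \<open>ln a\<close>.\<close>
  define D where "D = ln (exp 1 + 1 / (6 * r))"
  define \<kappa> where "\<kappa> = \<bar>ln c\<bar> + ?n * ln 6 + ?n"
  have D: "1 \<le> D" unfolding D_def using r by (intro ln_log_term_ge_1) auto
  have "ln (a * r ^ CARD('n)) \<le> ln c" using vol a r by (intro ln_mono mult_pos_pos) auto
  then have "ln a + ?n * ln r \<le> ln c" using a r by (simp add: ln_mult ln_realpow)
  moreover have "- ln r \<le> ln 6 + D"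
  proof -
    have "ln (1 / (6 * r)) \<le> D" unfolding D_def using r exp_gt_zero[of "1::real"] by (intro ln_mono) (auto simp: add_pos_pos)
    then show ?thesis using r by (simp add: ln_div ln_mult)
  qed
  then have "?n * (- ln r) \<le> ?n * (ln 6 + D)" by (intro mult_left_mono) auto
  ultimately have "ln a \<le> \<bar>ln c\<bar> + ?n * ln 6 + ?n * D" by (simp add: algebra_simps)
  also have "\<dots> \<le> (\<bar>ln c\<bar> + ?n * ln 6) * D + ?n * D"
    using mult_left_mono[OF D, of "\<bar>ln c\<bar> + ?n * ln 6"] by simp
  finally have la: "ln a \<le> \<kappa> * D" by (simp add: \<kappa>_def algebra_simps)
  have osc: "p x - p y \<le> C_log / D"
  proof (cases "x = y")
    case False
    then have "0 < norm (x - y)" by simp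
    then have "1 / (6 * r) \<le> 1 / norm (x - y)" using xy r by (intro divide_left_mono mult_pos_pos) auto
    then have "D \<le> ln (exp 1 + 1 / norm (x - y))"
      unfolding D_def using r by (intro ln_mono) (auto intro!: add_pos_pos)
    then have "C_log / ln (exp 1 + 1 / norm (x - y)) \<le> C_log / D"
      using D C_log by (intro divide_left_mono) auto
    with local[of x y] show ?thesis by linarith
  qed (use C_log D in simp)
  have "ln a * (p x - p y) \<le> ln a * (C_log / D)" using a osc by (intro mult_left_mono) auto
  also have "\<dots> \<le> \<kappa> * D * (C_log / D)" using la C_log D by (intro mult_right_mono) auto
  also have "\<dots> = \<kappa> * C_log" using D by simp
  finally have le: "ln a * (p x - p y) \<le> \<kappa> * C_log" .
  have "a powr p x = exp (ln a * (p x - p y)) * a powr p y"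
    using a by (simp add: powr_def exp_add[symmetric] algebra_simps)
  also have "\<dots> \<le> exp (\<kappa> * C_log) * a powr p y" using le by (intro mult_right_mono) auto
  finally show ?thesis by (simp add: \<kappa>_def)
qed

text \<open>The lower bound on \<open>a\<close> says
  \<open>- ln a \<le> m * ln (exp 1 + norm x)\<close>, and this logarithm cancels the one in the
  decay condition.\<close>

lemma decay_comparison:
  assumes a: "0 < a" "a < 1" and m: "0 \<le> m" "(exp 1 + norm x) powr (- m) \<le> a"
  shows "a powr p x \<le> exp (m * C_inf) * a powr p_inf" "a powr p_inf \<le> exp (m * C_inf) * a powr p x"
proof -
  define L where "L = ln (exp 1 + norm x)"
  have L: "1 \<le> L" unfolding L_def by (rule ln_log_term_ge_1) simp
  have e: "0 < exp 1 + norm x" by (simp add: add_pos_nonneg)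
  have "ln ((exp 1 + norm x) powr (- m)) \<le> ln a" using m e by (intro ln_mono) auto
  then have la: "- ln a \<le> m * L" using e by (simp add: L_def ln_powr)
  have "(- ln a) * \<bar>p x - p_inf\<bar> \<le> (m * L) * (C_inf / L)"
    using la decay[of x] a L m by (intro mult_mono) (auto simp: L_def)
  also have "\<dots> = m * C_inf" using L by simp
  finally have *: "\<bar>ln a * (p x - p_inf)\<bar> \<le> m * C_inf" using a by (simp add: abs_mult)
  have "a powr p x = exp (ln a * (p x - p_inf)) * a powr p_inf"
    "a powr p_inf = exp (- (ln a * (p x - p_inf))) * a powr p x"
    using a by (simp_all add: powr_def exp_add[symmetric] algebra_simps)
  moreover have "exp (ln a * (p x - p_inf)) \<le> exp (m * C_inf)" "exp (- (ln a * (p x - p_inf))) \<le> exp (m * C_inf)"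
    using * by auto
  ultimately show "a powr p x \<le> exp (m * C_inf) * a powr p_inf" "a powr p_inf \<le> exp (m * C_inf) * a powr p x"
    by (metis mult_right_mono powr_ge_zero)+
qed

text \<open>The set where the centred maximal function of \<open>F\<close> exceeds
  \<open>2 * a\<close>, written without division. The factor 2 leaves room in
  \<open>bad_ball\<close> to discard the part of \<open>F\<close> below \<open>a\<close>.\<close>

definition bad_set :: "(real^'n \<Rightarrow> ennreal) \<Rightarrow> real \<Rightarrow> (real^'n) set" where
  "bad_set F a = {x. \<exists>r>0. ennreal (2 * a) * emeasure lebesgue (cball x r) <
     (\<integral>\<^sup>+y. F y * indicator (cball x r) y \<partial>lebesgue)}"

text \<open>With \<open>h\<close> the part of \<open>F / a\<close> above 1, one has
  \<open>F \<le> a + a * h\<close>. An average of \<open>F\<close> above \<open>2 * a\<close> thus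
  forces an average of \<open>h\<close> of at least 1.\<close>

lemma bad_ball:
  assumes F[measurable]: "F \<in> borel_measurable lebesgue" and a: "0 < a"
    and bad: "ennreal (2 * a) * emeasure lebesgue B < (\<integral>\<^sup>+y. F y * indicator B y \<partial>lebesgue)"
    and B[measurable]: "B \<in> sets lebesgue"
  shows "emeasure lebesgue B \<le> (\<integral>\<^sup>+y. (F y / ennreal a * indicator {x. 1 < F x / ennreal a} y) * indicator B y \<partial>lebesgue)"
    (is "_ \<le> (\<integral>\<^sup>+y. ?h y * _ \<partial>lebesgue)")
proof (rule ccontr)
  assume "\<not> ?thesis"
  then have less: "(\<integral>\<^sup>+y. ?h y * indicator B y \<partial>lebesgue) \<le> emeasure lebesgue B" by simp
  have "F y \<le> ennreal a + ennreal a * ?h y" for y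
  proof (cases "1 < F y / ennreal a")
    case True
    then show ?thesis using a by (cases "F y") (auto simp: divide_ennreal ennreal_top_divide ennreal_mult_top simp flip: ennreal_mult ennreal_plus)
  next
    case False
    then have "\<not> ennreal 1 < F y / ennreal a" by simp
    then show ?thesis using a by (subst (asm) ennreal_less_divide) (auto simp: not_less add_increasing2)
  qed
  then have "(\<integral>\<^sup>+y. F y * indicator B y \<partial>lebesgue) \<le>
     (\<integral>\<^sup>+y. ennreal a * indicator B y + ennreal a * (?h y * indicator B y) \<partial>lebesgue)"
    by (intro nn_integral_mono) (auto simp: indicator_def)
  also have "\<dots> = ennreal a * emeasure lebesgue B + ennreal a * (\<integral>\<^sup>+y. ?h y * indicator B y \<partial>lebesgue)"
    by (subst nn_integral_add) (simp_all add: nn_integral_cmult B nn_integral_cmult_indicator)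
  also have "\<dots> \<le> ennreal a * emeasure lebesgue B + ennreal a * emeasure lebesgue B"
    by (intro add_left_mono mult_left_mono less) auto
  also have "\<dots> = ennreal (2 * a) * emeasure lebesgue B"
    using a by (simp flip: distrib_right ennreal_plus)
  finally show False using bad by simp
qed

text \<open>The weighted integral of \<open>h\<close> bounds \<open>a\<close> times the volume,
  because \<open>a \<le> a powr p y\<close> almost everywhere for \<open>a \<ge> 1\<close>; this is
  the hypothesis of \<open>local_comparison\<close>. The weight on the fivefold ball is then
  comparable to its value at every point of the ball, and averaging against \<open>h\<close>
  transfers the estimate to the weighted integral of \<open>h\<close>.\<close>

lemma single_ball:
  fixes h :: "real^'n \<Rightarrow> ennreal"
  assumes h[measurable]: "h \<in> borel_measurable lebesgue" and a: "1 \<le> a" and r: "0 < r"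
    and uh: "(\<integral>\<^sup>+y. ennreal (a powr p y) * h y \<partial>lebesgue) \<le> ennreal layer_const"
    and vol: "emeasure lebesgue (cball c r) \<le> (\<integral>\<^sup>+y. h y * indicator (cball c r) y \<partial>lebesgue)"
  shows "(\<integral>\<^sup>+x. ennreal (a powr p x) * indicator (cball c (5 * r)) x \<partial>lebesgue) \<le>
     ennreal (5 ^ CARD('n) * exp ((\<bar>ln (layer_const / unit_ball_vol (real CARD('n)))\<bar> + real CARD('n) * ln 6 + real CARD('n)) * C_log)) *
       (\<integral>\<^sup>+y. ennreal (a powr p y) * h y * indicator (cball c r) y \<partial>lebesgue)"
proof -
  let ?\<omega> = "unit_ball_vol (real CARD('n))"
  define E where "E = exp ((\<bar>ln (layer_const / ?\<omega>)\<bar> + real CARD('n) * ln 6 + real CARD('n)) * C_log)"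
  have \<omega>: "0 < ?\<omega>" by (rule unit_ball_vol_card_pos)
  define v where "v = ?\<omega> * r ^ CARD('n)"
  have v: "0 < v" using \<omega> r by (simp add: v_def)
  have ev: "emeasure lebesgue (cball c r) = ennreal v" "emeasure lebesgue (cball c (5 * r)) = ennreal (5 ^ CARD('n) * v)"
    using r by (simp_all add: emeasure_lborel_cball_vec v_def power_mult_distrib mult_ac)
  have cb[measurable]: "cball c s \<in> sets lebesgue" for s by simp
  have "ennreal a * ennreal v \<le> ennreal a * (\<integral>\<^sup>+y. h y * indicator (cball c r) y \<partial>lebesgue)"
    using vol by (intro mult_left_mono) (simp_all only: ev zero_le)
  also have "\<dots> \<le> ennreal a * (\<integral>\<^sup>+y. h y \<partial>lebesgue)"
    by (intro mult_left_mono nn_integral_mono) (auto simp: indicator_def)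
  also have "\<dots> = (\<integral>\<^sup>+y. ennreal a * h y \<partial>lebesgue)" by (rule nn_integral_cmult[symmetric]) measurable
  also have "\<dots> \<le> (\<integral>\<^sup>+y. ennreal (a powr p y) * h y \<partial>lebesgue)"
  proof (rule nn_integral_mono_AE)
    show "AE y in lebesgue. ennreal a * h y \<le> ennreal (a powr p y) * h y"
      using p_ge
    proof eventually_elim
      case (elim y)
      have "a powr 1 \<le> a powr p y" using elim pm a by (intro powr_mono) auto
      then show ?case using a by (intro mult_right_mono ennreal_leI) auto
    qed
  qed
  also note uh
  finally have "a * v \<le> layer_const" using a v layer_const_pos by (simp flip: ennreal_mult)
  then have vol': "a * r ^ CARD('n) \<le> layer_const / ?\<omega>" using \<omega> by (simp add: v_def pos_le_divide_eq mult_ac)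
  define I where "I = (\<integral>\<^sup>+x. ennreal (a powr p x) * indicator (cball c (5 * r)) x \<partial>lebesgue)"
  have I: "I \<le> ennreal (5 ^ CARD('n) * E * v) * ennreal (a powr p y)" if y: "y \<in> cball c r" for y
  proof -
    have "I \<le> (\<integral>\<^sup>+x. ennreal (E * a powr p y) * indicator (cball c (5 * r)) x \<partial>lebesgue)"
      unfolding I_def
    proof (rule nn_integral_mono)
      fix x
      have "norm (x - y) \<le> 6 * r" if "x \<in> cball c (5 * r)"
        using that y dist_triangle2[of x y c] by (simp add: dist_norm norm_minus_commute)
      from local_comparison[OF a r vol' _ this] layer_const_pos \<omega>
      show "ennreal (a powr p x) * indicator (cball c (5 * r)) x \<le> ennreal (E * a powr p y) * indicator (cball c (5 * r)) x"
        by (cases "x \<in> cball c (5 * r)") (auto simp: E_def intro!: ennreal_leI)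
    qed
    also have "\<dots> = ennreal (E * a powr p y) * ennreal (5 ^ CARD('n) * v)"
      by (subst nn_integral_cmult_indicator) (simp_all only: ev cb)
    also have "\<dots> = ennreal (5 ^ CARD('n) * E * v) * ennreal (a powr p y)"
      using v by (simp add: E_def mult_ac flip: ennreal_mult)
    finally show ?thesis .
  qed
  \<comment> \<open>\<open>I\<close> is a constant, so it may be moved under the integral of
    \<open>h\<close> and estimated there by the weight at the integration variable. The factor
    \<open>v\<close> that this produces cancels at the end.\<close>
  have "ennreal v * I \<le> (\<integral>\<^sup>+y. h y * indicator (cball c r) y \<partial>lebesgue) * I"
    using vol by (intro mult_right_mono) (simp_all only: ev zero_le)
  also have "\<dots> = (\<integral>\<^sup>+y. h y * indicator (cball c r) y * I \<partial>lebesgue)"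
    by (rule nn_integral_multc[symmetric]) measurable
  also have "\<dots> \<le> (\<integral>\<^sup>+y. ennreal (5 ^ CARD('n) * E * v) * (ennreal (a powr p y) * h y * indicator (cball c r) y) \<partial>lebesgue)"
  proof (rule nn_integral_mono)
    fix y
    show "h y * indicator (cball c r) y * I \<le> ennreal (5 ^ CARD('n) * E * v) * (ennreal (a powr p y) * h y * indicator (cball c r) y)"
      using mult_left_mono[OF I[of y], of "h y"] by (auto simp: indicator_def mult_ac)
  qed
  also have "\<dots> = ennreal (5 ^ CARD('n) * E * v) * (\<integral>\<^sup>+y. ennreal (a powr p y) * h y * indicator (cball c r) y \<partial>lebesgue)"
    by (rule nn_integral_cmult) measurable
  also have "\<dots> = ennreal v * (ennreal (5 ^ CARD('n) * E) * (\<integral>\<^sup>+y. ennreal (a powr p y) * h y * indicator (cball c r) y \<partial>lebesgue))"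
    using v by (simp add: E_def ennreal_mult' mult_ac)
  finally show ?thesis
    unfolding I_def E_def using v by (subst (asm) ennreal_mult_le_mult_iff) auto
qed

text \<open>The witness \<open>U\<close> is the union of the fivefold selected balls. A measurable
  superset suffices, since the norm of an indicator is monotone in its set.\<close>

lemma bad_set_measure:
  obtains C2 where "1 \<le> C2"
    "\<And>F a. weak_bounded F \<Longrightarrow> 0 < a \<Longrightarrow> \<exists>U\<in>sets lebesgue. bad_set F a \<subseteq> U \<and>
       (\<integral>\<^sup>+x. ennreal (a powr p x) * indicator U x \<partial>lebesgue) \<le> ennreal C2"
proof -
  let ?n = "CARD('n)"
  define K where "K = 5 ^ ?n * exp ((\<bar>ln (layer_const / unit_ball_vol (real ?n))\<bar> + real ?n * ln 6 + real ?n) * C_log)"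
  \<comment> \<open>If \<open>a < (exp 1 + norm x) powr (- m)\<close>, both \<open>a\<close> and
    \<open>a powr (p_inf - 1)\<close> have to lie below the polynomial weight. The two entries of
    the maximum ensure \<open>m \<ge> n + 1\<close> and
    \<open>m * (p_inf - 1) \<ge> n + 1\<close>.\<close>
  define m where "m = max (real (Suc ?n)) (real (Suc ?n) / (p_inf - 1))"
  define E where "E = exp (m * C_inf)"
  define V where "V = enn2real (\<integral>\<^sup>+x. ennreal (polynomial_weight x) \<partial>lebesgue)"
  have V: "(\<integral>\<^sup>+x. ennreal (polynomial_weight x) \<partial>lebesgue) = ennreal V" "0 \<le> V"
    unfolding V_def using nn_integral_kernel_finite[where 'n='n] by (simp_all del: power_Suc)
  \<comment> \<open>The summands are the bounds for \<open>a \<ge> 1\<close> and for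
    \<open>a < 1\<close>, and 1 to make \<open>C2 \<ge> 1\<close>, as
    \<open>Lp_norm_indicator_le\<close> demands.\<close>
  define C2 where "C2 = 1 + K * layer_const + (E * 5 ^ ?n * (E * layer_const + V + layer_const) + V)"
  have K0: "0 \<le> K" "0 \<le> E" by (simp_all add: K_def E_def)
  have C2: "1 \<le> C2" "K * layer_const \<le> C2" "E * 5 ^ ?n * (E * layer_const + V + layer_const) + V \<le> C2"
    using K0 V layer_const_pos by (simp_all add: C2_def)
  have pi1: "0 < p_inf - 1" using p_inf_ge pm by simp
  have m: "real (Suc ?n) \<le> m" "real (Suc ?n) \<le> m * (p_inf - 1)" "0 \<le> m"
  proof -
    show "real (Suc ?n) \<le> m" by (simp add: m_def)
    then show "0 \<le> m" by linarith
    have "real (Suc ?n) / (p_inf - 1) \<le> m" by (simp add: m_def)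
    then show "real (Suc ?n) \<le> m * (p_inf - 1)" using pi1 by (simp only: pos_divide_le_eq)
  qed
  have weight: "(exp 1 + norm x) powr (- s) \<le> polynomial_weight x" if "real (Suc ?n) \<le> s" for x :: "real^'n" and s
  proof -
    have e: "1 \<le> exp (1::real)" by simp
    have "(exp 1 + norm x) powr (- s) \<le> (exp 1 + norm x) powr (- real (Suc ?n))"
      using that e norm_ge_zero[of x] by (intro powr_mono) linarith+
    also have "\<dots> \<le> (1 + norm x) powr (- real (Suc ?n))"
      using e norm_ge_zero[of x] by (intro powr_mono2') linarith+
    also have "\<dots> = polynomial_weight x"
      using norm_ge_zero[of x] by (simp add: powr_minus powr_realpow inverse_eq_divide add_pos_nonneg del: power_Suc of_nat_Suc)
    finally show ?thesis .
  qed
  have main: "\<exists>U\<in>sets lebesgue. bad_set F a \<subseteq> U \<and>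
       (\<integral>\<^sup>+x. ennreal (a powr p x) * indicator U x \<partial>lebesgue) \<le> ennreal C2"
    if F: "weak_bounded F" and a: "0 < a" for F a
  proof -
    have Fm[measurable]: "F \<in> borel_measurable lebesgue" using F by (simp add: weak_bounded_def)
    define h where "h = (\<lambda>y. F y / ennreal a * indicator {x. 1 < F x / ennreal a} y)"
    have h[measurable]: "h \<in> borel_measurable lebesgue" unfolding h_def by measurable
    define u where "u = (\<lambda>x. ennreal (a powr p x))"
    have u[measurable]: "u \<in> borel_measurable lebesgue" unfolding u_def by measurable
    have cb[measurable]: "cball c s \<in> sets lebesgue" for c :: "real^'n" and s by simp
    have uh: "(\<integral>\<^sup>+y. u y * h y \<partial>lebesgue) \<le> ennreal layer_const"
      unfolding u_def h_def by (rule weak_bounded_layer[OF F a])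
    \<comment> \<open>Only finiteness matters here, to start the Vitali selection; the constant
      \<open>c\<close> depends on \<open>a\<close> and enters no later estimate.\<close>
    have hfin: "(\<integral>\<^sup>+y. h y \<partial>lebesgue) < \<infinity>"
    proof -
      define c where "c = min 1 (a powr pp)"
      have c: "0 < c" using a by (simp add: c_def)
      have "ennreal c * (\<integral>\<^sup>+y. h y \<partial>lebesgue) = (\<integral>\<^sup>+y. ennreal c * h y \<partial>lebesgue)"
        by (rule nn_integral_cmult[symmetric]) measurable
      also have "\<dots> \<le> (\<integral>\<^sup>+y. u y * h y \<partial>lebesgue)"
      proof (rule nn_integral_mono)
        fix y
        have "c \<le> a powr p y"
        proof (cases "1 \<le> a")
          case True
          then have "a powr 0 \<le> a powr p y" using p_pos[of y] by (intro powr_mono) auto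
          then show ?thesis using a by (simp add: c_def)
        next
          case False
          then have "a powr pp \<le> a powr p y" using a p_le by (intro powr_mono') auto
          then show ?thesis by (simp add: c_def)
        qed
        then show "ennreal c * h y \<le> u y * h y" unfolding u_def by (intro mult_right_mono ennreal_leI) auto
      qed
      also note uh
      finally have "ennreal c * (\<integral>\<^sup>+y. h y \<partial>lebesgue) < \<infinity>" by (rule le_less_trans) simp
      then show ?thesis using c by (auto simp: ennreal_mult_less_top)
    qed
    have "\<exists>r>0. emeasure lebesgue (cball x r) \<le> (\<integral>\<^sup>+y. h y * indicator (cball x r) y \<partial>lebesgue)" if x: "x \<in> bad_set F a" for x
    proof -
      from x obtain r where r: "0 < r" "ennreal (2 * a) * emeasure lebesgue (cball x r) < (\<integral>\<^sup>+y. F y * indicator (cball x r) y \<partial>lebesgue)"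
        unfolding bad_set_def by blast
      from bad_ball[OF Fm a r(2) cb] r(1) show ?thesis unfolding h_def by blast
    qed
    then obtain C r where C: "countable C" "\<And>x. x \<in> C \<Longrightarrow> 0 < r x"
      "\<And>x. x \<in> C \<Longrightarrow> emeasure lebesgue (cball x (r x)) \<le> (\<integral>\<^sup>+y. h y * indicator (cball x (r x)) y \<partial>lebesgue)"
      "disjoint_family_on (\<lambda>x. cball x (r x)) C" "bad_set F a \<subseteq> (\<Union>x\<in>C. cball x (5 * r x))"
      using vitali_selection[OF hfin, of "bad_set F a"] by blast
    \<comment> \<open>As a measure, the weighted integral over a union of balls can be handled by
      subadditivity and continuity from below.\<close>
    define Mu where "Mu = density lebesgue u"
    have Mu: "emeasure Mu A = (\<integral>\<^sup>+x. u x * indicator A x \<partial>lebesgue)" if "A \<in> sets lebesgue" for A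
      unfolding Mu_def by (rule emeasure_density[OF u that])
    have sMu: "sets Mu = sets lebesgue" by (simp add: Mu_def)
    have disj: "disjoint_family_on (\<lambda>x. cball x (r x)) D" if "D \<subseteq> C" for D
      using C(4) that by (auto simp: disjoint_family_on_def)
    have sum_le: "(\<Sum>x\<in>D. \<integral>\<^sup>+y. w y * indicator (cball x (r x)) y \<partial>lebesgue) \<le> (\<integral>\<^sup>+y. w y \<partial>lebesgue)"
      if D: "finite D" "D \<subseteq> C" and [measurable]: "w \<in> borel_measurable lebesgue" for D w
    proof -
      have "(\<Sum>x\<in>D. \<integral>\<^sup>+y. w y * indicator (cball x (r x)) y \<partial>lebesgue) = (\<integral>\<^sup>+y. (\<Sum>x\<in>D. w y * indicator (cball x (r x)) y) \<partial>lebesgue)"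
        by (rule nn_integral_sum[symmetric]) measurable
      also have "\<dots> \<le> (\<integral>\<^sup>+y. w y \<partial>lebesgue)"
      proof (rule nn_integral_mono)
        fix y
        have "(\<Sum>x\<in>D. w y * indicator (cball x (r x)) y) = w y * indicator (\<Union>x\<in>D. cball x (r x)) y"
        proof -
          have "(indicator (\<Union>x\<in>D. cball x (r x)) y :: ennreal) = (\<Sum>x\<in>D. indicator (cball x (r x)) y)"
            by (rule indicator_UN_disjoint[OF D(1) disj[OF D(2)]])
          then show ?thesis by (simp add: sum_distrib_left)
        qed
        then show "(\<Sum>x\<in>D. w y * indicator (cball x (r x)) y) \<le> w y" by (auto simp: indicator_def)
      qed
      finally show ?thesis .
    qed
    have fin: "emeasure Mu (\<Union>x\<in>D. cball x (5 * r x)) \<le> ennreal C2" if D: "finite D" "D \<subseteq> C" for D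
    proof (cases "1 \<le> a")
      case True
      have "emeasure Mu (\<Union>x\<in>D. cball x (5 * r x)) \<le> (\<Sum>x\<in>D. emeasure Mu (cball x (5 * r x)))"
        by (rule emeasure_subadditive_finite) (use D in \<open>auto simp: sMu\<close>)
      also have "\<dots> \<le> (\<Sum>x\<in>D. ennreal K * (\<integral>\<^sup>+y. u y * h y * indicator (cball x (r x)) y \<partial>lebesgue))"
      proof (rule sum_mono)
        fix x assume "x \<in> D"
        with D C have x: "0 < r x" "emeasure lebesgue (cball x (r x)) \<le> (\<integral>\<^sup>+y. h y * indicator (cball x (r x)) y \<partial>lebesgue)" by auto
        show "emeasure Mu (cball x (5 * r x)) \<le> ennreal K * (\<integral>\<^sup>+y. u y * h y * indicator (cball x (r x)) y \<partial>lebesgue)"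
          unfolding Mu[OF cb] K_def u_def
          by (rule single_ball[OF h True x(1) uh[unfolded u_def] x(2)])
      qed
      also have "\<dots> = ennreal K * (\<Sum>x\<in>D. (\<integral>\<^sup>+y. u y * h y * indicator (cball x (r x)) y \<partial>lebesgue))"
        by (rule sum_distrib_left[symmetric])
      also have "\<dots> \<le> ennreal K * (\<integral>\<^sup>+y. u y * h y \<partial>lebesgue)"
        by (intro mult_left_mono sum_le D) measurable
      also have "\<dots> \<le> ennreal K * ennreal layer_const" by (intro mult_left_mono uh) auto
      also have "\<dots> \<le> ennreal C2" using C2(2) K0 layer_const_pos by (simp add: ennreal_leI flip: ennreal_mult)
      finally show ?thesis .
    next
      case False
      then have a1: "a < 1" by simp
      let ?A = "\<Union>x\<in>D. cball x (5 * r x)"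
      have A[measurable]: "?A \<in> sets lebesgue" by (intro sets.finite_UN D) auto
      have "emeasure lebesgue ?A \<le> (\<Sum>x\<in>D. emeasure lebesgue (cball x (5 * r x)))"
        by (rule emeasure_subadditive_finite) (use D in auto)
      also have "\<dots> \<le> (\<Sum>x\<in>D. ennreal (5 ^ ?n) * (\<integral>\<^sup>+y. h y * indicator (cball x (r x)) y \<partial>lebesgue))"
      proof (rule sum_mono)
        fix x assume "x \<in> D"
        with D C have x: "0 < r x" "emeasure lebesgue (cball x (r x)) \<le> (\<integral>\<^sup>+y. h y * indicator (cball x (r x)) y \<partial>lebesgue)" by auto
        have "emeasure lebesgue (cball x (5 * r x)) = ennreal (5 ^ ?n) * emeasure lebesgue (cball x (r x))"
          using x(1) by (simp add: emeasure_lborel_cball_vec power_mult_distrib mult_ac flip: ennreal_mult)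
        also have "\<dots> \<le> ennreal (5 ^ ?n) * (\<integral>\<^sup>+y. h y * indicator (cball x (r x)) y \<partial>lebesgue)"
          by (intro mult_left_mono x(2)) simp
        finally show "emeasure lebesgue (cball x (5 * r x)) \<le> \<dots>" .
      qed
      also have "\<dots> = ennreal (5 ^ ?n) * (\<Sum>x\<in>D. (\<integral>\<^sup>+y. h y * indicator (cball x (r x)) y \<partial>lebesgue))"
        by (rule sum_distrib_left[symmetric])
      also have "\<dots> \<le> ennreal (5 ^ ?n) * (\<integral>\<^sup>+y. h y \<partial>lebesgue)"
        by (intro mult_left_mono sum_le D) measurable
      finally have volA: "emeasure lebesgue ?A \<le> ennreal (5 ^ ?n) * (\<integral>\<^sup>+y. h y \<partial>lebesgue)" .
      have "ennreal (a powr p_inf) * (\<integral>\<^sup>+y. h y \<partial>lebesgue) = (\<integral>\<^sup>+y. ennreal (a powr p_inf) * h y \<partial>lebesgue)"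
        by (rule nn_integral_cmult[symmetric]) measurable
      also have "\<dots> \<le> (\<integral>\<^sup>+y. (ennreal E * (u y * h y) + ennreal (polynomial_weight y)) + F y * indicator {x. 1 < F x} y \<partial>lebesgue)"
      proof (rule nn_integral_mono)
        fix y
        \<comment> \<open>In the third case \<open>a\<close> is too small for
          \<open>decay_comparison\<close>. There \<open>a powr p_inf * h y\<close> equals
          \<open>a powr (p_inf - 1) * F y\<close>, whose coefficient is at most 1 where
          \<open>F y > 1\<close> and below the polynomial weight elsewhere.\<close>
        consider "(exp 1 + norm y) powr (- m) \<le> a" | "h y = 0"
          | "a < (exp 1 + norm y) powr (- m)" "h y \<noteq> 0" by linarith
        then show "ennreal (a powr p_inf) * h y \<le> (ennreal E * (u y * h y) + ennreal (polynomial_weight y)) + F y * indicator {x. 1 < F x} y"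
        proof cases
          case 1
          have "ennreal (a powr p_inf) \<le> ennreal E * u y"
            unfolding u_def E_def using decay_comparison(2)[OF a a1 m(3) 1] by (simp add: ennreal_leI flip: ennreal_mult)
          then have "ennreal (a powr p_inf) * h y \<le> ennreal E * u y * h y" by (rule mult_right_mono) simp
          then show ?thesis by (simp add: add_increasing2 mult.assoc)
        next
          case 3
          have hy: "h y = F y / ennreal a" using 3(2) by (auto simp: h_def indicator_def split: if_splits)
          have eq: "ennreal (a powr p_inf) * h y = ennreal (a powr (p_inf - 1)) * F y"
            using a unfolding hy
            by (cases "F y") (auto simp: divide_ennreal ennreal_top_divide ennreal_mult_top powr_diff simp flip: ennreal_mult)
          show ?thesis
          proof (cases "1 < F y")
            case True
            have "a powr (p_inf - 1) \<le> a powr 0" using a a1 pi1 by (intro powr_mono') auto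
            then have "ennreal (a powr (p_inf - 1)) * F y \<le> 1 * F y" using a by (intro mult_right_mono) (auto simp: ennreal_le_1)
            then show ?thesis using True unfolding eq by (simp add: add_increasing)
          next
            case False
            have "a powr (p_inf - 1) \<le> ((exp 1 + norm y) powr (- m)) powr (p_inf - 1)"
              using a 3(1) pi1 by (intro powr_mono2) auto
            also have "\<dots> = (exp 1 + norm y) powr (- (m * (p_inf - 1)))" by (simp add: powr_powr)
            also have "\<dots> \<le> polynomial_weight y" by (rule weight[OF m(2)])
            finally have "ennreal (a powr (p_inf - 1)) * F y \<le> ennreal (polynomial_weight y) * 1"
              using False by (intro mult_mono ennreal_leI) auto
            then show ?thesis unfolding eq by (simp add: add_increasing add_increasing2 del: power_Suc)
          qed
        qed simp
      qed
      also have "\<dots> = ennreal E * (\<integral>\<^sup>+y. u y * h y \<partial>lebesgue) + ennreal V + (\<integral>\<^sup>+y. F y * indicator {x. 1 < F x} y \<partial>lebesgue)"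
        unfolding V(1)[symmetric] by (subst nn_integral_add, measurable, subst nn_integral_add, measurable, subst nn_integral_cmult, measurable)
      also have "\<dots> \<le> ennreal E * ennreal layer_const + ennreal V + ennreal layer_const"
        by (intro add_mono mult_left_mono uh weak_bounded_large_part F order_refl) auto
      also have "\<dots> = ennreal (E * layer_const + V + layer_const)" using K0 layer_const_pos V(2) by (simp flip: ennreal_mult ennreal_plus)
      finally have ah: "ennreal (a powr p_inf) * (\<integral>\<^sup>+y. h y \<partial>lebesgue) \<le> ennreal (E * layer_const + V + layer_const)" .
      \<comment> \<open>Return from volume to weight. Where \<open>decay_comparison\<close> fails,
        \<open>p x \<ge> 1\<close> gives \<open>a powr p x \<le> a\<close>, and \<open>a\<close> is
        below the polynomial weight.\<close>
      have "emeasure Mu ?A \<le> (\<integral>\<^sup>+x. ennreal (E * a powr p_inf) * indicator ?A x + ennreal (polynomial_weight x) \<partial>lebesgue)"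
        unfolding Mu[OF A]
      proof (rule nn_integral_mono_AE)
        show "AE x in lebesgue. u x * indicator ?A x \<le> ennreal (E * a powr p_inf) * indicator ?A x + ennreal (polynomial_weight x)"
          using p_ge_1
        proof eventually_elim
          case (elim x)
          have "u x \<le> ennreal (E * a powr p_inf) + ennreal (polynomial_weight x)"
          proof (cases "(exp 1 + norm x) powr (- m) \<le> a")
            case True
            have "u x \<le> ennreal (E * a powr p_inf)"
              unfolding u_def E_def using decay_comparison(1)[OF a a1 m(3) True] by (rule ennreal_leI)
            then show ?thesis by (simp add: add_increasing2)
          next
            case False
            have "a powr p x \<le> a powr 1" using a a1 elim by (intro powr_mono') auto
            also have "\<dots> = a" using a by simp
            also have "a \<le> (exp 1 + norm x) powr (- m)" using False by simp
            also have "\<dots> \<le> polynomial_weight x" by (rule weight[OF m(1)])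
            finally show ?thesis unfolding u_def by (intro add_increasing ennreal_leI) simp_all
          qed
          then show ?case by (auto simp: indicator_def)
        qed
      qed
      also have "\<dots> = ennreal (E * a powr p_inf) * emeasure lebesgue ?A + ennreal V"
        unfolding V(1)[symmetric] by (subst nn_integral_add) (simp_all add: nn_integral_cmult_indicator A del: power_Suc)
      also have "\<dots> \<le> ennreal (E * a powr p_inf) * (ennreal (5 ^ ?n) * (\<integral>\<^sup>+y. h y \<partial>lebesgue)) + ennreal V"
        by (intro add_mono mult_left_mono volA) auto
      also have "\<dots> = ennreal (E * 5 ^ ?n) * (ennreal (a powr p_inf) * (\<integral>\<^sup>+y. h y \<partial>lebesgue)) + ennreal V"
        using K0 by (simp add: ennreal_mult mult_ac)
      also have "\<dots> \<le> ennreal (E * 5 ^ ?n) * ennreal (E * layer_const + V + layer_const) + ennreal V"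
        by (intro add_mono mult_left_mono ah) auto
      also have "\<dots> = ennreal (E * 5 ^ ?n * (E * layer_const + V + layer_const) + V)"
        using K0 layer_const_pos V(2) by (simp flip: ennreal_mult ennreal_plus)
      also have "\<dots> \<le> ennreal C2" by (intro ennreal_leI C2)
      finally show ?thesis .
    qed
    let ?U = "\<Union>x\<in>C. cball x (5 * r x)"
    have U: "?U \<in> sets lebesgue" using C(1) by (intro sets.countable_UN'') auto
    have "emeasure Mu ?U \<le> ennreal C2"
      by (rule emeasure_countable_UN_le[OF C(1) _ fin]) (auto simp: sMu)
    with U C(5) Mu[OF U] show ?thesis unfolding u_def by auto
  qed
  from that[OF C2(1) main] show ?thesis .
qed

end

section \<open>From functions to distributions\<close>

lemma schwartz_pointwise:
  fixes \<psi> :: "real^'n \<Rightarrow> complex"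
  assumes "\<psi> \<in> schwartz"
  shows "norm (\<psi> x) \<le> schwartz_norm N \<psi> * (1 / (1 + norm x) ^ N)"
proof -
  have "deriv_list (\<lambda>_. 0) = ([] :: 'n list)" by (simp add: deriv_list_def)
  then have "(1 + norm x) ^ N * norm (\<psi> x) \<le> schwartz_norm N \<psi>"
    using schwartz_norm_ge[OF assms, of "\<lambda>_. 0" N x] by (simp add: multi_deriv_eq_pd)
  moreover have "0 < (1 + norm x) ^ N" by (simp add: add_pos_nonneg)
  ultimately show ?thesis by (simp add: pos_le_divide_eq mult.commute)
qed

lemma smooth_measurable: "smooth f \<Longrightarrow> f \<in> borel_measurable lebesgue"
  by (intro measurable_completion) (simp add: borel_measurable_continuous_onI smooth_continuous)

lemma schwartz_measurable: "f \<in> schwartz \<Longrightarrow> f \<in> borel_measurable lebesgue"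
  by (intro smooth_measurable schwartz_imp_smooth)

context log_hoelder_exponent
begin

lemma WLp_bound_exists:
  assumes "f \<in> WLp p"
  obtains l where "0 < l" "WLp_norm p f < ennreal l"
proof -
  have "WLp_norm p f < \<infinity>" using assms by (simp add: WLp_def)
  then obtain r where "WLp_norm p f = ennreal r" "0 \<le> r" by (cases "WLp_norm p f") auto
  then show ?thesis using that[of "r + 1"] by (simp add: ennreal_less_iff)
qed

lemma WLp_weak_bounded:
  assumes "f \<in> borel_measurable lebesgue" "0 < l" "WLp_norm p f < ennreal l"
  shows "weak_bounded (\<lambda>x. ennreal (norm (f x) / l))"
proof -
  have "weak_bounded (\<lambda>x. ennreal (norm (f x)) / ennreal l)"
    by (rule weak_boundedI) (use assms in \<open>auto simp: WLp_norm_def\<close>)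
  then show ?thesis using assms(2) by (simp add: divide_ennreal)
qed

lemma WLp_weighted_integrable:
  assumes f: "f \<in> WLp p"
  shows "integrable lebesgue (\<lambda>x. norm (f x) * polynomial_weight x)"
proof -
  obtain l where l: "0 < l" "WLp_norm p f < ennreal l" using WLp_bound_exists[OF f] .
  have fm: "f \<in> borel_measurable lebesgue" using f by (simp add: WLp_def)
  note fm[measurable]
  have "(\<integral>\<^sup>+x. ennreal (norm (f x) * polynomial_weight x) \<partial>lebesgue) =
     (\<integral>\<^sup>+x. ennreal l * (ennreal (norm (f x) / l) * ennreal (polynomial_weight x)) \<partial>lebesgue)"
    using l by (intro nn_integral_cong) (simp flip: ennreal_mult)
  also have "\<dots> = ennreal l * (\<integral>\<^sup>+x. ennreal (norm (f x) / l) * ennreal (polynomial_weight x) \<partial>lebesgue)"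
    by (rule nn_integral_cmult) measurable
  also have "\<dots> < \<infinity>"
    using weak_bounded_polynomial_weight[OF WLp_weak_bounded[OF fm l]] by (simp add: ennreal_mult_less_top)
  finally show ?thesis
  proof (intro integrableI_nonneg)
    show "(\<lambda>x. norm (f x) * polynomial_weight x) \<in> borel_measurable lebesgue" by measurable
  qed (use less_imp_le[OF polynomial_weight_pos] in \<open>simp_all del: power_Suc\<close>)
qed

lemma WLp_schwartz_integrable:
  assumes f: "f \<in> WLp p" and \<phi>: "\<phi> \<in> schwartz"
  shows "integrable lebesgue (\<lambda>x. f x * \<phi> x)"
    "norm (\<integral>x. f x * \<phi> x \<partial>lebesgue) \<le> (\<integral>x. norm (f x) * polynomial_weight x \<partial>lebesgue) * schwartz_norm (Suc CARD('n)) \<phi>"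
proof -
  let ?S = "schwartz_norm (Suc CARD('n)) \<phi>"
  note w = WLp_weighted_integrable[OF f]
  have le: "norm (f x * \<phi> x) \<le> norm (f x) * polynomial_weight x * ?S" for x
    using mult_left_mono[OF schwartz_pointwise[OF \<phi>, of x "Suc CARD('n)"], of "norm (f x)"]
    by (simp add: norm_mult mult_ac del: power_Suc)
  have S: "0 \<le> ?S" by (rule schwartz_norm_nonneg[OF \<phi>])
  have w0: "0 \<le> polynomial_weight x" for x by (rule less_imp_le[OF polynomial_weight_pos])
  show i: "integrable lebesgue (\<lambda>x. f x * \<phi> x)"
    by (rule Bochner_Integration.integrable_bound[OF integrable_mult_left[OF w, of ?S]])
      (use f schwartz_measurable[OF \<phi>] le S w0 in \<open>auto simp: WLp_def abs_mult simp del: power_Suc intro: order_trans[OF le]\<close>)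
  have "norm (\<integral>x. f x * \<phi> x \<partial>lebesgue) \<le> (\<integral>x. norm (f x * \<phi> x) \<partial>lebesgue)" by (rule integral_norm_bound)
  also have "\<dots> \<le> (\<integral>x. norm (f x) * polynomial_weight x * ?S \<partial>lebesgue)"
    by (intro integral_mono integrable_norm i integrable_mult_left w le)
  also have "\<dots> = (\<integral>x. norm (f x) * polynomial_weight x \<partial>lebesgue) * ?S" by (rule integral_mult_left_zero)
  finally show "norm (\<integral>x. f x * \<phi> x \<partial>lebesgue) \<le> \<dots>" .
qed

lemma WLp_locally_integrable:
  assumes f: "f \<in> WLp p" and K: "compact K"
  shows "f absolutely_integrable_on K"
proof -
  obtain R where R: "0 < R" "\<And>x. x \<in> K \<Longrightarrow> norm x \<le> R" using compact_imp_bounded[OF K] unfolding bounded_pos by blast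
  have "K \<in> sets lebesgue" using K by (simp add: borel_compact)
  then have m: "(\<lambda>x. indicator K x *\<^sub>R f x) \<in> borel_measurable lebesgue"
    using f unfolding WLp_def by (intro borel_measurable_scaleR borel_measurable_indicator) auto
  have "norm (indicator K x *\<^sub>R f x) \<le> norm ((1 + R) ^ Suc CARD('n) * (norm (f x) * polynomial_weight x))" for x
  proof (cases "x \<in> K")
    case True
    then have "(1 + norm x) ^ Suc CARD('n) \<le> (1 + R) ^ Suc CARD('n)" using R by (intro power_mono) auto
    moreover have "0 < (1 + norm x) ^ Suc CARD('n)" by (intro zero_less_power) (simp add: add_pos_nonneg)
    ultimately have "1 \<le> (1 + R) ^ Suc CARD('n) * polynomial_weight x" by (simp add: pos_le_divide_eq del: power_Suc)
    from mult_left_mono[OF this, of "norm (f x)"] show ?thesis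
      using True R by (simp add: abs_mult mult_ac add_nonneg_nonneg del: power_Suc)
  qed simp
  then show ?thesis
    unfolding set_integrable_def
    by (intro Bochner_Integration.integrable_bound[OF integrable_mult_right[OF WLp_weighted_integrable[OF f]] m]) auto
qed

lemma WLp_induces:
  assumes f: "f \<in> WLp p"
  shows "induces f (restrict (\<lambda>\<phi>. \<integral>x. f x * \<phi> x \<partial>lebesgue) schwartz)"
proof -
  let ?T = "restrict (\<lambda>\<phi>. \<integral>x. f x * \<phi> x \<partial>lebesgue) schwartz"
  note int = WLp_schwartz_integrable[OF f]
  have "?T \<in> tempered"
  proof (rule temperedI)
    fix \<phi> \<psi> :: "real^'n \<Rightarrow> complex" assume *: "\<phi> \<in> schwartz" "\<psi> \<in> schwartz"
    have "(\<integral>x. f x * (\<phi> x + \<psi> x) \<partial>lebesgue) = (\<integral>x. f x * \<phi> x \<partial>lebesgue) + (\<integral>x. f x * \<psi> x \<partial>lebesgue)"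
      unfolding distrib_left by (intro Bochner_Integration.integral_add int *)
    then show "?T (\<lambda>x. \<phi> x + \<psi> x) = ?T \<phi> + ?T \<psi>" using * by (simp add: schwartz_add)
  next
    fix c and \<phi> :: "real^'n \<Rightarrow> complex" assume *: "\<phi> \<in> schwartz"
    have "(\<integral>x. f x * (c * \<phi> x) \<partial>lebesgue) = c * (\<integral>x. f x * \<phi> x \<partial>lebesgue)"
      by (simp add: mult.left_commute)
    then show "?T (\<lambda>x. c * \<phi> x) = c * ?T \<phi>" using * by (simp add: schwartz_cmult)
  next
    fix \<phi> :: "real^'n \<Rightarrow> complex" assume *: "\<phi> \<in> schwartz"
    with int(2)[OF *] show "norm (?T \<phi>) \<le> (\<integral>x. norm (f x) * polynomial_weight x \<partial>lebesgue) * schwartz_norm (Suc CARD('n)) \<phi>" by simp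
  qed simp
  then show ?thesis
    unfolding induces_def using f WLp_locally_integrable[OF f] int by (simp add: WLp_def)
qed

text \<open>All members of \<open>F_class N\<close> are dominated by the kernel
  \<open>1 / (1 + norm z) ^ N\<close>, so a bound for all averages around \<open>x\<close> passes to
  all convolutions at \<open>x\<close> by \<open>kernel_average\<close>. The factor
  \<open>t ^ CARD('n)\<close> gained there cancels the one in \<open>dilate\<close>.\<close>

lemma grand_maximal_le_outside_bad_set:
  assumes ind: "induces f T" and l: "0 < l" and a: "0 < a" and N: "CARD('n) < N"
    and x: "x \<notin> bad_set (\<lambda>x. ennreal (norm (f x) / l)) a"
  shows "grand_maximal N T x \<le> ennreal (2 * a * unit_ball_vol (real CARD('n)) * kernel_const N CARD('n) * l)"
  unfolding grand_maximal_def
proof (intro SUP_least)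
  fix t :: real and \<psi> :: "real^'n \<Rightarrow> complex" assume "t \<in> {0<..}" and \<psi>: "\<psi> \<in> F_class N"
  then have t: "0 < t" by simp
  let ?\<omega> = "unit_ball_vol (real CARD('n))"
  have \<psi>s: "\<psi> \<in> schwartz" "schwartz_norm N \<psi> \<le> 1" using \<psi> by (auto simp: F_class_def)
  have [measurable]: "f \<in> borel_measurable lebesgue" using ind by (simp add: induces_def)
  have S: "(\<lambda>y. dilate t \<psi> (x - y)) \<in> schwartz" by (rule dilate_reflect_schwartz[OF \<psi>s(1) t])
  have ker: "norm (dilate t \<psi> (x - y)) \<le> 1 / t ^ CARD('n) * (1 / (1 + norm ((x - y) /\<^sub>R t)) ^ N)" for y
  proof -
    have "norm (\<psi> ((x - y) /\<^sub>R t)) \<le> schwartz_norm N \<psi> * (1 / (1 + norm ((x - y) /\<^sub>R t)) ^ N)"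
      by (rule schwartz_pointwise[OF \<psi>s(1)])
    also have "\<dots> \<le> 1 * (1 / (1 + norm ((x - y) /\<^sub>R t)) ^ N)" by (intro mult_right_mono \<psi>s) simp
    finally have q: "norm (\<psi> ((x - y) /\<^sub>R t)) \<le> 1 * (1 / (1 + norm ((x - y) /\<^sub>R t)) ^ N)" .
    have "norm (dilate t \<psi> (x - y)) = 1 / t ^ CARD('n) * norm (\<psi> ((x - y) /\<^sub>R t))"
      using t by (simp add: dilate_def)
    also have "\<dots> \<le> 1 / t ^ CARD('n) * (1 * (1 / (1 + norm ((x - y) /\<^sub>R t)) ^ N))"
      using t by (intro mult_left_mono q) simp
    finally show ?thesis by (simp only: mult_1)
  qed
  have "ennreal (norm (convolve T (dilate t \<psi>) x)) = ennreal (norm (\<integral>y. f y * dilate t \<psi> (x - y) \<partial>lebesgue))"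
    using ind S by (simp add: convolve_def induces_def)
  also have "\<dots> \<le> (\<integral>\<^sup>+y. ennreal (norm (f y * dilate t \<psi> (x - y))) \<partial>lebesgue)"
    using ind S by (intro integral_norm_bound_ennreal) (simp add: induces_def)
  also have "\<dots> \<le> (\<integral>\<^sup>+y. ennreal (l / t ^ CARD('n)) * (ennreal (norm (f y) / l) * ennreal (1 / (1 + norm ((x - y) /\<^sub>R t)) ^ N)) \<partial>lebesgue)"
  proof (rule nn_integral_mono)
    fix y
    have "norm (f y * dilate t \<psi> (x - y)) \<le> norm (f y) * (1 / t ^ CARD('n) * (1 / (1 + norm ((x - y) /\<^sub>R t)) ^ N))"
      unfolding norm_mult by (intro mult_left_mono ker) simp
    also have "\<dots> = l / t ^ CARD('n) * (norm (f y) / l * (1 / (1 + norm ((x - y) /\<^sub>R t)) ^ N))"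
      using l by simp
    finally show "ennreal (norm (f y * dilate t \<psi> (x - y))) \<le>
        ennreal (l / t ^ CARD('n)) * (ennreal (norm (f y) / l) * ennreal (1 / (1 + norm ((x - y) /\<^sub>R t)) ^ N))"
      using l t by (subst ennreal_mult[symmetric], simp, simp, subst ennreal_mult[symmetric], simp, simp, intro ennreal_leI)
  qed
  also have "\<dots> = ennreal (l / t ^ CARD('n)) * (\<integral>\<^sup>+y. ennreal (norm (f y) / l) * ennreal (1 / (1 + norm ((x - y) /\<^sub>R t)) ^ N) \<partial>lebesgue)"
  proof (rule nn_integral_cmult)
    have [measurable]: "(\<lambda>y. 1 / (1 + norm ((x - y) /\<^sub>R t)) ^ N) \<in> borel_measurable lebesgue"
      by (rule measurable_completion) measurable
    show "(\<lambda>y. ennreal (norm (f y) / l) * ennreal (1 / (1 + norm ((x - y) /\<^sub>R t)) ^ N)) \<in> borel_measurable lebesgue"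
      by measurable
  qed
  also have "\<dots> \<le> ennreal (l / t ^ CARD('n)) * ennreal (2 * a * ?\<omega> * t ^ CARD('n) * kernel_const N CARD('n))"
  proof (intro mult_left_mono kernel_average t N)
    fix r :: real assume r: "0 < r"
    have "\<not> ennreal (2 * a) * emeasure lebesgue (cball x r) < (\<integral>\<^sup>+y. ennreal (norm (f y) / l) * indicator (cball x r) y \<partial>lebesgue)"
      using x r unfolding bad_set_def by blast
    then have "(\<integral>\<^sup>+y. ennreal (norm (f y) / l) * indicator (cball x r) y \<partial>lebesgue) \<le> ennreal (2 * a) * emeasure lebesgue (cball x r)"
      by (rule leI)
    also have "\<dots> = ennreal (2 * a * ?\<omega> * r ^ CARD('n))"
      using a r by (simp add: emeasure_lborel_cball_vec less_imp_le[OF unit_ball_vol_card_pos] mult.assoc flip: ennreal_mult)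
    finally show "(\<integral>\<^sup>+y. ennreal (norm (f y) / l) * indicator (cball x r) y \<partial>lebesgue) \<le> ennreal (2 * a * ?\<omega> * r ^ CARD('n))" .
  qed (use a less_imp_le[OF unit_ball_vol_card_pos] in auto)
  also have "\<dots> = ennreal (2 * a * ?\<omega> * kernel_const N CARD('n) * l)"
    using l t a less_imp_le[OF unit_ball_vol_card_pos] less_imp_le[OF kernel_const_pos[OF N]]
    by (subst ennreal_mult[symmetric]) (simp_all add: field_simps)
  finally show "ennreal (norm (convolve T (dilate t \<psi>) x)) \<le> \<dots>" .
qed

lemma WHp_norm_le_WLp_norm:
  assumes N: "CARD('n) < N"
  obtains C where "0 < C" "\<And>f T. f \<in> WLp p \<Longrightarrow> induces f T \<Longrightarrow> WHp_norm p N T \<le> ennreal C * WLp_norm p f"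
proof -
  obtain C2 where C2: "1 \<le> C2"
    "\<And>F a. weak_bounded F \<Longrightarrow> 0 < a \<Longrightarrow> \<exists>U\<in>sets lebesgue. bad_set F a \<subseteq> U \<and>
       (\<integral>\<^sup>+x. ennreal (a powr p x) * indicator U x \<partial>lebesgue) \<le> ennreal C2"
    by (rule bad_set_measure) (rule that)
  define k where "k = 2 * unit_ball_vol (real CARD('n)) * kernel_const N CARD('n)"
  have k: "0 < k" unfolding k_def using kernel_const_pos[OF N] unit_ball_vol_card_pos by (intro mult_pos_pos) auto
  have le: "WHp_norm p N T \<le> ennreal (k * C2 * l)"
    if f: "f \<in> WLp p" and ind: "induces f T" and l: "0 < l" "WLp_norm p f < ennreal l" for f T l
    unfolding WHp_norm_def WLp_norm_nn_def
  proof (rule SUP_least)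
    fix b :: real assume "b \<in> {0<..}"
    then have b: "0 < b" by simp
    \<comment> \<open>Chosen so that the bound outside the bad set at level \<open>a\<close> is
      exactly \<open>b\<close>.\<close>
    define a where "a = b / (k * l)"
    have a: "0 < a" using b k l by (simp add: a_def)
    have fm: "f \<in> borel_measurable lebesgue" using f by (simp add: WLp_def)
    obtain U where U: "U \<in> sets lebesgue" "bad_set (\<lambda>x. ennreal (norm (f x) / l)) a \<subseteq> U"
       "(\<integral>\<^sup>+x. ennreal (a powr p x) * indicator U x \<partial>lebesgue) \<le> ennreal C2"
      using C2(2)[OF WLp_weak_bounded[OF fm l] a] by blast
    have sub: "{x. ennreal b < grand_maximal N T x} \<subseteq> U"
    proof
      fix x assume "x \<in> {x. ennreal b < grand_maximal N T x}"
      moreover have "2 * a * unit_ball_vol (real CARD('n)) * kernel_const N CARD('n) * l = b"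
      proof -
        have "2 * a * unit_ball_vol (real CARD('n)) * kernel_const N CARD('n) * l = a * (k * l)" by (simp add: k_def)
        also have "\<dots> = b" using k l by (simp add: a_def)
        finally show ?thesis .
      qed
      ultimately have "\<not> grand_maximal N T x \<le> ennreal (2 * a * unit_ball_vol (real CARD('n)) * kernel_const N CARD('n) * l)"
        by (simp add: not_le)
      then have "x \<in> bad_set (\<lambda>x. ennreal (norm (f x) / l)) a"
        using grand_maximal_le_outside_bad_set[OF ind l(1) a N] by blast
      with U(2) show "x \<in> U" by blast
    qed
    have "ennreal b * Lp_norm p (indicator {x. ennreal b < grand_maximal N T x}) \<le> ennreal b * Lp_norm p (indicator U)"
      by (intro mult_left_mono Lp_norm_mono p_pos) (use sub in \<open>auto simp: indicator_def\<close>)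
    also have "\<dots> = ennreal (k * l) * (ennreal a * Lp_norm p (indicator U))"
      using a k l by (simp add: a_def flip: mult.assoc ennreal_mult)
    also have "\<dots> \<le> ennreal (k * l) * ennreal C2"
      by (intro mult_left_mono Lp_norm_indicator_le U p_measurable p_ge_1 a C2) auto
    also have "\<dots> = ennreal (k * C2 * l)" using k l C2(1) by (simp add: mult_ac flip: ennreal_mult)
    finally show "ennreal b * Lp_norm p (indicator {x. ennreal b < grand_maximal N T x}) \<le> \<dots>" .
  qed
  show ?thesis
  proof (rule that)
    show kC: "0 < k * C2" using k C2(1) by simp
    fix f T assume f: "f \<in> WLp p" and ind: "induces f T"
    obtain r where r: "0 \<le> r" "WLp_norm p f = ennreal r"
      using f by (cases "WLp_norm p f") (auto simp: WLp_def)
    \<comment> \<open>The estimate \<open>le\<close> needs a number strictly above the norm. Adding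
      a small positive amount also covers a vanishing norm.\<close>
    have W: "WHp_norm p N T \<le> ennreal (k * C2 * r) + ennreal e" if e: "0 < e" for e
    proof -
      have "WHp_norm p N T \<le> ennreal (k * C2 * (r + e / (k * C2)))"
        by (rule le[OF f ind]) (use r e kC in \<open>auto simp: ennreal_less_iff add_nonneg_pos\<close>)
      also have "k * C2 * (r + e / (k * C2)) = k * C2 * r + e" using k C2(1) by (simp add: algebra_simps)
      finally show ?thesis using r e kC by (simp add: ennreal_plus)
    qed
    have "WHp_norm p N T \<le> ennreal (k * C2 * r)" by (rule ennreal_le_epsilon) (rule W)
    also have "\<dots> = ennreal (k * C2) * WLp_norm p f"
      unfolding r(2) using r(1) kC by (intro ennreal_mult) simp_all
    finally show "WHp_norm p N T \<le> ennreal (k * C2) * WLp_norm p f" .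
  qed
qed

end

section \<open>From distributions to functions\<close>

definition cell_bump :: "real^'n \<Rightarrow> complex" where
  "cell_bump y = of_real (\<Prod>i\<in>UNIV. bump (y $ i))"

lemma smooth_cell_bump: "smooth cell_bump"
  unfolding cell_bump_def[abs_def] by (rule smooth_prod_coordinates) (rule times_deriv_bump)

lemma cell_bump_eq_0: "y $ i \<le> 0 \<or> 2 \<le> y $ i \<Longrightarrow> cell_bump y = 0"
  unfolding cell_bump_def by (simp del: of_real_prod) (use bump_eq_0 in blast)

lemma norm_gt_component:
  fixes y :: "real^'n"
  assumes "c * real CARD('n) < norm y"
  obtains i where "c < \<bar>y $ i\<bar>"
proof (rule ccontr)
  assume "\<not> thesis"
  then have "\<bar>y $ i\<bar> \<le> c" for i using that not_less by blast
  then have "(\<Sum>i\<in>UNIV. \<bar>y $ i\<bar>) \<le> (\<Sum>i\<in>(UNIV :: 'n set). c)" by (intro sum_mono)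
  with norm_le_l1_cart[of y] assms show False by (simp add: mult.commute)
qed

lemma cell_bump_support: "2 * real CARD('n) < norm y \<Longrightarrow> cell_bump (y :: real^'n) = 0"
proof (erule norm_gt_component)
  fix i assume "2 < \<bar>y $ i\<bar>"
  then have "y $ i \<le> 0 \<or> 2 \<le> y $ i" by linarith
  then show "cell_bump y = 0" by (rule cell_bump_eq_0)
qed

definition grid_index :: "nat \<Rightarrow> real^'n \<Rightarrow> 'n \<Rightarrow> int" where
  "grid_index k x = (\<lambda>i. \<lfloor>2 ^ k * x $ i\<rfloor>)"

text \<open>Not normalised by volume: for fixed \<open>k\<close> these functions form a partition of
  unity. Each is supported in a cube of twice the side of its cell.\<close>

definition grid_bump :: "nat \<Rightarrow> ('n \<Rightarrow> int) \<Rightarrow> real^'n \<Rightarrow> complex" where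
  "grid_bump k q y = cell_bump (2 ^ k *\<^sub>R y - (\<chi> i. of_int (q i)))"

lemma smooth_grid_bump: "smooth (grid_bump k q)"
  using smooth_affine[OF smooth_cell_bump, of "- (\<chi> i. of_int (q i))" "2 ^ k"]
  by (simp add: grid_bump_def[abs_def] algebra_simps)

lemma grid_bump_support:
  assumes "norm (\<chi> i. real_of_int (q i)) + 2 * real CARD('n) < norm (y :: real^'n)"
  shows "grid_bump k q y = 0"
  unfolding grid_bump_def
proof (rule cell_bump_support)
  have "norm y \<le> norm ((2 ^ k) *\<^sub>R y)"
    by (simp add: mult_le_cancel_right1)
  also have "\<dots> \<le> norm ((2 ^ k) *\<^sub>R y - (\<chi> i. real_of_int (q i))) + norm (\<chi> i. real_of_int (q i))"
    using norm_triangle_sub[of "(2 ^ k) *\<^sub>R y" "\<chi> i. real_of_int (q i)"] by simp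
  finally show "2 * real CARD('n) < norm ((2 ^ k) *\<^sub>R y - (\<chi> i. real_of_int (q i)))" using assms by linarith
qed

lemma grid_bump_schwartz: "grid_bump k q \<in> schwartz"
  by (rule schwartz_compact_support[OF smooth_grid_bump grid_bump_support])

text \<open>Distributing the product over the coordinates reduces this to the telescoping sum in one
  variable.\<close>

lemma sum_grid_bump:
  fixes y :: "real^'n"
  assumes "\<And>i. \<bar>2 ^ k * y $ i\<bar> \<le> real_of_int L - 2"
  shows "(\<Sum>q\<in>PiE UNIV (\<lambda>_. {-L..L}). grid_bump k q y) = 1"
proof -
  have "(\<Prod>i\<in>UNIV. \<Sum>m\<in>{-L..L}. bump (2 ^ k * y $ i - real_of_int m)) =
      (\<Sum>q\<in>PiE UNIV (\<lambda>_. {-L..L}). \<Prod>i\<in>UNIV. bump (2 ^ k * y $ i - real_of_int (q i)))"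
    by (rule prod_sum_PiE) auto
  moreover have "(\<Sum>m\<in>{-L..L}. bump (2 ^ k * y $ i - real_of_int m)) = 1" for i
    using assms[of i] by (intro sum_bump_eq_1) (auto simp: abs_le_iff)
  ultimately have "(\<Sum>q\<in>PiE UNIV (\<lambda>_. {-L..L}). \<Prod>i\<in>UNIV. bump (2 ^ k * y $ i - real_of_int (q i))) = 1"
    by simp
  then show ?thesis
    unfolding grid_bump_def cell_bump_def of_real_sum[symmetric] by simp
qed

text \<open>In units of the mesh, \<open>x\<close> is within \<open>n\<close> of the corner of its
  cell and the bump vanishes beyond distance \<open>2 * n\<close> from that corner.\<close>

lemma grid_bump_grid_index:
  fixes x y :: "real^'n"
  assumes "grid_bump k (grid_index k x) y \<noteq> 0"
  shows "norm (x - y) \<le> 3 * real CARD('n) / 2 ^ k"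
proof -
  let ?c = "2 ^ k *\<^sub>R x - (\<chi> i. real_of_int (grid_index k x i)) :: real^'n"
  have c: "\<bar>?c $ i\<bar> \<le> 1" for i
    unfolding grid_index_def by simp linarith
  have "norm ?c \<le> (\<Sum>i\<in>UNIV. \<bar>?c $ i\<bar>)" by (rule norm_le_l1_cart)
  also have "\<dots> \<le> (\<Sum>i\<in>(UNIV :: 'n set). 1)" by (intro sum_mono c)
  finally have nc: "norm ?c \<le> real CARD('n)" by simp
  have "norm (2 ^ k *\<^sub>R y - (\<chi> i. real_of_int (grid_index k x i))) \<le> 2 * real CARD('n)"
    using assms cell_bump_support unfolding grid_bump_def by (meson not_less)
  moreover have "2 ^ k *\<^sub>R (x - y) = ?c - (2 ^ k *\<^sub>R y - (\<chi> i. real_of_int (grid_index k x i)))"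
    by (simp add: scaleR_diff_right)
  ultimately have "norm (2 ^ k *\<^sub>R (x - y)) \<le> 3 * real CARD('n)"
    using nc norm_triangle_ineq4[of ?c "2 ^ k *\<^sub>R y - (\<chi> i. real_of_int (grid_index k x i))"] by simp
  then show ?thesis by (simp add: pos_le_divide_eq mult.commute)
qed

text \<open>The index type is countable and each cell is a finite intersection of Borel half-spaces,
  so an arbitrary function \<open>c\<close> of the index is allowed.\<close>

lemma grid_index_measurable: "(\<lambda>x. c (grid_index k x)) \<in> borel_measurable (lebesgue :: (real^'n) measure)"
proof -
  have "grid_index k \<in> (lebesgue :: (real^'n) measure) \<rightarrow>\<^sub>M count_space UNIV"
  proof (subst measurable_count_space_eq2_countable, safe)
    fix q :: "'n \<Rightarrow> int"
    have "grid_index k -` {q} = (\<Inter>i. {x :: real^'n. \<lfloor>2 ^ k * x $ i\<rfloor> = q i})"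
      by (auto simp: grid_index_def fun_eq_iff)
    also have "\<dots> = (\<Inter>i. {x :: real^'n. real_of_int (q i) \<le> 2 ^ k * x $ i} \<inter> {x. 2 ^ k * x $ i < real_of_int (q i) + 1})"
      by (auto simp: floor_eq_iff)
    also have "\<dots> \<in> sets borel"
      by (intro sets.countable_INT' sets.Int borel_closed closed_Collect_le borel_open open_Collect_less continuous_intros) auto
    finally show "grid_index k -` {q} \<inter> space lebesgue \<in> sets (lebesgue :: (real^'n) measure)" by simp
  qed auto
  then show ?thesis by (rule measurable_compose) simp
qed

text \<open>The half-open cell is squeezed between an open and a closed box of equal
  measure.\<close>

lemma grid_cell_measure:
  fixes q :: "'n::finite \<Rightarrow> int"
  shows "{x :: real^'n. grid_index k x = q} \<in> sets lebesgue"
    "measure lebesgue {x :: real^'n. grid_index k x = q} = 1 / 2 ^ (k * CARD('n))"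
    "emeasure lebesgue {x :: real^'n. grid_index k x = q} < \<infinity>"
proof -
  let ?Q = "{x :: real^'n. grid_index k x = q}"
  have "(\<lambda>x :: real^'n. of_bool (grid_index k x = q) :: real) \<in> borel_measurable lebesgue"
    by (rule grid_index_measurable)
  then have "(\<lambda>x :: real^'n. of_bool (grid_index k x = q) :: real) -` {1} \<inter> space lebesgue \<in> sets lebesgue"
    by (rule measurable_sets) simp
  moreover have "(\<lambda>x :: real^'n. of_bool (grid_index k x = q) :: real) -` {1} \<inter> space lebesgue = ?Q" by auto
  ultimately show Q: "?Q \<in> sets lebesgue" by simp
  define a b :: "real^'n" where "a = (\<chi> i. q i / 2 ^ k)" and "b = (\<chi> i. (q i + 1) / 2 ^ k)"
  have ab: "a $ i \<le> b $ i" for i by (simp add: a_def b_def divide_right_mono)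
  have sub: "box a b \<subseteq> ?Q" "?Q \<subseteq> cbox a b"
    by (auto simp: mem_box_cart a_def b_def grid_index_def fun_eq_iff floor_eq_iff pos_divide_less_eq pos_less_divide_eq
        pos_divide_le_eq pos_le_divide_eq mult.commute less_imp_le)
  have ne: "cbox a b \<noteq> {}" using ab by (auto simp: box_ne_empty inner_axis Basis_vec_def)
  have em: "emeasure lebesgue (box a b) = emeasure lebesgue (cbox a b)"
  proof -
    have "i \<in> Basis \<Longrightarrow> a \<bullet> i \<le> b \<bullet> i" for i using ab by (auto simp: Basis_vec_def inner_axis)
    then show ?thesis by (simp add: emeasure_lborel_box emeasure_lborel_cbox)
  qed
  have "emeasure lebesgue (box a b) \<le> emeasure lebesgue ?Q" "emeasure lebesgue ?Q \<le> emeasure lebesgue (cbox a b)"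
    using emeasure_mono[OF sub(1) Q] emeasure_mono[OF sub(2), of lebesgue] by simp_all
  then have eq: "emeasure lebesgue ?Q = emeasure lebesgue (cbox a b)" using em by simp
  also have "\<dots> < \<infinity>" using emeasure_bounded_finite[OF bounded_cbox, of a b] by simp
  finally show "emeasure lebesgue ?Q < \<infinity>" .
  have "measure lebesgue ?Q = measure lborel (cbox a b)"
    using eq by (simp add: measure_def)
  also have "\<dots> = (\<Prod>i\<in>UNIV. b $ i - a $ i)" by (rule content_cbox_cart[OF ne])
  also have "\<dots> = 1 / 2 ^ (k * CARD('n))"
    by (simp add: a_def b_def diff_divide_distrib[symmetric] power_mult power_one_over divide_simps power_divide)
  finally show "measure lebesgue ?Q = 1 / 2 ^ (k * CARD('n))" .
qed

text \<open>The product of \<open>g\<close> and the bump of the cell of \<open>x\<close>, times the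
  inverse cell volume, is the reflected dilate at scale \<open>1 / 2 ^ k\<close> of a function
  \<psi> supported in \<open>norm z \<le> 3 * n\<close>. Its bump factor is a reflected translate of
  \<open>cell_bump\<close>, so the norm of \<psi> depends only on the local bound \<open>M\<close>
  for \<open>g\<close>, and \<open>C\<close> precedes all other quantities. It is used with
  \<open>g = 1\<close> to dominate the averages and with \<open>g = \<phi> - \<phi> x\<close> to
  estimate the error of freezing \<phi>.\<close>

lemma grid_bump_grand_maximal:
  "\<exists>C>0. \<forall>T (g :: real^'n \<Rightarrow> complex) x k M. T \<in> tempered \<longrightarrow> smooth g \<longrightarrow> 0 < M \<longrightarrow>
     (\<forall>js z. length js \<le> N \<longrightarrow> norm z \<le> 3 * real CARD('n) \<longrightarrow> norm (pd js (\<lambda>z. g (x + (- 1 / 2 ^ k) *\<^sub>R z)) z) \<le> M) \<longrightarrow>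
     ennreal (norm (2 ^ (k * CARD('n)) * T (\<lambda>y. g y * grid_bump k (grid_index k x) y))) \<le> ennreal (C * M) * grand_maximal N T x"
proof -
  let ?n = "real CARD('n)"
  obtain B where B: "0 \<le> B" "\<And>js x. length js \<le> N \<Longrightarrow> norm (pd js (cell_bump :: real^'n \<Rightarrow> complex) x) \<le> B"
    using pd_compact_support_bounded[OF smooth_cell_bump cell_bump_support] by blast
  define K where "K = real (card {\<beta> :: 'n \<Rightarrow> nat. sum \<beta> UNIV \<le> N}) * ((1 + 3 * ?n) ^ N * (2 ^ N * B))"
  have K: "0 \<le> K" using B by (simp add: K_def)
  show ?thesis
  proof (intro exI[of _ "K + 1"] conjI allI impI)
    show "0 < K + 1" using K by simp
    fix T :: "(real^'n \<Rightarrow> complex) \<Rightarrow> complex" and g :: "real^'n \<Rightarrow> complex" and x k and M :: real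
    assume T: "T \<in> tempered" and g: "smooth g" and M: "0 < M"
      and bound: "\<forall>js z. length js \<le> N \<longrightarrow> norm z \<le> 3 * ?n \<longrightarrow> norm (pd js (\<lambda>z. g (x + (- 1 / 2 ^ k) *\<^sub>R z)) z) \<le> M"
    define c where "c = 2 ^ k *\<^sub>R x - (\<chi> i. real_of_int (grid_index k x i))"
    define \<psi> where "\<psi> = (\<lambda>z. g (x + (- 1 / 2 ^ k) *\<^sub>R z) * cell_bump (c + (- 1) *\<^sub>R z))"
    have sg: "smooth (\<lambda>z. g (x + (- 1 / 2 ^ k) *\<^sub>R z))" by (rule smooth_affine[OF g])
    have sc: "smooth (\<lambda>z. cell_bump (c + (- 1) *\<^sub>R z))" by (rule smooth_affine[OF smooth_cell_bump])
    have s\<psi>: "smooth \<psi>" unfolding \<psi>_def by (rule smooth_mult[OF sg sc])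
    have dil: "dilate (1 / 2 ^ k) \<psi> (x - y) = 2 ^ (k * CARD('n)) * (g y * grid_bump k (grid_index k x) y)" for y
    proof -
      have "x + (- 1 / 2 ^ k) *\<^sub>R ((x - y) /\<^sub>R (1 / 2 ^ k)) = y" by (simp add: algebra_simps)
      moreover have "c + (- 1) *\<^sub>R ((x - y) /\<^sub>R (1 / 2 ^ k)) = 2 ^ k *\<^sub>R y - (\<chi> i. real_of_int (grid_index k x i))"
        by (simp add: c_def algebra_simps)
      ultimately have "\<psi> ((x - y) /\<^sub>R (1 / 2 ^ k)) = g y * grid_bump k (grid_index k x) y"
        by (simp only: \<psi>_def grid_bump_def)
      then show ?thesis by (simp add: dilate_def scaleR_conv_of_real power_one_over power_mult)
    qed
    have supp: "\<psi> z = 0" if z: "3 * ?n < norm z" for z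
    proof (rule ccontr)
      assume "\<psi> z \<noteq> 0"
      define y where "y = x + (- 1 / 2 ^ k) *\<^sub>R z"
      have xy: "x - y = (1 / 2 ^ k) *\<^sub>R z" by (simp add: y_def)
      have "c + (- 1) *\<^sub>R z = 2 ^ k *\<^sub>R y - (\<chi> i. real_of_int (grid_index k x i))"
        by (simp add: c_def y_def algebra_simps)
      then have "grid_bump k (grid_index k x) y \<noteq> 0"
        using \<open>\<psi> z \<noteq> 0\<close> unfolding \<psi>_def grid_bump_def by auto
      from grid_bump_grid_index[OF this] have "norm z / 2 ^ k \<le> 3 * ?n / 2 ^ k" unfolding xy by simp
      with z show False by (simp add: divide_le_cancel)
    qed
    have "norm (pd js \<psi> z) \<le> 2 ^ N * (M * B)" if js: "length js \<le> N" and z: "norm z \<le> 3 * ?n" for js z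
    proof -
      have "norm (pd js \<psi> z) \<le> 2 ^ length js * (M * B)"
        unfolding \<psi>_def
      proof (rule norm_pd_mult_le[OF sg sc])
        fix ks assume "subseq ks js"
        then have l: "length ks \<le> N" using js list_emb_length by fastforce
        show "norm (pd ks (\<lambda>z. g (x + (- 1 / 2 ^ k) *\<^sub>R z)) z) \<le> M" using bound l z by blast
        have "norm (pd ks (\<lambda>z. cell_bump (c + (- 1) *\<^sub>R z)) z) = norm (pd ks cell_bump (c + (- 1) *\<^sub>R z))"
          by (subst pd_affine[OF smooth_cell_bump]) (simp add: norm_mult norm_power)
        also have "\<dots> \<le> B" by (rule B(2)[OF l])
        finally show "norm (pd ks (\<lambda>z. cell_bump (c + (- 1) *\<^sub>R z)) z) \<le> B" .
      qed
      also have "\<dots> \<le> 2 ^ N * (M * B)" using js M B by (intro mult_right_mono power_increasing) auto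
      finally show ?thesis .
    qed
    then have "schwartz_norm N \<psi> \<le> real (card {\<beta> :: 'n \<Rightarrow> nat. sum \<beta> UNIV \<le> N}) * ((1 + 3 * ?n) ^ N * (2 ^ N * (M * B)))"
      using M B by (intro schwartz_norm_compact_support supp) auto
    also have "\<dots> = K * M" by (simp add: K_def)
    also have "\<dots> \<le> (K + 1) * M" using M by simp
    finally have n\<psi>: "schwartz_norm N \<psi> \<le> (K + 1) * M" .
    have "ennreal (norm (T (\<lambda>y. dilate (1 / 2 ^ k) \<psi> (x - y)))) \<le> ennreal ((K + 1) * M) * grand_maximal N T x"
      using K M by (intro norm_le_grand_maximal[OF T _ n\<psi>] schwartz_compact_support[OF s\<psi> supp]) auto
    moreover have "T (\<lambda>y. dilate (1 / 2 ^ k) \<psi> (x - y)) = 2 ^ (k * CARD('n)) * T (\<lambda>y. g y * grid_bump k (grid_index k x) y)"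
    proof -
      have "(\<lambda>y. g y * grid_bump k (grid_index k x) y) \<in> schwartz"
        by (rule schwartz_compact_support[OF smooth_mult[OF g smooth_grid_bump],
            where R = "norm (\<chi> i. real_of_int (grid_index k x i)) + 2 * ?n"]) (simp add: grid_bump_support)
      then show ?thesis unfolding dil by (rule tempered_cmult[OF T])
    qed
    ultimately show "ennreal (norm (2 ^ (k * CARD('n)) * T (\<lambda>y. g y * grid_bump k (grid_index k x) y))) \<le> ennreal ((K + 1) * M) * grand_maximal N T x"
      by simp
  qed
qed

lemma smooth_lipschitz:
  fixes \<phi> :: "real^'n \<Rightarrow> complex"
  assumes \<phi>: "smooth \<phi>" and M: "\<And>i x. norm (partial i \<phi> x) \<le> M"
  shows "norm (\<phi> x - \<phi> y) \<le> real CARD('n) * M * norm (x - y)"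
proof (rule differentiable_bound[of UNIV \<phi> "\<lambda>x. frechet_derivative \<phi> (at x)"])
  fix x :: "real^'n"
  have d: "(\<phi> has_derivative frechet_derivative \<phi> (at x)) (at x)"
    using smooth_differentiable[OF \<phi>] frechet_derivative_works by blast
  then show "(\<phi> has_derivative frechet_derivative \<phi> (at x)) (at x within UNIV)" by simp
  interpret linear "frechet_derivative \<phi> (at x)" using d by (rule has_derivative_linear)
  show "onorm (frechet_derivative \<phi> (at x)) \<le> real CARD('n) * M"
  proof (rule onorm_le)
    fix h :: "real^'n"
    have "frechet_derivative \<phi> (at x) h = frechet_derivative \<phi> (at x) (\<Sum>i\<in>UNIV. h $ i *\<^sub>R axis i 1)"
      using basis_expansion[of h] by (simp add: scalar_mult_eq_scaleR)
    also have "\<dots> = (\<Sum>i\<in>UNIV. h $ i *\<^sub>R partial i \<phi> x)"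
      by (simp add: sum scaleR partial_eq[OF d])
    also have "norm \<dots> \<le> (\<Sum>i\<in>(UNIV :: 'n set). norm h * M)"
    proof (rule sum_norm_le)
      fix i
      show "norm (h $ i *\<^sub>R partial i \<phi> x) \<le> norm h * M"
        unfolding norm_scaleR by (intro mult_mono M) (auto simp: component_le_norm_cart)
    qed
    finally show "norm (frechet_derivative \<phi> (at x) h) \<le> real CARD('n) * M * norm h" by (simp add: mult_ac)
  qed
qed auto

text \<open>Every derivative in \<open>z\<close> brings a factor \<open>1 / 2 ^ k\<close> by the
  chain rule. At order zero this factor comes from the Lipschitz bound, for which the constant
  \<open>\<phi> x\<close> is subtracted and \<open>z\<close> is kept bounded.\<close>

lemma local_variation_bound:
  fixes \<phi> :: "real^'n \<Rightarrow> complex"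
  assumes \<phi>: "smooth \<phi>" "\<And>x. R < norm x \<Longrightarrow> \<phi> x = 0"
  obtains C where "0 < C"
    "\<And>js x z k. length js \<le> N \<Longrightarrow> norm z \<le> 3 * real CARD('n) \<Longrightarrow>
       norm (pd js (\<lambda>z. \<phi> (x + (- 1 / 2 ^ k) *\<^sub>R z) - \<phi> x) z) \<le> C / 2 ^ k"
proof -
  let ?n = "real CARD('n)"
  obtain M where M: "0 \<le> M" "\<And>js x. length js \<le> Suc N \<Longrightarrow> norm (pd js \<phi> x) \<le> M"
    by (rule pd_compact_support_bounded[OF \<phi>, where N = "Suc N"]) (assumption, rule that)
  define C where "C = ?n * M * (3 * ?n) + M + 1"
  have C0: "0 < C" using M by (simp add: C_def add_nonneg_pos)
  have "norm (pd js (\<lambda>z. \<phi> (x + (- 1 / 2 ^ k) *\<^sub>R z) - \<phi> x) z) \<le> C / 2 ^ k"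
    if js: "length js \<le> N" and z: "norm z \<le> 3 * ?n" for js x z and k :: nat
  proof (cases js)
    case Nil
    have "norm (\<phi> (x + (- 1 / 2 ^ k) *\<^sub>R z) - \<phi> x) \<le> ?n * M * norm (x + (- 1 / 2 ^ k) *\<^sub>R z - x)"
      by (rule smooth_lipschitz[OF \<phi>(1)]) (use M(2)[of "[_]"] in simp)
    also have "\<dots> = ?n * M * norm z / 2 ^ k" by simp
    also have "\<dots> \<le> C / 2 ^ k"
    proof (intro divide_right_mono)
      have "?n * M * norm z \<le> ?n * M * (3 * ?n)" using M by (intro mult_left_mono z) auto
      then show "?n * M * norm z \<le> C" using M unfolding C_def by linarith
    qed simp
    finally show ?thesis by (simp add: Nil)
  next
    case (Cons j js')
    have "pd js (\<lambda>z. \<phi> (x + (- 1 / 2 ^ k) *\<^sub>R z) - \<phi> x) z = of_real ((- 1 / 2 ^ k) ^ length js) * pd js \<phi> (x + (- 1 / 2 ^ k) *\<^sub>R z)"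
      unfolding pd_diff[OF smooth_affine[OF \<phi>(1)] smooth_const] pd_affine[OF \<phi>(1)]
      by (simp add: Cons pd_const del: foldr.simps)
    also have "norm \<dots> = (1 / 2 ^ k) ^ length js * norm (pd js \<phi> (x + (- 1 / 2 ^ k) *\<^sub>R z))"
      unfolding norm_mult norm_of_real by (simp add: power_abs)
    also have "\<dots> \<le> (1 / 2 ^ k) ^ 1 * M"
    proof (rule mult_mono)
      show "norm (pd js \<phi> (x + (- 1 / 2 ^ k) *\<^sub>R z)) \<le> M" by (rule M(2)) (use js in simp)
      have "1 \<le> length js" by (simp add: Cons)
      then show "(1 / 2 ^ k) ^ length js \<le> (1 / 2 ^ k :: real) ^ 1"
        by (intro power_decreasing) (auto simp: divide_le_eq_1)
    qed auto
    also have "\<dots> \<le> C / 2 ^ k" using M by (auto simp: C_def intro!: divide_right_mono)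
    finally show ?thesis .
  qed
  with C0 show ?thesis by (rule that)
qed

lemma sigma_finite_lebesgue: "sigma_finite_measure (lebesgue :: 'a::euclidean_space measure)"
proof
  let ?A = "range (\<lambda>n :: nat. cball (0 :: 'a) (real n))"
  have "\<Union>?A = UNIV" using real_arch_simple by fastforce
  moreover have "emeasure lebesgue a \<noteq> \<infinity>" if "a \<in> ?A" for a
    using that emeasure_bounded_finite[OF bounded_cball] by (auto simp: less_top)
  ultimately show "\<exists>A. countable A \<and> A \<subseteq> sets (lebesgue :: 'a measure) \<and> \<Union>A = space lebesgue \<and> (\<forall>a\<in>A. emeasure lebesgue a \<noteq> \<infinity>)"
    by (intro exI[of _ ?A]) auto
qed

text \<open>The factor is the reciprocal of the cell volume, so the integral over a cell is the
  value of \<open>T\<close> at the bump of that cell.\<close>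

definition grid_average :: "((real^'n \<Rightarrow> complex) \<Rightarrow> complex) \<Rightarrow> nat \<Rightarrow> real^'n \<Rightarrow> complex" where
  "grid_average T k x = 2 ^ (k * CARD('n)) * T (grid_bump k (grid_index k x))"

lemma grid_average_measurable: "grid_average T k \<in> borel_measurable lebesgue"
  unfolding grid_average_def[abs_def] by (rule grid_index_measurable)

text \<open>The identity is exact for every \<open>k\<close>: the integral over the cell of index
  \<open>q\<close> returns \<open>T\<close> at \<phi> times its bump, and the bumps sum to 1 on the
  support of \<phi>. Compact support leaves finitely many indices.\<close>

lemma grid_sum_has_integral:
  fixes \<phi> :: "real^'n \<Rightarrow> complex"
  assumes T: "T \<in> tempered" and \<phi>: "smooth \<phi>" "\<And>x. R < norm x \<Longrightarrow> \<phi> x = 0"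
  shows "has_bochner_integral lebesgue (\<lambda>x. 2 ^ (k * CARD('n)) * T (\<lambda>y. \<phi> y * grid_bump k (grid_index k x) y)) (T \<phi>)"
proof -
  \<comment> \<open>The margin 3 suffices both for the bumps with indices between \<open>-L\<close>
    and \<open>L\<close> to sum to 1 on the support of \<phi> and for all other bumps to miss
    it.\<close>
  define L where "L = \<lceil>2 ^ k * R\<rceil> + 3"
  have L: "2 ^ k * R \<le> real_of_int L - 3" unfolding L_def by linarith
  define J where "J = PiE (UNIV :: 'n set) (\<lambda>_. {-L..L})"
  have J: "finite J" unfolding J_def by (intro finite_PiE) auto
  have small: "\<bar>2 ^ k * y $ i\<bar> \<le> real_of_int L - 3" if "\<phi> y \<noteq> 0" for y i
  proof -
    have "norm y \<le> R" using \<phi>(2)[of y] that by force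
    then have "\<bar>y $ i\<bar> \<le> R" using component_le_norm_cart[of y i] by linarith
    then have "2 ^ k * \<bar>y $ i\<bar> \<le> 2 ^ k * R" by (intro mult_left_mono) auto
    moreover have "\<bar>2 ^ k * y $ i\<bar> = 2 ^ k * \<bar>y $ i\<bar>" by (simp add: abs_mult)
    ultimately show ?thesis using L by linarith
  qed
  have decomp: "\<phi> y = (\<Sum>q\<in>J. \<phi> y * grid_bump k q y)" for y
  proof (cases "\<phi> y = 0")
    case False
    have "(\<Sum>q\<in>J. grid_bump k q y) = 1"
      unfolding J_def by (rule sum_grid_bump) (rule order_trans[OF small[OF False]], simp)
    then show ?thesis by (simp add: sum_distrib_left[symmetric])
  qed simp
  have out: "\<phi> y * grid_bump k q y = 0" if "q \<notin> J" for q y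
  proof (rule ccontr)
    assume *: "\<phi> y * grid_bump k q y \<noteq> 0"
    have "\<exists>i. q i < -L \<or> L < q i"
    proof (rule ccontr)
      assume "\<nexists>i. q i < -L \<or> L < q i"
      then have "q i \<in> {-L..L}" for i by (metis atLeastAtMost_iff not_less)
      with that show False by (simp add: J_def PiE_iff)
    qed
    then obtain i where i: "q i < -L \<or> L < q i" ..
    have "\<not> ((2 ^ k *\<^sub>R y - (\<chi> i. real_of_int (q i))) $ i \<le> 0 \<or> 2 \<le> (2 ^ k *\<^sub>R y - (\<chi> i. real_of_int (q i))) $ i)"
      using cell_bump_eq_0[of "2 ^ k *\<^sub>R y - (\<chi> i. real_of_int (q i))" i] * unfolding grid_bump_def by (metis mult_zero_right)
    then have "0 < 2 ^ k * y $ i - real_of_int (q i)" "2 ^ k * y $ i - real_of_int (q i) < 2" by auto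
    with i small[of y i] * show False by (auto simp: abs_le_iff)
  qed
  have S: "(\<lambda>y. \<phi> y * grid_bump k q y) \<in> schwartz" for q
    by (rule schwartz_compact_support[OF smooth_mult[OF \<phi>(1) smooth_grid_bump], where R = R]) (simp add: \<phi>(2))
  define c where "c = (\<lambda>q. 2 ^ (k * CARD('n)) * T (\<lambda>y. \<phi> y * grid_bump k q y))"
  have c0: "c q = 0" if "q \<notin> J" for q
    unfolding c_def out[OF that] by (simp add: tempered_zero[OF T])
  let ?Q = "\<lambda>q. {x :: real^'n. grid_index k x = q}"
  have "has_bochner_integral lebesgue (\<lambda>x. \<Sum>q\<in>J. indicator (?Q q) x *\<^sub>R c q) (\<Sum>q\<in>J. measure lebesgue (?Q q) *\<^sub>R c q)"
    by (intro has_bochner_integral_sum has_bochner_integral_indicator grid_cell_measure)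
  also have "(\<lambda>x. \<Sum>q\<in>J. indicator (?Q q) x *\<^sub>R c q) = (\<lambda>x. c (grid_index k x))"
  proof
    fix x
    have "(\<Sum>q\<in>J. indicator (?Q q) x *\<^sub>R c q) = (\<Sum>q\<in>J. if q = grid_index k x then c (grid_index k x) else 0)"
      by (intro sum.cong) (auto simp: indicator_def)
    also have "\<dots> = c (grid_index k x)" using J c0 by simp
    finally show "(\<Sum>q\<in>J. indicator (?Q q) x *\<^sub>R c q) = c (grid_index k x)" .
  qed
  also have "(\<Sum>q\<in>J. measure lebesgue (?Q q) *\<^sub>R c q) = (\<Sum>q\<in>J. T (\<lambda>y. \<phi> y * grid_bump k q y))"
    by (simp only: grid_cell_measure(2) c_def) (simp add: scaleR_conv_of_real)
  also have "\<dots> = T (\<lambda>y. \<Sum>q\<in>J. \<phi> y * grid_bump k q y)"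
    by (rule tempered_sum[OF T S, symmetric])
  also have "\<dots> = T \<phi>" unfolding decomp[symmetric] by simp
  finally show ?thesis unfolding c_def .
qed

text \<open>Written with \<open>1 * (x $ i)\<close> and \<open>(- 1) * (x $ i)\<close> so that
  \<open>times_deriv_affine\<close> applies literally.\<close>

definition cutoff :: "real^'n \<Rightarrow> complex" where
  "cutoff x = of_real (\<Prod>i\<in>UNIV. smooth_step (2 + 1 * (x $ i)) * smooth_step (2 + (- 1) * (x $ i)))"

lemma smooth_cutoff: "smooth cutoff"
proof -
  have "smooth (\<lambda>x. complex_of_real (\<Prod>i\<in>UNIV. (\<lambda>t. smooth_step (2 + 1 * t) * smooth_step (2 + (- 1) * t)) (x $ i)))"
    by (rule smooth_prod_coordinates[of "\<lambda>i t. smooth_step (2 + 1 * t) * smooth_step (2 + (- 1) * t)"])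
      (intro times_deriv_mult times_deriv_affine times_deriv_smooth_step)
  then show ?thesis unfolding cutoff_def[abs_def] .
qed

lemma cutoff_eq_0:
  fixes x :: "real^'n"
  assumes "2 * real CARD('n) < norm x"
  shows "cutoff x = 0"
proof -
  obtain i where "2 < \<bar>x $ i\<bar>" by (rule norm_gt_component[OF assms])
  then have "smooth_step (2 + 1 * (x $ i)) * smooth_step (2 + (- 1) * (x $ i)) = 0"
    using smooth_step_eq_0[of "2 + x $ i"] smooth_step_eq_0[of "2 - x $ i"] by (cases "0 \<le> x $ i") auto
  then have "(\<Prod>i\<in>UNIV. smooth_step (2 + 1 * (x $ i)) * smooth_step (2 + (- 1) * (x $ i))) = 0"
    by (intro prod_zero bexI[of _ i]) auto
  then show ?thesis unfolding cutoff_def by (simp only: of_real_0)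
qed

lemma cutoff_eq_1:
  assumes "norm x < 1"
  shows "cutoff x = 1"
proof -
  have "smooth_step (2 + 1 * (x $ i)) * smooth_step (2 + (- 1) * (x $ i)) = 1" for i
    using assms component_le_norm_cart[of x i] smooth_step_eq_1[of "2 + x $ i"] smooth_step_eq_1[of "2 - x $ i"] by simp
  then show ?thesis unfolding cutoff_def by simp
qed

context log_hoelder_exponent
begin

text \<open>The value \<open>T \<phi>\<close> is the integral of cell averages of \<open>\<phi> T\<close>; freezing \<open>\<phi>\<close> at \<open>x\<close> in the cell of \<open>x\<close>
  changes them by at most a constant times \<open>2\<^sup>-\<^sup>k\<close> times the grand maximal function.\<close>

lemma grid_average_converges:
  fixes \<phi> :: "real^'n \<Rightarrow> complex"
  assumes T: "T \<in> WHp p N" and \<phi>: "smooth \<phi>" "\<And>x. R < norm x \<Longrightarrow> \<phi> x = 0"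
  shows "(\<lambda>k. \<integral>x. grid_average T k x * \<phi> x \<partial>lebesgue) \<longlonglongrightarrow> T \<phi>"
proof -
  let ?n = "real CARD('n)"
  have Tt: "T \<in> tempered" and Tfin: "WHp_norm p N T < \<infinity>" using T by (auto simp: WHp_def)
  obtain l where l: "0 < l" "WHp_norm p N T < ennreal l"
  proof -
    obtain r where "WHp_norm p N T = ennreal r" "0 \<le> r" using Tfin by (cases "WHp_norm p N T") auto
    then show ?thesis using that[of "r + 1"] by (simp add: ennreal_less_iff)
  qed
  obtain B where B: "0 < B"
    "\<forall>T (g :: real^'n \<Rightarrow> complex) x k M. T \<in> tempered \<longrightarrow> smooth g \<longrightarrow> 0 < M \<longrightarrow>
       (\<forall>js z. length js \<le> N \<longrightarrow> norm z \<le> 3 * ?n \<longrightarrow> norm (pd js (\<lambda>z. g (x + (- 1 / 2 ^ k) *\<^sub>R z)) z) \<le> M) \<longrightarrow>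
       ennreal (norm (2 ^ (k * CARD('n)) * T (\<lambda>y. g y * grid_bump k (grid_index k x) y))) \<le> ennreal (B * M) * grand_maximal N T x"
    using grid_bump_grand_maximal[where 'n='n and N=N] by blast
  obtain C where C: "0 < C"
    "\<And>js x z k. length js \<le> N \<Longrightarrow> norm z \<le> 3 * real CARD('n) \<Longrightarrow>
       norm (pd js (\<lambda>z. \<phi> (x + (- 1 / 2 ^ k) *\<^sub>R z) - \<phi> x) z) \<le> C / 2 ^ k"
    by (rule local_variation_bound[OF \<phi>, where N = N]) (assumption, rule that)
  define G where "G = (\<lambda>k x. 2 ^ (k * CARD('n)) * T (\<lambda>y. \<phi> y * grid_bump k (grid_index k x) y))"
  define D where "D = (\<lambda>k x. G k x - grid_average T k x * \<phi> x)"
  have Gint: "has_bochner_integral lebesgue (G k) (T \<phi>)" for k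
    unfolding G_def by (rule grid_sum_has_integral[OF Tt \<phi>])
  have \<phi>m[measurable]: "\<phi> \<in> borel_measurable lebesgue" by (rule smooth_measurable[OF \<phi>(1)])
  have Gm[measurable]: "G k \<in> borel_measurable lebesgue" for k using Gint[of k] by (auto dest: has_bochner_integral_integrable)
  note grid_average_measurable[measurable]
  have Dm[measurable]: "D k \<in> borel_measurable lebesgue" for k unfolding D_def by measurable
  have S: "(\<lambda>y. \<phi> y * grid_bump k q y) \<in> schwartz" for k q
    by (rule schwartz_compact_support[OF smooth_mult[OF \<phi>(1) smooth_grid_bump], where R = R]) (simp add: \<phi>(2))
  have D_eq: "D k x = 2 ^ (k * CARD('n)) * T (\<lambda>y. (\<phi> y - \<phi> x) * grid_bump k (grid_index k x) y)" for k x
  proof -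
    have "T (\<lambda>y. \<phi> y * grid_bump k (grid_index k x) y - \<phi> x * grid_bump k (grid_index k x) y) =
       T (\<lambda>y. \<phi> y * grid_bump k (grid_index k x) y) - \<phi> x * T (grid_bump k (grid_index k x))"
      unfolding tempered_diff[OF Tt S schwartz_cmult[OF grid_bump_schwartz]] tempered_cmult[OF Tt grid_bump_schwartz] ..
    then show ?thesis by (simp add: D_def G_def grid_average_def left_diff_distrib right_diff_distrib mult_ac)
  qed
  have D_le: "ennreal (norm (D k x)) \<le> ennreal (B * (C / 2 ^ k)) * grand_maximal N T x" for k x
    unfolding D_eq
    by (rule B(2)[rule_format, OF Tt smooth_diff[OF \<phi>(1) smooth_const]]) (use C in auto)
  define K where "K = B * C"
  have K: "0 < K" using B C by (simp add: K_def)
  \<comment> \<open>The rescaled error is measurable and lies below the grand maximal function for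
    every \<open>k\<close>. Its weak norm is thus bounded uniformly, and the factor
    \<open>K / 2 ^ k\<close> remains for the integral of \<open>D k\<close>.\<close>
  define d where "d = (\<lambda>k x. ennreal (2 ^ k / K * norm (D k x)))"
  have dm[measurable]: "d k \<in> borel_measurable lebesgue" for k unfolding d_def by measurable
  have d_le: "d k x \<le> 1 * grand_maximal N T x" for k x
  proof -
    have "d k x = ennreal (2 ^ k / K) * ennreal (norm (D k x))"
      unfolding d_def using K by (intro ennreal_mult) auto
    also have "\<dots> \<le> ennreal (2 ^ k / K) * (ennreal (B * (C / 2 ^ k)) * grand_maximal N T x)"
      by (intro mult_left_mono D_le) simp
    also have "\<dots> = ennreal (2 ^ k / K * (B * (C / 2 ^ k))) * grand_maximal N T x"
      using B(1) C(1) K by (subst ennreal_mult) (auto simp: mult_ac)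
    also have "2 ^ k / K * (B * (C / 2 ^ k)) = 1" using B C K by (simp add: K_def)
    finally show ?thesis by simp
  qed
  \<comment> \<open>The constant of \<open>weak_bounded_weighted\<close> for the indicator of a ball
    that contains the supports of all \<open>D k\<close>.\<close>
  define V where "V = unit_ball_vol ?n * (\<bar>R\<bar> + 3 * ?n) ^ CARD('n) + layer_const"
  have V: "0 \<le> V" using layer_const_pos less_imp_le[OF unit_ball_vol_card_pos[where 'n='n]] by (simp add: V_def)
  have supp: "D k x = 0" if x: "\<bar>R\<bar> + 3 * ?n < norm x" for k x
  proof -
    have "\<phi> y * grid_bump k (grid_index k x) y = 0" for y
    proof (rule ccontr)
      assume *: "\<phi> y * grid_bump k (grid_index k x) y \<noteq> 0"
      then have "norm (x - y) \<le> 3 * ?n / 2 ^ k" by (intro grid_bump_grid_index) auto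
      also have "\<dots> \<le> 3 * ?n" by (simp add: divide_le_eq mult_le_cancel_left1)
      finally have "norm (x - y) \<le> 3 * ?n" .
      moreover have "norm y \<le> R" using * \<phi>(2)[of y] by force
      ultimately show False using x norm_triangle_sub[of x y] by linarith
    qed
    then have eq: "(\<lambda>y. \<phi> y * grid_bump k (grid_index k x) y) = (\<lambda>_. 0)" by (rule ext)
    have "\<phi> x = 0" using x \<phi>(2)[of x] by simp
    then show ?thesis unfolding D_def G_def eq by (simp add: tempered_zero[OF Tt])
  qed
  have Dint: "(\<integral>\<^sup>+x. ennreal (norm (D k x)) \<partial>lebesgue) \<le> ennreal (K * l * V / 2 ^ k)" for k
  proof -
    have "WLp_norm_nn p (d k) \<le> ennreal 1 * WHp_norm p N T"
      unfolding WHp_norm_def by (rule WLp_norm_nn_mono[OF _ _ p_pos]) (use d_le in auto)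
    then have "WLp_norm_nn p (d k) < ennreal l" using l(2) by simp
    from weak_boundedI[OF dm this l(1)] have wb: "weak_bounded (\<lambda>x. d k x / ennreal l)" .
    let ?B = "cball (0 :: real^'n) (\<bar>R\<bar> + 3 * ?n)"
    have [measurable]: "?B \<in> sets lebesgue" by simp
    have "(\<integral>\<^sup>+x. ennreal (norm (D k x)) \<partial>lebesgue) = (\<integral>\<^sup>+x. ennreal (K * l / 2 ^ k) * (d k x / ennreal l * indicator ?B x) \<partial>lebesgue)"
    proof (rule nn_integral_cong)
      fix x
      show "ennreal (norm (D k x)) = ennreal (K * l / 2 ^ k) * (d k x / ennreal l * indicator ?B x)"
        using K l(1) supp[of x k] by (cases "x \<in> ?B") (simp_all add: d_def divide_ennreal flip: ennreal_mult)
    qed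
    also have "\<dots> = ennreal (K * l / 2 ^ k) * (\<integral>\<^sup>+x. d k x / ennreal l * indicator ?B x \<partial>lebesgue)"
      by (rule nn_integral_cmult) measurable
    also have "\<dots> \<le> ennreal (K * l / 2 ^ k) * ((\<integral>\<^sup>+x. indicator ?B x \<partial>lebesgue) + ennreal layer_const)"
      by (intro mult_left_mono weak_bounded_weighted wb borel_measurable_indicator) (auto simp: indicator_def)
    also have "(\<integral>\<^sup>+x. indicator ?B x \<partial>lebesgue) + ennreal layer_const = ennreal V"
      unfolding V_def using layer_const_pos less_imp_le[OF unit_ball_vol_card_pos[where 'n='n]]
      by (simp add: emeasure_lborel_cball_vec ennreal_plus)
    also have "ennreal (K * l / 2 ^ k) * ennreal V = ennreal (K * l * V / 2 ^ k)"
      using K l(1) V by (simp flip: ennreal_mult)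
    finally show ?thesis .
  qed
  have Di: "integrable lebesgue (D k)" for k
    by (rule integrableI_bounded[OF Dm]) (rule le_less_trans[OF Dint], simp)
  have Dnorm: "norm (\<integral>x. D k x \<partial>lebesgue) \<le> K * l * V / 2 ^ k" for k
  proof -
    have "ennreal (norm (\<integral>x. D k x \<partial>lebesgue)) \<le> ennreal (K * l * V / 2 ^ k)"
      by (rule order_trans[OF integral_norm_bound_ennreal[OF Di] Dint])
    then show ?thesis using K l(1) V by (subst (asm) ennreal_le_iff) auto
  qed
  have "(\<integral>x. grid_average T k x * \<phi> x \<partial>lebesgue) = T \<phi> - (\<integral>x. D k x \<partial>lebesgue)" for k
  proof -
    have "(\<lambda>x. grid_average T k x * \<phi> x) = (\<lambda>x. G k x - D k x)" by (simp add: D_def)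
    then show ?thesis
      using Gint[of k] Bochner_Integration.integral_diff[of lebesgue "G k" "D k"] Di[of k]
      by (simp add: has_bochner_integral_iff)
  qed
  moreover have "(\<lambda>k. \<integral>x. D k x \<partial>lebesgue) \<longlonglongrightarrow> 0"
  proof (rule Lim_null_comparison)
    show "\<forall>\<^sub>F k in sequentially. norm (\<integral>x. D k x \<partial>lebesgue) \<le> K * l * V * (1 / 2) ^ k"
      using Dnorm by (simp add: power_one_over)
    show "(\<lambda>k. K * l * V * (1 / 2) ^ k) \<longlonglongrightarrow> 0"
      by (intro tendsto_mult_right_zero LIMSEQ_power_zero) simp
  qed
  ultimately show ?thesis using tendsto_diff[OF tendsto_const, of "\<lambda>k. \<integral>x. D k x \<partial>lebesgue" 0 sequentially "T \<phi>"] by simp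
qed

end

section \<open>Uniqueness of the inducing function\<close>

lemma box_integrals_zero_imp_AE:
  fixes d :: "real^'n \<Rightarrow> complex"
  assumes loc: "\<And>a b. set_integrable lebesgue (box a b) d"
    and zero: "\<And>a b. (LINT x:box a b|lebesgue. d x) = 0"
  shows "AE x in lebesgue. d x = 0"
proof -
  \<comment> \<open>On a box, \<open>d\<close> is integrable. Open boxes are stable under
    intersection and generate the Borel sets, so vanishing integrals over boxes extend to all Borel
    sets by a Dynkin argument.\<close>
  have main: "AE x in lebesgue. indicator C x *\<^sub>R d x = 0" if Cbox: "C = box a b" for a b C
  proof -
    have C: "set_integrable lebesgue C d" unfolding Cbox by (rule loc)
    have Cm[measurable]: "C \<in> sets lebesgue" by (simp add: Cbox)
    let ?D = "\<lambda>x. indicator C x *\<^sub>R d x"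
    have D: "integrable lebesgue ?D" using C unfolding set_integrable_def .
    have DA: "integrable lebesgue (\<lambda>x. indicator A x *\<^sub>R ?D x)" if "A \<in> sets lebesgue" for A
      by (rule integrable_mult_indicator[OF that D])
    let ?G = "range (\<lambda>(a, b). box a b :: (real^'n) set)"
    have stable: "Int_stable ?G" by (auto simp: Int_stable_def box_Int_box)
    have sub: "?G \<subseteq> Pow UNIV" by simp
    have sigma: "A \<in> sets lebesgue" if "A \<in> sigma_sets UNIV ?G" for A
    proof -
      have "A \<in> sets borel" unfolding borel_eq_box using that by (simp add: sets_measure_of)
      then show ?thesis by simp
    qed
    have borel: "(\<integral>x. indicator A x *\<^sub>R ?D x \<partial>lebesgue) = 0" if "A \<in> sigma_sets UNIV ?G" for A
      using stable sub that
    proof (induction rule: sigma_sets_induct_disjoint)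
      case (basic A)
      then obtain c e where A: "A = box c e" by auto
      obtain c' e' where "box c e \<inter> box a b = box c' e'" by (auto simp: box_Int_box)
      then have "indicator A x *\<^sub>R ?D x = indicator (box c' e') x *\<^sub>R d x" for x
        by (auto simp: A Cbox indicator_def)
      then have eq: "(\<integral>x. indicator A x *\<^sub>R ?D x \<partial>lebesgue) = (\<integral>x. indicator (box c' e') x *\<^sub>R d x \<partial>lebesgue)"
        by (rule Bochner_Integration.integral_cong[OF refl])
      show ?case unfolding eq using zero[of c' e'] unfolding set_lebesgue_integral_def .
    next
      case empty
      show ?case by simp
    next
      case (compl A)
      then have A: "A \<in> sets lebesgue" by (intro sigma)
      have e1: "(\<integral>x. ?D x \<partial>lebesgue) = 0" using zero[of a b] by (simp add: set_lebesgue_integral_def Cbox)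
      have e2: "(\<integral>x. indicator (UNIV - A) x *\<^sub>R ?D x \<partial>lebesgue) = (\<integral>x. ?D x - indicator A x *\<^sub>R ?D x \<partial>lebesgue)"
        by (intro Bochner_Integration.integral_cong) (auto simp: indicator_def)
      show ?case
        unfolding e2 Bochner_Integration.integral_diff[OF D DA[OF A]] e1 compl.IH by simp
    next
      case (union A)
      have A: "A i \<in> sets lebesgue" for i
        by (rule sigma) (use union in auto)
      have "(\<lambda>n. \<integral>x. indicator (\<Union>i<n. A i) x *\<^sub>R ?D x \<partial>lebesgue) \<longlonglongrightarrow> (\<integral>x. indicator (\<Union>i. A i) x *\<^sub>R ?D x \<partial>lebesgue)"
      proof (rule integral_dominated_convergence[where w="\<lambda>x. norm (?D x)"])
        show "AE x in lebesgue. (\<lambda>n. indicator (\<Union>i<n. A i) x *\<^sub>R ?D x) \<longlonglongrightarrow> indicator (\<Union>i. A i) x *\<^sub>R ?D x"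
          by (intro AE_I2 tendsto_scaleR tendsto_const LIMSEQ_indicator_UN)
        show "(\<lambda>x. indicator (\<Union>i. A i) x *\<^sub>R ?D x) \<in> borel_measurable lebesgue"
          by (intro borel_measurable_integrable DA sets.countable_UN) (use A in blast)
        show "(\<lambda>x. indicator (\<Union>i<n. A i) x *\<^sub>R ?D x) \<in> borel_measurable lebesgue" for n
          by (intro borel_measurable_integrable DA sets.finite_UN A) simp
        show "integrable lebesgue (\<lambda>x. norm (?D x))" by (rule integrable_norm[OF D])
      qed (auto simp: indicator_def)
      moreover have "(\<integral>x. indicator (\<Union>i<n. A i) x *\<^sub>R ?D x \<partial>lebesgue) = 0" for n
      proof -
        have "(indicator (\<Union>i<n. A i) x :: real) = (\<Sum>i<n. indicator (A i) x)" for x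
          by (rule indicator_UN_disjoint) (use union in \<open>auto simp: disjoint_family_on_def\<close>)
        then have "(\<integral>x. indicator (\<Union>i<n. A i) x *\<^sub>R ?D x \<partial>lebesgue) = (\<integral>x. (\<Sum>i<n. indicator (A i) x *\<^sub>R ?D x) \<partial>lebesgue)"
          by (intro Bochner_Integration.integral_cong refl) (simp only: scaleR_sum_left)
        also have "\<dots> = (\<Sum>i<n. \<integral>x. indicator (A i) x *\<^sub>R ?D x \<partial>lebesgue)"
          by (rule Bochner_Integration.integral_sum) (rule DA[OF A])
        also have "\<dots> = 0" using union by (intro sum.neutral) blast
        finally show ?thesis .
      qed
      ultimately show ?case by (simp add: LIMSEQ_const_iff)
    qed
    show ?thesis
    proof (rule sigma_finite_measure.density_zero[OF sigma_finite_lebesgue D])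
      fix A :: "(real^'n) set" assume "A \<in> sets lebesgue"
      \<comment> \<open>A Lebesgue set is a Borel set up to part of a null set, which does not
        affect the integral.\<close>
      then obtain S N N' where A: "A = S \<union> N" "N \<subseteq> N'" "N' \<in> null_sets lborel" "S \<in> sets lborel"
        by (rule sets_completionE)
      have "AE x in lebesgue. x \<notin> N'"
        using A(3) by (intro AE_not_in) (simp add: null_sets_completionI)
      then have "AE x in lebesgue. indicator A x *\<^sub>R ?D x = indicator S x *\<^sub>R ?D x"
        by eventually_elim (use A in \<open>auto simp: indicator_def\<close>)
      moreover have "A \<in> sets lebesgue" "S \<in> sets lebesgue" using \<open>A \<in> sets lebesgue\<close> A(4) by (auto intro: sets_completionI_sets)
      ultimately have "(\<integral>x. indicator A x *\<^sub>R ?D x \<partial>lebesgue) = (\<integral>x. indicator S x *\<^sub>R ?D x \<partial>lebesgue)"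
        by (intro integral_cong_AE borel_measurable_integrable DA)
      also have "\<dots> = 0"
        by (rule borel) (use A(4) in \<open>simp add: borel_eq_box sets_measure_of\<close>)
      finally show "set_lebesgue_integral lebesgue A ?D = 0" by (simp add: set_lebesgue_integral_def)
    qed
  qed
  \<comment> \<open>Countably many boxes around the origin exhaust the space.\<close>
  have "AE x in lebesgue. \<forall>m::nat. indicator (box (\<chi> i. - real m) (\<chi> i. real m)) x *\<^sub>R d x = 0"
    unfolding AE_all_countable using main by blast
  then show ?thesis
  proof eventually_elim
    case (elim x)
    obtain m :: nat where "norm x < real m" using reals_Archimedean2 by blast
    then have "x \<in> box (\<chi> i. - real m) (\<chi> i. real m)"
      using component_le_norm_cart[of x] by (auto simp: mem_box_cart abs_less_iff intro: le_less_trans) (smt (verit))+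
    with elim[rule_format, of m] show ?case by simp
  qed
qed

text \<open>A compressed step tends to the indicator of \<open>c < t\<close>, with value 0 at
  \<open>t = c\<close>; this is why the limit interval is open at \<open>a\<close> and closed at
  \<open>b\<close>.\<close>

lemma smooth_step_box_limit:
  assumes "a < b"
  shows "(\<lambda>k. smooth_step (- real (Suc k) * a + real (Suc k) * t) - smooth_step (- real (Suc k) * b + real (Suc k) * t))
    \<longlonglongrightarrow> of_bool (a < t \<and> t \<le> b)"
proof -
  have step: "(\<lambda>k. smooth_step (- real (Suc k) * c + real (Suc k) * t)) \<longlonglongrightarrow> of_bool (c < t)" for c
  proof (cases "c < t")
    case True
    obtain k0 :: nat where k0: "1 < real k0 * (t - c)" using reals_Archimedean3[of "t - c"] True by auto
    have "smooth_step (- real (Suc k) * c + real (Suc k) * t) = 1" if "k0 \<le> k" for k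
    proof (rule smooth_step_eq_1)
      have "real k0 * (t - c) \<le> real (Suc k) * (t - c)" using that True by (intro mult_right_mono) auto
      with k0 show "1 \<le> - real (Suc k) * c + real (Suc k) * t" by (simp add: algebra_simps)
    qed
    then show ?thesis using True by (intro tendsto_eventually) (auto simp: eventually_sequentially)
  next
    case False
    have "smooth_step (- real (Suc k) * c + real (Suc k) * t) = 0" for k
    proof (rule smooth_step_eq_0)
      have "real (Suc k) * (t - c) \<le> 0" using False by (intro mult_nonneg_nonpos) auto
      then show "- real (Suc k) * c + real (Suc k) * t \<le> 0" by (simp add: algebra_simps)
    qed
    then show ?thesis using False by simp
  qed
  have "(of_bool (a < t \<and> t \<le> b) :: real) = of_bool (a < t) - of_bool (b < t)" using assms by auto
  then show ?thesis using tendsto_diff[OF step[of a] step[of b]] by simp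
qed

text \<open>Products of compressed steps are Schwartz functions bounded by 1, supported in one box
  and converging to the indicator of a half-open box. Dominated convergence then gives vanishing
  integrals over boxes.\<close>

lemma schwartz_annihilator_AE_zero:
  fixes d :: "real^'n \<Rightarrow> complex"
  assumes loc: "\<And>K. compact K \<Longrightarrow> d absolutely_integrable_on K"
    and dm: "d \<in> borel_measurable lebesgue"
    and zero: "\<And>\<phi>. \<phi> \<in> schwartz \<Longrightarrow> (\<integral>x. d x * \<phi> x \<partial>lebesgue) = 0"
  shows "AE x in lebesgue. d x = 0"
proof (rule box_integrals_zero_imp_AE)
  fix a b :: "real^'n"
  show "set_integrable lebesgue (box a b) d"
    by (rule set_integrable_subset[OF loc[OF compact_cbox] _ box_subset_cbox]) simp
  show "(LINT x:box a b|lebesgue. d x) = 0"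
  proof (cases "\<forall>i. a $ i < b $ i")
    case False
    then have "box a b = {}" by (auto simp: interval_eq_empty_cart not_less)
    then show ?thesis by (simp add: set_lebesgue_integral_def)
  next
    case True
    define u where "u = (\<lambda>k i t. smooth_step (- real (Suc k) * a $ i + real (Suc k) * t) - smooth_step (- real (Suc k) * b $ i + real (Suc k) * t))"
    define \<phi> where "\<phi> = (\<lambda>k (x :: real^'n). complex_of_real (\<Prod>i\<in>UNIV. u k i (x $ i)))"
    have u1: "\<bar>u k i t\<bar> \<le> 1" for k i t
      using smooth_step_nonneg smooth_step_le_1 unfolding u_def by (smt (verit))
    have u0: "u k i t = 0" if "t < a $ i \<or> b $ i + 1 < t" for k i t
    proof -
      have ab: "a $ i < b $ i" using True by simp
      have *: "- real (Suc k) * c + real (Suc k) * t = real (Suc k) * (t - c)" for c by (simp add: algebra_simps)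
      show ?thesis
      proof (cases "t < a $ i")
        case True
        then have "real (Suc k) * (t - a $ i) \<le> 0" "real (Suc k) * (t - b $ i) \<le> 0"
          using ab by (auto intro!: mult_nonneg_nonpos)
        then show ?thesis unfolding u_def * by (simp only: smooth_step_eq_0)
      next
        case False
        with that have t: "1 \<le> t - a $ i" "1 \<le> t - b $ i" using ab by auto
        have "1 * 1 \<le> real (Suc k) * (t - a $ i)" "1 * 1 \<le> real (Suc k) * (t - b $ i)"
          using t by (intro mult_mono; simp)+
        then show ?thesis unfolding u_def * by (simp only: smooth_step_eq_1)
      qed
    qed
    have su: "times_deriv n (u k i)" for n k i
    proof -
      have "times_deriv n (\<lambda>t. smooth_step (- real (Suc k) * a $ i + real (Suc k) * t) + (- 1) * smooth_step (- real (Suc k) * b $ i + real (Suc k) * t))"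
        by (intro times_deriv_add times_deriv_cmult times_deriv_affine times_deriv_smooth_step)
      then show ?thesis by (simp add: u_def)
    qed
    have s\<phi>: "smooth (\<phi> k)" for k
      unfolding \<phi>_def by (rule smooth_prod_coordinates) (rule su)
    \<comment> \<open>Each step has reached 1 at distance \<open>1 / Suc k \<le> 1\<close> to the
      right of its corner, so this box serves all \<open>k\<close>. The \<open>1\<close> here is the
      vector of ones.\<close>
    let ?B = "cbox a (b + 1)"
    have supp: "\<phi> k x = 0" if "x \<notin> ?B" for k x
    proof -
      have "\<exists>i. x $ i < a $ i \<or> b $ i + 1 < x $ i"
      proof (rule ccontr)
        assume "\<nexists>i. x $ i < a $ i \<or> b $ i + 1 < x $ i"
        then have "a $ i \<le> x $ i \<and> x $ i \<le> b $ i + 1" for i by (meson not_le)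
        with that show False by (simp add: mem_box_cart)
      qed
      then obtain i where "x $ i < a $ i \<or> b $ i + 1 < x $ i" ..
      then have "(\<Prod>i\<in>UNIV. u k i (x $ i)) = 0" using u0 by (intro prod_zero bexI[of _ i]) auto
      then show ?thesis unfolding \<phi>_def by (simp only: of_real_0)
    qed
    have \<phi>1: "norm (\<phi> k x) \<le> 1" for k x
      unfolding \<phi>_def norm_of_real abs_prod by (intro prod_le_1) (auto simp: u1)
    obtain R where R: "\<And>x. x \<in> ?B \<Longrightarrow> norm x \<le> R" using bounded_cbox[of a "b + 1"] unfolding bounded_iff by blast
    have \<phi>s: "\<phi> k \<in> schwartz" for k
      by (rule schwartz_compact_support[OF s\<phi>, where R = R]) (use supp R in fastforce)
    let ?H = "{x :: real^'n. \<forall>i. a $ i < x $ i \<and> x $ i \<le> b $ i}"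
    have \<phi>lim: "(\<lambda>k. \<phi> k x) \<longlonglongrightarrow> indicator ?H x" for x
    proof -
      have "(\<lambda>k. \<Prod>i\<in>UNIV. u k i (x $ i)) \<longlonglongrightarrow> (\<Prod>i\<in>UNIV. of_bool (a $ i < x $ i \<and> x $ i \<le> b $ i))"
        unfolding u_def by (intro tendsto_prod smooth_step_box_limit) (use True in auto)
      also have "(\<Prod>i\<in>UNIV. of_bool (a $ i < x $ i \<and> x $ i \<le> b $ i)) = (indicator ?H x :: real)"
      proof (cases "x \<in> ?H")
        case False
        then obtain i where "\<not> (a $ i < x $ i \<and> x $ i \<le> b $ i)" by auto
        then have "(\<Prod>i\<in>UNIV. of_bool (a $ i < x $ i \<and> x $ i \<le> b $ i) :: real) = 0"
          by (intro prod_zero bexI[of _ i]) auto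
        with False show ?thesis by simp
      qed simp
      finally have "(\<lambda>k. complex_of_real (\<Prod>i\<in>UNIV. u k i (x $ i))) \<longlonglongrightarrow> complex_of_real (indicator ?H x)"
        by (rule tendsto_of_real)
      moreover have "complex_of_real (indicator ?H x) = indicator ?H x" by (simp add: indicator_def)
      ultimately show ?thesis unfolding \<phi>_def by (simp only:)
    qed
    have box_H: "box a b \<subseteq> ?H" "?H \<subseteq> cbox a b" by (auto simp: mem_box_cart less_imp_le)
    \<comment> \<open>The half-open limit box and the open box differ by part of a frontier of
      measure zero.\<close>
    have null: "AE x in lebesgue. x \<notin> cbox a b - box a b"
      using negligible_frontier_interval[of a b] by (intro AE_not_in) (simp add: negligible_iff_null_sets)
    have AEH: "AE x in lebesgue. (\<lambda>k. d x * \<phi> k x) \<longlonglongrightarrow> indicator (box a b) x *\<^sub>R d x"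
      using null
    proof eventually_elim
      case (elim x)
      then have "d x * indicator ?H x = indicator (box a b) x *\<^sub>R d x" using box_H by (auto simp: indicator_def)
      with tendsto_mult_left[OF \<phi>lim[of x], of "d x"] show ?case by simp
    qed
    have "(\<lambda>k. \<integral>x. d x * \<phi> k x \<partial>lebesgue) \<longlonglongrightarrow> (\<integral>x. indicator (box a b) x *\<^sub>R d x \<partial>lebesgue)"
    proof (rule integral_dominated_convergence[OF _ _ _ AEH, where w="\<lambda>x. norm (indicator ?B x *\<^sub>R d x)"])
      show "integrable lebesgue (\<lambda>x. norm (indicator ?B x *\<^sub>R d x))"
        using loc[OF compact_cbox[of a "b + 1"]] unfolding set_integrable_def by (rule integrable_norm)
      show "AE x in lebesgue. norm (d x * \<phi> k x) \<le> norm (indicator ?B x *\<^sub>R d x)" for k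
      proof (rule AE_I2)
        fix x
        show "norm (d x * \<phi> k x) \<le> norm (indicator ?B x *\<^sub>R d x)"
          using supp[of x k] mult_left_mono[OF \<phi>1[of k x], of "norm (d x)"]
          by (cases "x \<in> ?B") (auto simp: norm_mult)
      qed
      show "(\<lambda>x. d x * \<phi> k x) \<in> borel_measurable lebesgue" for k
        by (intro borel_measurable_times dm smooth_measurable s\<phi>)
      show "(\<lambda>x. indicator (box a b) x *\<^sub>R d x) \<in> borel_measurable lebesgue"
        by (intro borel_measurable_scaleR dm borel_measurable_indicator) simp
    qed
    then show ?thesis using zero[OF \<phi>s] by (simp add: set_lebesgue_integral_def LIMSEQ_const_iff)
  qed
qed

context log_hoelder_exponent
begin

lemma induces_unique:
  assumes "f \<in> WLp p" "g \<in> WLp p" "induces f T" "induces g T"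
  shows "AE x in lebesgue. f x = g x"
proof -
  have "AE x in lebesgue. f x - g x = 0"
  proof (rule schwartz_annihilator_AE_zero)
    show "(\<lambda>x. f x - g x) \<in> borel_measurable lebesgue"
      using assms by (intro borel_measurable_diff) (auto simp: WLp_def)
    show "(\<lambda>x. f x - g x) absolutely_integrable_on K" if "compact K" for K
      using that assms unfolding induces_def by (intro set_integral_diff) auto
    show "(\<integral>x. (f x - g x) * \<phi> x \<partial>lebesgue) = 0" if "\<phi> \<in> schwartz" for \<phi>
      using that assms unfolding induces_def left_diff_distrib
      by (subst Bochner_Integration.integral_diff) auto
  qed
  then show ?thesis by simp
qed

text \<open>Real and imaginary parts of the step functions, multiplied by the polynomial weight,
  have weak limits by domination; dividing by the weight yields \<open>f\<close>. Convergence to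
  \<open>T\<close> on compactly supported functions identifies \<open>f\<close>, and cutoffs extend
  the identity to all Schwartz functions.\<close>

lemma WHp_induced:
  "\<exists>C>0. \<forall>T\<in>WHp p N. \<exists>f\<in>WLp p. induces f T \<and> WLp_norm p f \<le> ennreal C * WHp_norm p N T"
proof -
  let ?n = "real CARD('n)"
  let ?w = "polynomial_weight"
  obtain B where B: "0 < B"
    "\<forall>T (g :: real^'n \<Rightarrow> complex) x k M. T \<in> tempered \<longrightarrow> smooth g \<longrightarrow> 0 < M \<longrightarrow>
       (\<forall>js z. length js \<le> N \<longrightarrow> norm z \<le> 3 * ?n \<longrightarrow> norm (pd js (\<lambda>z. g (x + (- 1 / 2 ^ k) *\<^sub>R z)) z) \<le> M) \<longrightarrow>
       ennreal (norm (2 ^ (k * CARD('n)) * T (\<lambda>y. g y * grid_bump k (grid_index k x) y))) \<le> ennreal (B * M) * grand_maximal N T x"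
    using grid_bump_grand_maximal[where 'n='n and N=N] by blast
  have "\<exists>f\<in>WLp p. induces f T \<and> WLp_norm p f \<le> ennreal (2 * B) * WHp_norm p N T" if T: "T \<in> WHp p N" for T
  proof -
    have Tt: "T \<in> tempered" and Tfin: "WHp_norm p N T < \<infinity>" using T by (auto simp: WHp_def)
    \<comment> \<open>A countable supremum is measurable, so \<open>g\<close> can play the role of a
      dominating function, and its weak norm is bounded by that of the grand maximal
      function.\<close>
    define g where "g = (\<lambda>x. SUP k. ennreal (norm (grid_average T k x)))"
    note grid_average_measurable[measurable]
    have gm[measurable]: "g \<in> borel_measurable lebesgue" unfolding g_def by measurable
    have ge: "ennreal (norm (grid_average T k x)) \<le> g x" for k x unfolding g_def by (rule SUP_upper) simp
    have g_le: "g x \<le> ennreal B * grand_maximal N T x" for x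
      unfolding g_def
    proof (rule SUP_least)
      fix k
      have "ennreal (norm (2 ^ (k * CARD('n)) * T (\<lambda>y. 1 * grid_bump k (grid_index k x) y))) \<le> ennreal (B * 1) * grand_maximal N T x"
        by (rule B(2)[rule_format, OF Tt smooth_const[of 1]]) (simp_all add: pd_const)
      then show "ennreal (norm (grid_average T k x)) \<le> ennreal B * grand_maximal N T x"
        by (simp add: grid_average_def)
    qed
    have gW: "WLp_norm_nn p g \<le> ennreal B * WHp_norm p N T"
      unfolding WHp_norm_def by (rule WLp_norm_nn_mono[OF _ B(1) p_pos]) (use g_le in auto)
    then have "WLp_norm_nn p g < \<infinity>" using Tfin by (auto simp: ennreal_mult_less_top intro: le_less_trans)
    then obtain r where "WLp_norm_nn p g = ennreal r" "0 \<le> r" by (cases "WLp_norm_nn p g") auto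
    then have l: "0 < r + 1" "WLp_norm_nn p g < ennreal (r + 1)" by (auto simp: ennreal_less_iff)
    have wb: "weak_bounded (\<lambda>x. g x / ennreal (r + 1))" by (rule weak_boundedI[OF gm l(2,1)])
    have gfin: "AE x in lebesgue. g x < \<infinity>"
      using weak_bounded_finite[OF wb]
    proof eventually_elim
      case (elim x)
      then show ?case using l(1) by (cases "g x") (auto simp: ennreal_top_divide)
    qed
    define gr where "gr = (\<lambda>x. enn2real (g x))"
    have grm[measurable]: "gr \<in> borel_measurable lebesgue" unfolding gr_def by measurable
    have gr0: "0 \<le> gr x" for x by (simp add: gr_def)
    have w: "0 < ?w x" for x by (rule polynomial_weight_pos)
    define G where "G = (\<lambda>x. gr x * ?w x)"
    have Gm[measurable]: "G \<in> borel_measurable lebesgue" unfolding G_def by measurable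
    have G0: "0 \<le> G x" for x unfolding G_def using gr0 less_imp_le[OF w] by (intro mult_nonneg_nonneg)
    have Gint: "integrable lebesgue G"
    proof (rule integrableI_nonneg[OF Gm])
      have "(\<integral>\<^sup>+x. ennreal (G x) \<partial>lebesgue) \<le> (\<integral>\<^sup>+x. ennreal (r + 1) * (g x / ennreal (r + 1) * ennreal (?w x)) \<partial>lebesgue)"
      proof (rule nn_integral_mono)
        fix x
        show "ennreal (G x) \<le> ennreal (r + 1) * (g x / ennreal (r + 1) * ennreal (?w x))"
        proof (cases "g x")
          case (real s)
          then have "ennreal (G x) = ennreal (r + 1) * (ennreal (s / (r + 1)) * ennreal (?w x))"
            using l(1) less_imp_le[OF w[of x]] by (simp add: G_def gr_def del: power_Suc flip: ennreal_mult)
          then show ?thesis using real l(1) by (simp add: divide_ennreal)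
        qed (simp add: G_def gr_def)
      qed
      also have "\<dots> = ennreal (r + 1) * (\<integral>\<^sup>+x. g x / ennreal (r + 1) * ennreal (?w x) \<partial>lebesgue)"
        by (rule nn_integral_cmult) measurable
      also have "\<dots> < \<infinity>" using weak_bounded_polynomial_weight[OF wb] by (simp add: ennreal_mult_less_top)
      finally show "(\<integral>\<^sup>+x. ennreal (G x) \<partial>lebesgue) < \<infinity>" .
    qed (use G0 in auto)
    have ga: "norm (grid_average T k x) \<le> gr x" if "g x \<noteq> \<infinity>" for k x
    proof -
      have "ennreal (norm (grid_average T k x)) \<le> ennreal (gr x)"
        using ge[of k x] that by (simp add: gr_def less_top)
      then show ?thesis using gr0 by simp
    qed
    \<comment> \<open>The parameter \<rho> is \<open>Re\<close> or \<open>Im\<close>. The value 0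
      where \<open>g x = \<infinity>\<close> makes the bound by \<open>G\<close> hold at every
      point, since \<open>enn2real\<close> sends \<infinity> to 0.\<close>
    define h where "h = (\<lambda>\<rho> :: complex \<Rightarrow> real. \<lambda>k x. if g x = \<infinity> then 0 else \<rho> (grid_average T k x) * ?w x)"
    have hm: "h \<rho> k \<in> borel_measurable lebesgue" if [measurable]: "\<rho> \<in> borel_measurable borel" for \<rho> k
      unfolding h_def by measurable
    have hG: "\<bar>h \<rho> k x\<bar> \<le> G x" if "\<And>z. \<bar>\<rho> z\<bar> \<le> norm z" for \<rho> k x
      using ga[of x k] order_trans[OF that[of "grid_average T k x"], of "gr x"] G0[of x] less_imp_le[OF w[of x]]
      by (auto simp: h_def G_def abs_mult simp del: power_Suc intro!: mult_right_mono divide_right_mono)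
    obtain F1 H1 where F1: "F1 \<le> sequentially" "F1 \<noteq> bot" and H1: "H1 \<in> borel_measurable lebesgue" "AE x in lebesgue. \<bar>H1 x\<bar> \<le> G x"
      "\<And>u :: real^'n \<Rightarrow> complex. integrable (density lebesgue G) u \<Longrightarrow> ((\<lambda>k. \<integral>x. h Re k x *\<^sub>R u x \<partial>lebesgue) \<longlongrightarrow> (\<integral>x. H1 x *\<^sub>R u x \<partial>lebesgue)) F1"
      by (rule weak_limit_dominated[OF sigma_finite_lebesgue sequentially_bot Gint hm[of Re] hG[OF abs_Re_le_cmod], where 'c=complex])
        (simp, rule that)
    \<comment> \<open>The second limit is taken along a filter finer than \<open>F1\<close>, so real
      and imaginary parts converge together along \<open>F2\<close>.\<close>
    obtain F2 H2 where F2: "F2 \<le> F1" "F2 \<noteq> bot" and H2: "H2 \<in> borel_measurable lebesgue" "AE x in lebesgue. \<bar>H2 x\<bar> \<le> G x"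
      "\<And>u :: real^'n \<Rightarrow> complex. integrable (density lebesgue G) u \<Longrightarrow> ((\<lambda>k. \<integral>x. h Im k x *\<^sub>R u x \<partial>lebesgue) \<longlongrightarrow> (\<integral>x. H2 x *\<^sub>R u x \<partial>lebesgue)) F2"
      by (rule weak_limit_dominated[OF sigma_finite_lebesgue F1(2) Gint hm[of Im] hG[OF abs_Im_le_cmod], where 'c=complex])
        (simp, rule that)
    define f where "f = (\<lambda>x. (of_real (H1 x) + \<i> * of_real (H2 x)) / complex_of_real (?w x))"
    have fm: "f \<in> borel_measurable lebesgue" unfolding f_def using H1(1) H2(1) by measurable
    have f_le: "AE x in lebesgue. ennreal (norm (f x)) \<le> ennreal 2 * g x"
      using H1(2) H2(2) gfin
    proof eventually_elim
      case (elim x)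
      \<comment> \<open>Bounding the two parts separately produces the factor 2 in the constant
        \<open>2 * B\<close>.\<close>
      have "norm (of_real (H1 x) + \<i> * of_real (H2 x)) \<le> G x + G x"
        by (rule norm_triangle_mono) (use elim in \<open>auto simp: norm_mult\<close>)
      then have "norm (f x) \<le> (G x + G x) / ?w x"
        unfolding f_def norm_divide norm_of_real using w[of x] by (simp add: divide_right_mono del: power_Suc)
      also have "G x + G x = (2 * gr x) * ?w x" unfolding G_def by (simp only: mult_2 distrib_right)
      also have "\<dots> / ?w x = 2 * gr x" using w[of x] by (intro nonzero_mult_div_cancel_right) (rule less_imp_neq[symmetric])
      finally have "ennreal (norm (f x)) \<le> ennreal (2 * gr x)" by (rule ennreal_leI)
      also have "\<dots> = ennreal 2 * g x" using elim(3) gr0 by (simp add: ennreal_mult gr_def)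
      finally show ?case .
    qed
    have fW: "WLp_norm p f \<le> ennreal (2 * B) * WHp_norm p N T"
    proof -
      have "WLp_norm p f \<le> ennreal 2 * WLp_norm_nn p g"
        unfolding WLp_norm_def by (rule WLp_norm_nn_mono[OF f_le _ p_pos]) simp
      also have "\<dots> \<le> ennreal 2 * (ennreal B * WHp_norm p N T)" by (intro mult_left_mono gW) simp
      also have "\<dots> = ennreal (2 * B) * WHp_norm p N T" using B(1) by (simp add: ennreal_mult mult.assoc)
      finally show ?thesis .
    qed
    then have fWLp: "f \<in> WLp p" using fm Tfin by (auto simp: WLp_def ennreal_mult_less_top intro: le_less_trans)
    have compact_case: "T \<phi> = (\<integral>x. f x * \<phi> x \<partial>lebesgue)"
      if \<phi>: "smooth \<phi>" "\<And>x. R < norm x \<Longrightarrow> \<phi> x = 0" for \<phi> R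
    proof -
      \<comment> \<open>Division by the weight compensates its presence in \<open>h\<close>. The
        quotient stays bounded because \<phi> has compact support.\<close>
      define u where "u = (\<lambda>x. \<phi> x / complex_of_real (?w x))"
      have \<phi>m[measurable]: "\<phi> \<in> borel_measurable lebesgue" by (rule smooth_measurable[OF \<phi>(1)])
      have um[measurable]: "u \<in> borel_measurable lebesgue" unfolding u_def by measurable
      obtain M where M: "0 \<le> M" "\<And>js x. length js \<le> 0 \<Longrightarrow> norm (pd js \<phi> x) \<le> M"
        by (rule pd_compact_support_bounded[OF \<phi>, where N = 0]) (assumption, rule that)
      have u_le: "norm (u x) \<le> M * (1 + \<bar>R\<bar>) ^ Suc CARD('n)" for x
      proof (cases "norm x \<le> \<bar>R\<bar>")
        case True
        have "norm (u x) = norm (\<phi> x) * (1 + norm x) ^ Suc CARD('n)"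
          unfolding u_def norm_divide norm_of_real using w[of x] by (simp del: power_Suc)
        also have "\<dots> \<le> M * (1 + \<bar>R\<bar>) ^ Suc CARD('n)"
          using M(2)[of "[]" x] M(1) True by (intro mult_mono power_mono) auto
        finally show ?thesis .
      next
        case False
        then have "\<phi> x = 0" using \<phi>(2)[of x] by simp
        then show ?thesis using M(1) by (simp add: u_def)
      qed
      have int: "integrable lebesgue (\<lambda>x. v x *\<^sub>R u x)" if "v \<in> borel_measurable lebesgue" "AE x in lebesgue. \<bar>v x\<bar> \<le> G x" for v
      proof (rule Bochner_Integration.integrable_bound[OF integrable_mult_left[OF Gint, of "M * (1 + \<bar>R\<bar>) ^ Suc CARD('n)"]])
        show "(\<lambda>x. v x *\<^sub>R u x) \<in> borel_measurable lebesgue" using that(1) by measurable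
        show "AE x in lebesgue. norm (v x *\<^sub>R u x) \<le> norm (G x * (M * (1 + \<bar>R\<bar>) ^ Suc CARD('n)))"
          using that(2)
        proof eventually_elim
          case (elim x)
          have "norm (v x *\<^sub>R u x) \<le> G x * (M * (1 + \<bar>R\<bar>) ^ Suc CARD('n))"
            unfolding norm_scaleR by (intro mult_mono elim u_le G0) simp
          also have "\<dots> \<le> norm \<dots>" by simp
          finally show ?case .
        qed
      qed
      have hint: "integrable lebesgue (\<lambda>x. h Re k x *\<^sub>R u x)" "integrable lebesgue (\<lambda>x. h Im k x *\<^sub>R u x)" for k
        using hm[of Re k] hm[of Im k] hG[OF abs_Re_le_cmod] hG[OF abs_Im_le_cmod] by (auto intro!: int)
      have "integrable lebesgue (\<lambda>x. G x *\<^sub>R u x)" using G0 by (intro int) auto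
      then have ud: "integrable (density lebesgue G) u"
        using G0 by (subst integrable_density) auto
      have "((\<lambda>k. (\<integral>x. h Re k x *\<^sub>R u x \<partial>lebesgue) + \<i> * (\<integral>x. h Im k x *\<^sub>R u x \<partial>lebesgue)) \<longlongrightarrow>
          (\<integral>x. H1 x *\<^sub>R u x \<partial>lebesgue) + \<i> * (\<integral>x. H2 x *\<^sub>R u x \<partial>lebesgue)) F2"
        by (intro tendsto_intros tendsto_mono[OF F2(1) H1(3)[OF ud]] H2(3)[OF ud])
      also have "(\<lambda>k. (\<integral>x. h Re k x *\<^sub>R u x \<partial>lebesgue) + \<i> * (\<integral>x. h Im k x *\<^sub>R u x \<partial>lebesgue)) =
         (\<lambda>k. \<integral>x. grid_average T k x * \<phi> x \<partial>lebesgue)"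
      proof
        fix k
        have "(\<integral>x. h Re k x *\<^sub>R u x \<partial>lebesgue) + \<i> * (\<integral>x. h Im k x *\<^sub>R u x \<partial>lebesgue) =
           (\<integral>x. h Re k x *\<^sub>R u x + \<i> * (h Im k x *\<^sub>R u x) \<partial>lebesgue)"
          using Bochner_Integration.integral_add[OF hint(1)[of k] integrable_mult_right[OF hint(2)[of k], of \<i>]]
          unfolding integral_mult_right_zero by (rule sym)
        also have "\<dots> = (\<integral>x. grid_average T k x * \<phi> x \<partial>lebesgue)"
        proof (rule integral_cong_AE)
          show "(\<lambda>x. h Re k x *\<^sub>R u x + \<i> * (h Im k x *\<^sub>R u x)) \<in> borel_measurable lebesgue"
            using Bochner_Integration.integrable_add[OF hint(1)[of k] integrable_mult_right[OF hint(2)[of k], of \<i>]]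
            by (rule borel_measurable_integrable)
          show "AE x in lebesgue. h Re k x *\<^sub>R u x + \<i> * (h Im k x *\<^sub>R u x) = grid_average T k x * \<phi> x"
            using gfin
          proof eventually_elim
            case (elim x)
            have "h Re k x *\<^sub>R u x + \<i> * (h Im k x *\<^sub>R u x) =
              (of_real (Re (grid_average T k x)) + \<i> * of_real (Im (grid_average T k x))) * (of_real (?w x) * u x)"
              using elim by (simp add: h_def scaleR_conv_of_real algebra_simps del: power_Suc)
            also have "of_real (?w x) * u x = \<phi> x"
            proof -
              have "complex_of_real (?w x) \<noteq> 0" using w[of x] by (metis less_irrefl of_real_eq_0_iff)
              then show ?thesis unfolding u_def times_divide_eq_right by (rule nonzero_mult_div_cancel_left)
            qed
            finally show ?case using complex_eq[of "grid_average T k x"] by simp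
          qed
        qed measurable
        finally show "(\<integral>x. h Re k x *\<^sub>R u x \<partial>lebesgue) + \<i> * (\<integral>x. h Im k x *\<^sub>R u x \<partial>lebesgue) = (\<integral>x. grid_average T k x * \<phi> x \<partial>lebesgue)" .
      qed
      also have "(\<integral>x. H1 x *\<^sub>R u x \<partial>lebesgue) + \<i> * (\<integral>x. H2 x *\<^sub>R u x \<partial>lebesgue) = (\<integral>x. H1 x *\<^sub>R u x + \<i> * (H2 x *\<^sub>R u x) \<partial>lebesgue)"
        using Bochner_Integration.integral_add[OF int[OF H1(1,2)] integrable_mult_right[OF int[OF H2(1,2)], of \<i>]]
        unfolding integral_mult_right_zero by (rule sym)
      also have "(\<lambda>x. H1 x *\<^sub>R u x + \<i> * (H2 x *\<^sub>R u x)) = (\<lambda>x. f x * \<phi> x)"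
        unfolding f_def u_def scaleR_conv_of_real
        by (simp only: distrib_right add_divide_distrib times_divide_eq_left times_divide_eq_right mult.assoc)
      finally have "((\<lambda>k. \<integral>x. grid_average T k x * \<phi> x \<partial>lebesgue) \<longlongrightarrow> (\<integral>x. f x * \<phi> x \<partial>lebesgue)) F2" .
      moreover have "((\<lambda>k. \<integral>x. grid_average T k x * \<phi> x \<partial>lebesgue) \<longlongrightarrow> T \<phi>) F2"
        using grid_average_converges[OF T \<phi>] tendsto_mono[OF order_trans[OF F2(1) F1(1)]] by blast
      ultimately show ?thesis using tendsto_unique[OF F2(2)] by blast
    qed
    have "T \<phi> = (\<integral>x. f x * \<phi> x \<partial>lebesgue)" if \<phi>: "\<phi> \<in> schwartz" for \<phi>
    proof -
      \<comment> \<open>Both sides are continuous for the convergence of these truncations: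
        \<open>T\<close> because it is tempered, the integral because one Schwartz seminorm controls
        it.\<close>
      define \<phi>' where "\<phi>' = (\<lambda>k x. \<phi> x * cutoff (x /\<^sub>R real (Suc k)))"
      have lim: "(\<lambda>k. schwartz_norm m (\<lambda>x. \<phi>' k x - \<phi> x)) \<longlonglongrightarrow> 0" for m
        unfolding \<phi>'_def by (rule cutoff_tendsto[OF \<phi> smooth_cutoff cutoff_eq_0 cutoff_eq_1])
      have s: "smooth (\<phi>' k)" for k
        unfolding \<phi>'_def using smooth_affine[OF smooth_cutoff, of 0 "inverse (real (Suc k))"]
        by (intro smooth_mult schwartz_imp_smooth[OF \<phi>]) simp
      have supp: "\<phi>' k x = 0" if "2 * ?n * real (Suc k) < norm x" for k x
      proof -
        have "2 * ?n < norm (x /\<^sub>R real (Suc k))" using that by (simp add: field_simps)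
        from cutoff_eq_0[OF this] show ?thesis by (simp add: \<phi>'_def)
      qed
      have cS: "\<phi>' k \<in> schwartz" for k by (rule schwartz_compact_support[OF s supp])
      have eq: "T (\<phi>' k) = (\<integral>x. f x * \<phi>' k x \<partial>lebesgue)" for k by (rule compact_case[OF s supp])
      define c where "c = (\<integral>x. norm (f x) * ?w x \<partial>lebesgue)"
      have "(\<lambda>k. (\<integral>x. f x * \<phi>' k x \<partial>lebesgue) - (\<integral>x. f x * \<phi> x \<partial>lebesgue)) \<longlonglongrightarrow> 0"
      proof (rule Lim_null_comparison)
        show "\<forall>\<^sub>F k in sequentially. norm ((\<integral>x. f x * \<phi>' k x \<partial>lebesgue) - (\<integral>x. f x * \<phi> x \<partial>lebesgue)) \<le>
            c * schwartz_norm (Suc CARD('n)) (\<lambda>x. \<phi>' k x - \<phi> x)"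
        proof (intro always_eventually allI)
          fix k
          have "(\<integral>x. f x * \<phi>' k x \<partial>lebesgue) - (\<integral>x. f x * \<phi> x \<partial>lebesgue) = (\<integral>x. f x * (\<phi>' k x - \<phi> x) \<partial>lebesgue)"
            unfolding right_diff_distrib
            by (intro Bochner_Integration.integral_diff[symmetric] WLp_schwartz_integrable(1) fWLp cS \<phi>)
          also have "norm \<dots> \<le> c * schwartz_norm (Suc CARD('n)) (\<lambda>x. \<phi>' k x - \<phi> x)"
            unfolding c_def by (intro WLp_schwartz_integrable(2) fWLp schwartz_diff cS \<phi>)
          finally show "norm ((\<integral>x. f x * \<phi>' k x \<partial>lebesgue) - (\<integral>x. f x * \<phi> x \<partial>lebesgue)) \<le> \<dots>" .
        qed
        show "(\<lambda>k. c * schwartz_norm (Suc CARD('n)) (\<lambda>x. \<phi>' k x - \<phi> x)) \<longlonglongrightarrow> 0"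
          by (rule tendsto_mult_right_zero[OF lim])
      qed
      then have "(\<lambda>k. T (\<phi>' k)) \<longlonglongrightarrow> (\<integral>x. f x * \<phi> x \<partial>lebesgue)" unfolding eq by (rule LIM_zero_cancel)
      moreover have "(\<lambda>k. T (\<phi>' k)) \<longlonglongrightarrow> T \<phi>" by (rule tempered_sequentially_continuous[OF Tt \<phi> cS lim])
      ultimately show ?thesis using LIMSEQ_unique by blast
    qed
    then have "induces f T"
      unfolding induces_def using fm WLp_locally_integrable[OF fWLp] Tt WLp_schwartz_integrable(1)[OF fWLp] by blast
    with fWLp fW show ?thesis by blast
  qed
  with B(1) show ?thesis by (intro exI[of _ "2 * B"]) auto
qed

end

text \<open>For a given \<open>f\<close> the inducing relation determines \<open>T\<close>, because
  members of \<open>tempered\<close> are extensional and the values on Schwartz functions are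
  prescribed. The third conjunct supplies the other direction, so the identification is a bijection
  modulo equality almost everywhere.\<close>

theorem corollary1p6:
  fixes p :: "real^'n \<Rightarrow> real" and N :: nat
  assumes "p \<in> log_Hoelder_exponents"
    and "p_minus p \<in> {1<..<\<infinity>}"
    and "0 < N"
    and "ereal (real CARD('n)) / p_underline p + ereal (real CARD('n)) + 1 < ereal (real N)"
  shows "(\<forall>f\<in>WLp p. \<exists>T\<in>WHp p N. induces f T)
       \<and> (\<forall>T\<in>WHp p N. \<exists>f\<in>WLp p. induces f T)
       \<and> (\<forall>f\<in>WLp p. \<forall>g\<in>WLp p. \<forall>T. induces f T \<and> induces g T \<longrightarrow> (AE x in lebesgue. f x = g x))
       \<and> (\<exists>C>0. \<forall>f\<in>WLp p. \<forall>T\<in>WHp p N. induces f T \<longrightarrow>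
              WHp_norm p N T \<le> ennreal C * WLp_norm p f \<and>
              WLp_norm p f \<le> ennreal C * WHp_norm p N T)"
proof -
  obtain C_log C_inf p_inf where p: "p \<in> borel_measurable lebesgue" "\<And>x. 0 < p x" "0 < C_log" "0 < C_inf"
    "\<And>x y. \<bar>p x - p y\<bar> \<le> C_log / ln (exp 1 + 1 / norm (x - y))"
    "\<And>x. \<bar>p x - p_inf\<bar> \<le> C_inf / ln (exp 1 + norm x)"
    using assms(1) unfolding log_Hoelder_exponents_def variable_exponents_def by auto
  have "1 < p_minus p" using assms(2) by simp
  then obtain z where z: "AE x in lebesgue. z \<le> ereal (p x)" "1 < z"
    unfolding p_minus_def less_Sup_iff by auto
  \<comment> \<open>\<open>p_minus\<close> is a supremum of extended reals; a real number strictly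
    between 1 and an admissible \<open>z\<close> serves as the lower exponent of the locale.\<close>
  obtain pm where pm: "1 < ereal pm" "ereal pm < z" using ereal_dense2[OF z(2)] by blast
  have pm_le: "AE x in lebesgue. pm \<le> p x"
    using z(1) by eventually_elim (use pm in \<open>metis ereal_less_eq(3) less_imp_le order_trans\<close>)
  have upper: "p x \<le> p_inf + C_inf" for x
  proof -
    have "ln (exp 1) \<le> ln (exp 1 + norm x)" by (intro ln_mono) auto
    then have "C_inf / ln (exp 1 + norm x) \<le> C_inf" using p(4) by (simp add: divide_le_eq mult_le_cancel_left1)
    with p(6)[of x] show ?thesis by linarith
  qed
  interpret log_hoelder_exponent p pm "p_inf + C_inf" C_log C_inf p_inf
    by unfold_locales (use p pm pm_le upper in auto)
  have "p_underline p = 1" using \<open>1 < p_minus p\<close> by (simp add: p_underline_def min_absorb2 less_imp_le)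
  then have N: "CARD('n) < N" using assms(4) by (simp add: one_ereal_def)
  obtain C1 where C1: "0 < C1" "\<And>f T. f \<in> WLp p \<Longrightarrow> induces f T \<Longrightarrow> WHp_norm p N T \<le> ennreal C1 * WLp_norm p f"
    using WHp_norm_le_WLp_norm[OF N] by blast
  obtain C2 where C2: "0 < C2" "\<And>T. T \<in> WHp p N \<Longrightarrow> \<exists>f\<in>WLp p. induces f T \<and> WLp_norm p f \<le> ennreal C2 * WHp_norm p N T"
    using WHp_induced[of N] by blast
  have 1: "\<exists>T\<in>WHp p N. induces f T" if f: "f \<in> WLp p" for f
  proof
    let ?T = "restrict (\<lambda>\<phi>. \<integral>x. f x * \<phi> x \<partial>lebesgue) schwartz"
    show ind: "induces f ?T" by (rule WLp_induces[OF f])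
    have "WHp_norm p N ?T < \<infinity>"
      using C1(2)[OF f ind] f by (auto simp: WLp_def ennreal_mult_less_top intro: le_less_trans)
    then show "?T \<in> WHp p N" using ind by (simp add: WHp_def induces_def)
  qed
  have 4: "WHp_norm p N T \<le> ennreal (max C1 C2) * WLp_norm p f \<and> WLp_norm p f \<le> ennreal (max C1 C2) * WHp_norm p N T"
    if f: "f \<in> WLp p" and T: "T \<in> WHp p N" and ind: "induces f T" for f T
  proof
    have "WHp_norm p N T \<le> ennreal C1 * WLp_norm p f" by (rule C1(2)[OF f ind])
    also have "\<dots> \<le> ennreal (max C1 C2) * WLp_norm p f" by (intro mult_right_mono ennreal_leI) auto
    finally show "WHp_norm p N T \<le> \<dots>" .
    \<comment> \<open>The function constructed from \<open>T\<close> need not be \<open>f\<close>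
      itself; uniqueness almost everywhere transfers its norm bound to \<open>f\<close>.\<close>
    obtain g where g: "g \<in> WLp p" "induces g T" "WLp_norm p g \<le> ennreal C2 * WHp_norm p N T" using C2(2)[OF T] by blast
    have "AE x in lebesgue. ennreal (norm (f x)) \<le> ennreal 1 * ennreal (norm (g x))"
      using induces_unique[OF f g(1) ind g(2)] by eventually_elim simp
    from WLp_norm_nn_mono[OF this _ p_pos] have "WLp_norm p f \<le> WLp_norm p g" by (simp add: WLp_norm_def)
    also note g(3)
    also have "ennreal C2 * WHp_norm p N T \<le> ennreal (max C1 C2) * WHp_norm p N T" by (intro mult_right_mono ennreal_leI) auto
    finally show "WLp_norm p f \<le> \<dots>" .
  qed
  show ?thesis
    using 1 C2 4 C1(1) induces_unique by (intro conjI exI[of _ "max C1 C2"]) (auto, blast+)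
qed

end
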